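(* Let $(M,Q)$ be a quaternionic complex manifold defined by a nowhere vanishing twistor function $\mu$, let $I_1$ be the complex structure induced by $\mu$, and let $\nabla^\mu$ be the $\mu$-connection. Then the first Chern class $c_{1}(M)$ of $(M,I_{1})$ is represented by the Ricci form of the $\mu$-connection; more precisely, \[ c_{1}(M)=\left[-\frac{1}{2\pi}Ric^{\nabla^{\mu}}_{I_{1}}\right], \] where $Ric^{\nabla^\mu}_{I_1}(X,Y):=Ric^{\nabla^\mu}(X,I_1Y)$ for $X,Y\in TM$.
   Context: All manifolds are smooth and without boundary. A quaternionic manifold $(M,Q)$ of dimension $4n>4$ is a manifold with a rank-3 subbundle $Q\subset \mathrm{End}(TM)$ which at every point is spanned by $I_1,I_2,I_3$ with $I_1^2=I_2^2=I_3^2=-\mathrm{id}$, $I_1I_2=-I_2I_1=I_3$ (an admissible frame), and which admits a torsion-free affine connection $\nabla$ with $\nabla_X\Gamma(Q)\subset\Gamma(Q)$ for all $X$ (a quaternionic connection; not unique). In dimension 4 it is by definition a self-dual conformal manifold ($Q$ being the rank-3 bundle spanned by the local orthogonal almost complex structures inducing the opposite orientation; quaternionic connections are the torsion-free connections preserving $Q$). $Q$ carries the metric $(A,B)=-\frac1{4n}\mathrm{Tr}(AB)$, $\|A\|=\sqrt{(A,A)}$. Twistor functions: for $s\in\mathbb{R}$ let $L^s$ be the real line bundle with transition functions $|\det(\partial x^\beta_i/\partial x^\alpha_j)|^{-s}$ between charts, so $L^s\otimes L^{s'}\cong L^{s+s'}$ and (using the canonical orientation) $L^1\cong\Lambda^{4n}T^*M$.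 A quaternionic connection $\nabla$ induces connections $\nabla^{Q,s}$ on $Q\otimes L^s$. Put $s_0=-\frac{1}{2(n+1)}$. A twistor function is a section $\mu\in\Gamma(Q\otimes L^{s_0})$ such that for one (equivalently any) quaternionic connection $\nabla$, and any local nowhere vanishing section $e$ of $L^{s_0}$, locally $\nabla^{Q,s_0}\mu=\sum_{\alpha=1}^3(\xi\circ I_\alpha)\otimes I_\alpha\otimes e$ for some one-form $\xi$. An associated pair $(e,\nu)$ consists of a volume form $\nu$ and $e\in\Gamma(L^{s_0})$ with $e^{\otimes 2(n+1)}=\nu^*\in\Gamma(L^{-1})$, $\nu^*$ dual to $\nu$. Write $\mu=\bar\mu\otimes e$, $\bar\mu\in\Gamma(Q)$. A quaternionic complex manifold is a quaternionic manifold with a nowhere vanishing twistor function $\mu$; the complex structure induced by $\mu$ is $\bar\mu/\|\bar\mu\|$ (well defined up to sign, integrable); the volume form $\nu^\mu=\|\bar\mu\|^{-2(n+1)}\nu$ does not depend on the associated pair, and the $\mu$-connection $\nabla^\mu$ is the unique quaternionic connection with $\nabla^\mu\nu^\mu=0$; its Ricci tensor is symmetric and $\nabla^\mu$ preserves the induced complex structure. $Ric^\nabla(Y,Z)=\mathrm{Tr}(X\mapsto R^\nabla_{X,Y}Z)$; $c_1$ is taken in de Rham cohomology. *)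

theory Defs
  imports "HOL-Analysis.Analysis"
begin

section \<open>Smooth manifolds given by an atlas\<close>

text \<open>
  The manifold is a whole Hausdorff second countable type \<open>'m\<close> with a smooth atlas modelled on
  \<open>real^'k\<close>, so its dimension is \<open>CARD('k)\<close>.  A chart is a pair (domain, coordinate map).
  Every geometric object is the family of its coordinate representatives, indexed by the charts
  of the atlas, subject to the transformation law under change of charts.  Such a family is
  only meaningful at charts \<open>c\<close> of the atlas and points \<open>p\<close> of the domain of \<open>c\<close>.
\<close>

type_synonym ('m, 'k) chart = "'m set \<times> ('m \<Rightarrow> real^'k)"
type_synonym ('m, 'k) atlas = "('m, 'k) chart set"
type_synonym ('m, 'k, 'v) fld = "('m, 'k) chart \<Rightarrow> 'm \<Rightarrow> 'v"

primrec Ck_on :: "nat \<Rightarrow> 'a::euclidean_space set \<Rightarrow> ('a \<Rightarrow> 'b::real_normed_vector) \<Rightarrow> bool" where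
  "Ck_on 0 S f \<longleftrightarrow> continuous_on S f"
| "Ck_on (Suc k) S f \<longleftrightarrow>
     f differentiable_on S \<and> (\<forall>v. Ck_on k S (\<lambda>x. frechet_derivative f (at x) v))"

text \<open>Only used for open \<open>S\<close>.\<close>
definition smooth_on :: "'a::euclidean_space set \<Rightarrow> ('a \<Rightarrow> 'b::real_normed_vector) \<Rightarrow> bool" where
  "smooth_on S f \<longleftrightarrow> (\<forall>k. Ck_on k S f)"

abbreviation dom_of :: "('m, 'k::finite) chart \<Rightarrow> 'm set" where
  "dom_of c \<equiv> fst c"

definition cinv :: "('m, 'k::finite) chart \<Rightarrow> real^'k \<Rightarrow> 'm" where
  "cinv c = inv_into (fst c) (snd c)"

definition is_chart :: "('m::topological_space, 'k::finite) chart \<Rightarrow> bool" where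
  "is_chart c \<longleftrightarrow> open (fst c) \<and> open (snd c ` fst c) \<and>
     homeomorphism (fst c) (snd c ` fst c) (snd c) (cinv c)"

definition smooth_atlas :: "('m::topological_space, 'k::finite) atlas \<Rightarrow> bool" where
  "smooth_atlas A \<longleftrightarrow> (\<forall>c\<in>A. is_chart c) \<and> (\<Union>c\<in>A. dom_of c) = UNIV \<and>
     (\<forall>c\<in>A. \<forall>d\<in>A. smooth_on (snd c ` (dom_of c \<inter> dom_of d)) (snd d \<circ> cinv c))"

text \<open>Smoothness on an open \<open>U \<subseteq> dom_of c\<close> and directional derivatives, read in the chart \<open>c\<close>.\<close>

definition smooth_in :: "('m, 'k::finite) chart \<Rightarrow> 'm set \<Rightarrow> ('m \<Rightarrow> 'b::real_normed_vector) \<Rightarrow> bool" where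
  "smooth_in c U f \<longleftrightarrow> smooth_on (snd c ` U) (f \<circ> cinv c)"

definition pd :: "('m, 'k::finite) chart \<Rightarrow> ('m \<Rightarrow> 'b::real_normed_vector) \<Rightarrow> real^'k \<Rightarrow> 'm \<Rightarrow> 'b" where
  "pd c f u p = frechet_derivative (f \<circ> cinv c) (at (snd c p)) u"

text \<open>\<open>jac c d p\<close> takes the \<open>c\<close>-components of a tangent vector at \<open>p\<close> to its \<open>d\<close>-components.\<close>

definition jac :: "('m, 'k::finite) chart \<Rightarrow> ('m, 'k) chart \<Rightarrow> 'm \<Rightarrow> real^'k^'k" where
  "jac c d p = jacobian (snd d \<circ> cinv c) (at (snd c p))"

definition transp_end :: "('m, 'k::finite) chart \<Rightarrow> ('m, 'k) chart \<Rightarrow> 'm \<Rightarrow> real^'k^'k \<Rightarrow> real^'k^'k" where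
  "transp_end c d p T = jac c d p ** T ** jac d c p"

section \<open>Tensor fields and connections\<close>

definition endo_field :: "('m::topological_space, 'k::finite) atlas \<Rightarrow> ('m, 'k, real^'k^'k) fld \<Rightarrow> bool" where
  "endo_field A J \<longleftrightarrow> (\<forall>c\<in>A. smooth_in c (dom_of c) (J c)) \<and>
     (\<forall>c\<in>A. \<forall>d\<in>A. \<forall>p\<in>dom_of c \<inter> dom_of d. J d p = transp_end c d p (J c p))"

text \<open>
  An affine connection is given by \<open>\<nabla>\<^sub>u Y = \<partial>\<^sub>u Y + \<Gamma>(u) Y\<close> in each chart, where \<open>\<Gamma> c p u\<close> is
  the matrix of Christoffel symbols.
\<close>

type_synonym ('m, 'k) conn = "('m, 'k, real^'k \<Rightarrow> real^'k^'k) fld"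

definition affine_connection :: "('m::topological_space, 'k::finite) atlas \<Rightarrow> ('m, 'k) conn \<Rightarrow> bool" where
  "affine_connection A \<Gamma> \<longleftrightarrow>
     (\<forall>c\<in>A. \<forall>p\<in>dom_of c. linear (\<Gamma> c p)) \<and>
     (\<forall>c\<in>A. \<forall>u. smooth_in c (dom_of c) (\<lambda>p. \<Gamma> c p u)) \<and>
     (\<forall>c\<in>A. \<forall>d\<in>A. \<forall>p\<in>dom_of c \<inter> dom_of d. \<forall>u v.
        jac c d p *v (\<Gamma> c p u *v v) =
          pd c (\<lambda>q. jac c d q *v v) u p + \<Gamma> d p (jac c d p *v u) *v (jac c d p *v v))"

definition torsion_free :: "('m::topological_space, 'k::finite) atlas \<Rightarrow> ('m, 'k) conn \<Rightarrow> bool" where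
  "torsion_free A \<Gamma> \<longleftrightarrow> (\<forall>c\<in>A. \<forall>p\<in>dom_of c. \<forall>u v. \<Gamma> c p u *v v = \<Gamma> c p v *v u)"

definition cov_end :: "('m, 'k::finite) conn \<Rightarrow> ('m, 'k) chart \<Rightarrow> ('m \<Rightarrow> real^'k^'k) \<Rightarrow> real^'k \<Rightarrow> 'm \<Rightarrow> real^'k^'k" where
  "cov_end \<Gamma> c J u p = pd c J u p + \<Gamma> c p u ** J p - J p ** \<Gamma> c p u"

text \<open>\<open>R\<^sub>u\<^sub>,\<^sub>v = [\<nabla>\<^sub>u, \<nabla>\<^sub>v] - \<nabla>\<^sub>[\<^sub>u\<^sub>,\<^sub>v\<^sub>]\<close>, evaluated on coordinate (constant coefficient) fields.\<close>

definition curv :: "('m, 'k::finite) conn \<Rightarrow> ('m, 'k) chart \<Rightarrow> 'm \<Rightarrow> real^'k \<Rightarrow> real^'k \<Rightarrow> real^'k^'k" where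
  "curv \<Gamma> c p u v = pd c (\<lambda>q. \<Gamma> c q v) u p - pd c (\<lambda>q. \<Gamma> c q u) v p
     + \<Gamma> c p u ** \<Gamma> c p v - \<Gamma> c p v ** \<Gamma> c p u"

definition Ric :: "('m, 'k::finite) conn \<Rightarrow> ('m, 'k) chart \<Rightarrow> 'm \<Rightarrow> real^'k \<Rightarrow> real^'k \<Rightarrow> real" where
  "Ric \<Gamma> c p Y Z = trace (matrix (\<lambda>X. curv \<Gamma> c p X Y *v Z))"

section \<open>Density bundles and sections of \<open>Q \<otimes> L\<^sup>s\<close>\<close>

text \<open>
  A section of \<open>L\<^sup>s\<close> is the family of its coefficients; for \<open>s = 1\<close> the law is, up to the absolute
  value, that of the coefficient of a top-degree form.  Via the canonical orientation of a
  quaternionic manifold the positive volume forms are thus the positive sections of \<open>L\<^sup>1\<close>.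
\<close>

definition section_L :: "('m::topological_space, 'k::finite) atlas \<Rightarrow> real \<Rightarrow> ('m, 'k, real) fld \<Rightarrow> bool" where
  "section_L A s f \<longleftrightarrow> (\<forall>c\<in>A. smooth_in c (dom_of c) (f c)) \<and>
     (\<forall>c\<in>A. \<forall>d\<in>A. \<forall>p\<in>dom_of c \<inter> dom_of d. f d p = \<bar>det (jac c d p)\<bar> powr (- s) * f c p)"

text \<open>The connection induced on \<open>L\<^sup>s\<close>; for \<open>s = 1\<close> it is the one on top-degree forms.\<close>

definition cov_L :: "('m, 'k::finite) conn \<Rightarrow> real \<Rightarrow> ('m, 'k) chart \<Rightarrow> ('m \<Rightarrow> real) \<Rightarrow> real^'k \<Rightarrow> 'm \<Rightarrow> real" where
  "cov_L \<Gamma> s c f u p = pd c f u p - s * trace (\<Gamma> c p u) * f p"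

type_synonym ('m, 'k) qbundle = "('m, 'k, (real^'k^'k) set) fld"

definition section_Q :: "('m::topological_space, 'k::finite) atlas \<Rightarrow> ('m, 'k) qbundle \<Rightarrow> ('m, 'k, real^'k^'k) fld \<Rightarrow> bool" where
  "section_Q A Q J \<longleftrightarrow> endo_field A J \<and> (\<forall>c\<in>A. \<forall>p\<in>dom_of c. J c p \<in> Q c p)"

definition section_QL :: "('m::topological_space, 'k::finite) atlas \<Rightarrow> ('m, 'k) qbundle \<Rightarrow> real \<Rightarrow> ('m, 'k, real^'k^'k) fld \<Rightarrow> bool" where
  "section_QL A Q s \<mu> \<longleftrightarrow> (\<forall>c\<in>A. smooth_in c (dom_of c) (\<mu> c)) \<and>
     (\<forall>c\<in>A. \<forall>p\<in>dom_of c. \<mu> c p \<in> Q c p) \<and>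
     (\<forall>c\<in>A. \<forall>d\<in>A. \<forall>p\<in>dom_of c \<inter> dom_of d.
        \<mu> d p = (\<bar>det (jac c d p)\<bar> powr (- s)) *\<^sub>R transp_end c d p (\<mu> c p))"

text \<open>The connection \<open>\<nabla>\<^sup>Q\<^sup>,\<^sup>s\<close> on \<open>Q \<otimes> L\<^sup>s\<close>: tensor product of those on \<open>Q\<close> and on \<open>L\<^sup>s\<close>.\<close>

definition cov_QL :: "('m, 'k::finite) conn \<Rightarrow> real \<Rightarrow> ('m, 'k) chart \<Rightarrow> ('m \<Rightarrow> real^'k^'k) \<Rightarrow> real^'k \<Rightarrow> 'm \<Rightarrow> real^'k^'k" where
  "cov_QL \<Gamma> s c \<mu> u p = cov_end \<Gamma> c \<mu> u p - (s * trace (\<Gamma> c p u)) *\<^sub>R \<mu> p"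

section \<open>Quaternionic manifolds\<close>

definition admissible_frame :: "(real^'k^'k) set \<Rightarrow> real^'k^'k \<Rightarrow> real^'k^'k \<Rightarrow> real^'k^'k \<Rightarrow> bool" where
  "admissible_frame V I1 I2 I3 \<longleftrightarrow>
     I1 ** I1 = - mat 1 \<and> I2 ** I2 = - mat 1 \<and> I3 ** I3 = - mat 1 \<and>
     I1 ** I2 = I3 \<and> - (I2 ** I1) = I3 \<and> V = span {I1, I2, I3}"

definition rank3_subbundle :: "('m::topological_space, 'k::finite) atlas \<Rightarrow> ('m, 'k) qbundle \<Rightarrow> bool" where
  "rank3_subbundle A Q \<longleftrightarrow>
     (\<forall>c\<in>A. \<forall>d\<in>A. \<forall>p\<in>dom_of c \<inter> dom_of d. Q d p = transp_end c d p ` Q c p) \<and>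
     (\<forall>c\<in>A. \<forall>p\<in>dom_of c. \<exists>U. open U \<and> p \<in> U \<and> U \<subseteq> dom_of c \<and>
        (\<exists>s1 s2 s3. smooth_in c U s1 \<and> smooth_in c U s2 \<and> smooth_in c U s3 \<and>
          (\<forall>q\<in>U. independent {s1 q, s2 q, s3 q} \<and> card {s1 q, s2 q, s3 q} = 3 \<and>
                 Q c q = span {s1 q, s2 q, s3 q})))"

definition almost_quaternionic :: "('m::topological_space, 'k::finite) atlas \<Rightarrow> ('m, 'k) qbundle \<Rightarrow> bool" where
  "almost_quaternionic A Q \<longleftrightarrow> rank3_subbundle A Q \<and>
     (\<forall>c\<in>A. \<forall>p\<in>dom_of c. \<exists>I1 I2 I3. admissible_frame (Q c p) I1 I2 I3)"

text \<open>\<open>\<nabla>\<^sub>X \<Gamma>(Q) \<subseteq> \<Gamma>(Q)\<close>, tested on local sections of \<open>Q\<close>.\<close>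

definition preserves_Q :: "('m::topological_space, 'k::finite) atlas \<Rightarrow> ('m, 'k) qbundle \<Rightarrow> ('m, 'k) conn \<Rightarrow> bool" where
  "preserves_Q A Q \<Gamma> \<longleftrightarrow>
     (\<forall>c\<in>A. \<forall>U J. open U \<and> U \<subseteq> dom_of c \<and> smooth_in c U J \<and> (\<forall>p\<in>U. J p \<in> Q c p) \<longrightarrow>
        (\<forall>p\<in>U. \<forall>u. cov_end \<Gamma> c J u p \<in> Q c p))"

definition quaternionic_connection :: "('m::topological_space, 'k::finite) atlas \<Rightarrow> ('m, 'k) qbundle \<Rightarrow> ('m, 'k) conn \<Rightarrow> bool" where
  "quaternionic_connection A Q \<Gamma> \<longleftrightarrow> affine_connection A \<Gamma> \<and> torsion_free A \<Gamma> \<and> preserves_Q A Q \<Gamma>"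

subsection \<open>Dimension four: self-dual conformal manifolds\<close>

definition riemannian_metric :: "('m::topological_space, 'k::finite) atlas \<Rightarrow> ('m, 'k, real^'k \<Rightarrow> real^'k \<Rightarrow> real) fld \<Rightarrow> bool" where
  "riemannian_metric A g \<longleftrightarrow>
     (\<forall>c\<in>A. \<forall>p\<in>dom_of c. bilinear (g c p) \<and> (\<forall>X Y. g c p X Y = g c p Y X) \<and> (\<forall>X. X \<noteq> 0 \<longrightarrow> g c p X X > 0)) \<and>
     (\<forall>c\<in>A. \<forall>X Y. smooth_in c (dom_of c) (\<lambda>p. g c p X Y)) \<and>
     (\<forall>c\<in>A. \<forall>d\<in>A. \<forall>p\<in>dom_of c \<inter> dom_of d. \<forall>X Y.
        g c p X Y = g d p (jac c d p *v X) (jac c d p *v Y))"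

definition levi_civita :: "('m::topological_space, 'k::finite) atlas \<Rightarrow> ('m, 'k, real^'k \<Rightarrow> real^'k \<Rightarrow> real) fld \<Rightarrow> ('m, 'k) conn \<Rightarrow> bool" where
  "levi_civita A g \<Gamma> \<longleftrightarrow> affine_connection A \<Gamma> \<and> torsion_free A \<Gamma> \<and>
     (\<forall>c\<in>A. \<forall>p\<in>dom_of c. \<forall>u X Y.
        pd c (\<lambda>q. g c q X Y) u p = g c p (\<Gamma> c p u *v X) Y + g c p X (\<Gamma> c p u *v Y))"

text \<open>A nowhere vanishing 4-form; only its orientation class matters below.\<close>

definition orientation_form :: "('m::topological_space, 'k::finite) atlas \<Rightarrow> ('m, 'k, real^'k \<Rightarrow> real^'k \<Rightarrow> real^'k \<Rightarrow> real^'k \<Rightarrow> real) fld \<Rightarrow> bool" where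
  "orientation_form A w \<longleftrightarrow>
     (\<forall>c\<in>A. \<forall>p\<in>dom_of c.
        (\<forall>x y z. linear (\<lambda>t. w c p t x y z) \<and> linear (\<lambda>t. w c p x t y z) \<and>
                 linear (\<lambda>t. w c p x y t z) \<and> linear (\<lambda>t. w c p x y z t)) \<and>
        (\<forall>x y z. w c p x x y z = 0 \<and> w c p x y y z = 0 \<and> w c p x y z z = 0) \<and>
        (\<exists>x y z t. w c p x y z t \<noteq> 0)) \<and>
     (\<forall>c\<in>A. \<forall>x y z t. smooth_in c (dom_of c) (\<lambda>p. w c p x y z t)) \<and>
     (\<forall>c\<in>A. \<forall>d\<in>A. \<forall>p\<in>dom_of c \<inter> dom_of d. \<forall>x y z t.
        w c p x y z t = w d p (jac c d p *v x) (jac c d p *v y) (jac c d p *v z) (jac c d p *v t))"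

text \<open>Weyl tensor in dimension 4, with one index lowered; \<open>sc\<close> is the scalar curvature.\<close>

definition weyl4 :: "('m, 'k::finite, real^'k \<Rightarrow> real^'k \<Rightarrow> real) fld \<Rightarrow> ('m, 'k) conn \<Rightarrow> real \<Rightarrow>
    ('m, 'k) chart \<Rightarrow> 'm \<Rightarrow> real^'k \<Rightarrow> real^'k \<Rightarrow> real^'k \<Rightarrow> real^'k \<Rightarrow> real" where
  "weyl4 g \<Gamma> sc c p X Y Z V =
     g c p (curv \<Gamma> c p X Y *v Z) V
     - (1/2) * (Ric \<Gamma> c p Y Z * g c p X V - Ric \<Gamma> c p X Z * g c p Y V
                + g c p Y Z * Ric \<Gamma> c p X V - g c p X Z * Ric \<Gamma> c p Y V)
     + (sc / 6) * (g c p Y Z * g c p X V - g c p X Z * g c p Y V)"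

text \<open>
  \<open>W\<close> is self-dual (\<open>W\<^sup>- = 0\<close>): \<open>W(*\<beta>) = W(\<beta>)\<close> for 2-vectors \<open>\<beta>\<close>, where \<open>*(e\<^sub>0 \<and> e\<^sub>1) = e\<^sub>2 \<and> e\<^sub>3\<close> for
  every positively oriented orthonormal frame.
\<close>

definition self_dual :: "('m::topological_space, 'k::finite) atlas \<Rightarrow> ('m, 'k, real^'k \<Rightarrow> real^'k \<Rightarrow> real) fld \<Rightarrow>
    ('m, 'k, real^'k \<Rightarrow> real^'k \<Rightarrow> real^'k \<Rightarrow> real^'k \<Rightarrow> real) fld \<Rightarrow> bool" where
  "self_dual A g w \<longleftrightarrow> (\<exists>\<Gamma>. levi_civita A g \<Gamma> \<and>
     (\<forall>c\<in>A. \<forall>p\<in>dom_of c. \<forall>e :: nat \<Rightarrow> real^'k.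
        (\<forall>i<4. \<forall>j<4. g c p (e i) (e j) = (if i = j then 1 else 0)) \<and> w c p (e 0) (e 1) (e 2) (e 3) > 0 \<longrightarrow>
        (let sc = (\<Sum>i<4. Ric \<Gamma> c p (e i) (e i)) in
          \<forall>Z V. weyl4 g \<Gamma> sc c p (e 0) (e 1) Z V = weyl4 g \<Gamma> sc c p (e 2) (e 3) Z V)))"

text \<open>
  \<open>Q\<close> is spanned by the \<open>g\<close>-orthogonal complex structures \<open>J\<close> inducing the orientation opposite to
  that of \<open>w\<close>, i.e. such that \<open>(X, JX, Y, JY)\<close> is negative whenever it is a basis.
\<close>

definition self_dual_conformal :: "('m::topological_space, 'k::finite) atlas \<Rightarrow> ('m, 'k) qbundle \<Rightarrow> bool" where
  "self_dual_conformal A Q \<longleftrightarrow> (\<exists>g w. riemannian_metric A g \<and> orientation_form A w \<and> self_dual A g w \<and>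
     (\<forall>c\<in>A. \<forall>p\<in>dom_of c. Q c p =
        span {J. J ** J = - mat 1 \<and> (\<forall>X Y. g c p (J *v X) (J *v Y) = g c p X Y) \<and>
                 (\<forall>X Y. w c p X (J *v X) Y (J *v Y) \<le> 0)}))"

definition quaternionic_manifold :: "nat \<Rightarrow> ('m::{t2_space,second_countable_topology}, 'k::finite) atlas \<Rightarrow> ('m, 'k) qbundle \<Rightarrow> bool" where
  "quaternionic_manifold n A Q \<longleftrightarrow> 1 \<le> n \<and> CARD('k) = 4 * n \<and> smooth_atlas A \<and> almost_quaternionic A Q \<and>
     (if n = 1 then self_dual_conformal A Q else \<exists>\<Gamma>. quaternionic_connection A Q \<Gamma>)"

section \<open>Twistor functions and the induced structures\<close>

definition s0 :: "nat \<Rightarrow> real" where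
  "s0 n = - 1 / (2 * (real n + 1))"

definition twistor_equation :: "nat \<Rightarrow> ('m::topological_space, 'k::finite) atlas \<Rightarrow> ('m, 'k) qbundle \<Rightarrow> ('m, 'k) conn \<Rightarrow> ('m, 'k, real^'k^'k) fld \<Rightarrow> bool" where
  "twistor_equation n A Q \<Gamma> \<mu> \<longleftrightarrow>
     (\<forall>c\<in>A. \<forall>U e. open U \<and> U \<subseteq> dom_of c \<and> smooth_in c U e \<and> (\<forall>p\<in>U. e p \<noteq> (0::real)) \<longrightarrow>
       (\<exists>\<xi> :: 'm \<Rightarrow> real^'k \<Rightarrow> real.
          (\<forall>p\<in>U. linear (\<xi> p)) \<and> (\<forall>u. smooth_in c U (\<lambda>p. \<xi> p u)) \<and>
          (\<forall>p\<in>U. \<forall>I1 I2 I3. admissible_frame (Q c p) I1 I2 I3 \<longrightarrow>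
             (\<forall>u. cov_QL \<Gamma> (s0 n) c (\<mu> c) u p =
                e p *\<^sub>R (\<xi> p (I1 *v u) *\<^sub>R I1 + \<xi> p (I2 *v u) *\<^sub>R I2 + \<xi> p (I3 *v u) *\<^sub>R I3)))))"

definition twistor_function :: "nat \<Rightarrow> ('m::topological_space, 'k::finite) atlas \<Rightarrow> ('m, 'k) qbundle \<Rightarrow> ('m, 'k, real^'k^'k) fld \<Rightarrow> bool" where
  "twistor_function n A Q \<mu> \<longleftrightarrow> section_QL A Q (s0 n) \<mu> \<and>
     (\<exists>\<Gamma>. quaternionic_connection A Q \<Gamma> \<and> twistor_equation n A Q \<Gamma> \<mu>)"

definition quaternionic_complex_manifold :: "nat \<Rightarrow> ('m::{t2_space,second_countable_topology}, 'k::finite) atlas \<Rightarrow> ('m, 'k) qbundle \<Rightarrow> ('m, 'k, real^'k^'k) fld \<Rightarrow> bool" where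
  "quaternionic_complex_manifold n A Q \<mu> \<longleftrightarrow> quaternionic_manifold n A Q \<and> twistor_function n A Q \<mu> \<and>
     (\<forall>c\<in>A. \<forall>p\<in>dom_of c. \<mu> c p \<noteq> 0)"

definition qnorm :: "real^'k^'k \<Rightarrow> real" where
  "qnorm T = sqrt (- (1 / real CARD('k)) * trace (T ** T))"

text \<open>
  The equation \<open>e\<^sup>2\<^sup>(\<^sup>n\<^sup>+\<^sup>1\<^sup>) = \<nu>\<^sup>*\<close> forces \<open>\<nu> > 0\<close>, so representing volume forms by sections of \<open>L\<^sup>1\<close>
  loses nothing.
\<close>

definition associated_pair :: "nat \<Rightarrow> ('m::topological_space, 'k::finite) atlas \<Rightarrow> ('m, 'k, real) fld \<Rightarrow> ('m, 'k, real) fld \<Rightarrow> bool" where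
  "associated_pair n A e \<nu> \<longleftrightarrow> section_L A (s0 n) e \<and> section_L A 1 \<nu> \<and>
     (\<forall>c\<in>A. \<forall>p\<in>dom_of c. \<nu> c p \<noteq> 0 \<and> e c p ^ (2 * (n + 1)) = 1 / \<nu> c p)"

text \<open>\<open>\<mu> = \<mu>' \<otimes> e\<close> with respect to the associated pair \<open>(e, \<nu>)\<close>.\<close>

definition mu_decomposition :: "nat \<Rightarrow> ('m::topological_space, 'k::finite) atlas \<Rightarrow> ('m, 'k) qbundle \<Rightarrow> ('m, 'k, real^'k^'k) fld \<Rightarrow>
    ('m, 'k, real) fld \<Rightarrow> ('m, 'k, real) fld \<Rightarrow> ('m, 'k, real^'k^'k) fld \<Rightarrow> bool" where
  "mu_decomposition n A Q \<mu> e \<nu> \<mu>' \<longleftrightarrow> associated_pair n A e \<nu> \<and> section_Q A Q \<mu>' \<and>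
     (\<forall>c\<in>A. \<forall>p\<in>dom_of c. \<mu> c p = e c p *\<^sub>R \<mu>' c p)"

text \<open>Both signs of the induced complex structure occur, since \<open>(-e, \<nu>)\<close> is also an associated pair.\<close>

definition induced_complex_structure :: "nat \<Rightarrow> ('m::topological_space, 'k::finite) atlas \<Rightarrow> ('m, 'k) qbundle \<Rightarrow> ('m, 'k, real^'k^'k) fld \<Rightarrow> ('m, 'k, real^'k^'k) fld \<Rightarrow> bool" where
  "induced_complex_structure n A Q \<mu> I \<longleftrightarrow> (\<exists>e \<nu> \<mu>'. mu_decomposition n A Q \<mu> e \<nu> \<mu>' \<and>
     (\<forall>c\<in>A. \<forall>p\<in>dom_of c. I c p = (1 / qnorm (\<mu>' c p)) *\<^sub>R \<mu>' c p))"

definition mu_volume :: "nat \<Rightarrow> ('m::topological_space, 'k::finite) atlas \<Rightarrow> ('m, 'k) qbundle \<Rightarrow> ('m, 'k, real^'k^'k) fld \<Rightarrow> ('m, 'k, real) fld \<Rightarrow> bool" where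
  "mu_volume n A Q \<mu> \<nu>\<mu> \<longleftrightarrow> (\<exists>e \<nu> \<mu>'. mu_decomposition n A Q \<mu> e \<nu> \<mu>' \<and>
     (\<forall>c\<in>A. \<forall>p\<in>dom_of c. \<nu>\<mu> c p = \<nu> c p / qnorm (\<mu>' c p) ^ (2 * (n + 1))))"

definition mu_connection :: "nat \<Rightarrow> ('m::topological_space, 'k::finite) atlas \<Rightarrow> ('m, 'k) qbundle \<Rightarrow> ('m, 'k, real^'k^'k) fld \<Rightarrow> ('m, 'k) conn \<Rightarrow> bool" where
  "mu_connection n A Q \<mu> \<Gamma> \<longleftrightarrow> quaternionic_connection A Q \<Gamma> \<and>
     (\<exists>\<nu>\<mu>. mu_volume n A Q \<mu> \<nu>\<mu> \<and> (\<forall>c\<in>A. \<forall>p\<in>dom_of c. \<forall>u. cov_L \<Gamma> 1 c (\<nu>\<mu> c) u p = 0))"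

section \<open>De Rham cohomology in degree two and the first Chern class\<close>

text \<open>Forms are complex valued; \<open>H\<^sup>2(M, \<real>)\<close> embeds into the resulting \<open>H\<^sup>2(M, \<complex>)\<close>.\<close>

type_synonym ('m, 'k) form1 = "('m, 'k, real^'k \<Rightarrow> complex) fld"
type_synonym ('m, 'k) form2 = "('m, 'k, real^'k \<Rightarrow> real^'k \<Rightarrow> complex) fld"

definition one_form :: "('m::topological_space, 'k::finite) atlas \<Rightarrow> ('m, 'k) form1 \<Rightarrow> bool" where
  "one_form A \<eta> \<longleftrightarrow>
     (\<forall>c\<in>A. \<forall>p\<in>dom_of c. linear (\<eta> c p)) \<and>
     (\<forall>c\<in>A. \<forall>u. smooth_in c (dom_of c) (\<lambda>p. \<eta> c p u)) \<and>
     (\<forall>c\<in>A. \<forall>d\<in>A. \<forall>p\<in>dom_of c \<inter> dom_of d. \<forall>u. \<eta> c p u = \<eta> d p (jac c d p *v u))"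

definition two_form :: "('m::topological_space, 'k::finite) atlas \<Rightarrow> ('m, 'k) form2 \<Rightarrow> bool" where
  "two_form A \<omega> \<longleftrightarrow>
     (\<forall>c\<in>A. \<forall>p\<in>dom_of c. bilinear (\<omega> c p) \<and> (\<forall>u. \<omega> c p u u = 0)) \<and>
     (\<forall>c\<in>A. \<forall>u v. smooth_in c (dom_of c) (\<lambda>p. \<omega> c p u v)) \<and>
     (\<forall>c\<in>A. \<forall>d\<in>A. \<forall>p\<in>dom_of c \<inter> dom_of d. \<forall>u v.
        \<omega> c p u v = \<omega> d p (jac c d p *v u) (jac c d p *v v))"

definition closed_two_form :: "('m::topological_space, 'k::finite) atlas \<Rightarrow> ('m, 'k) form2 \<Rightarrow> bool" where
  "closed_two_form A \<omega> \<longleftrightarrow> two_form A \<omega> \<and>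
     (\<forall>c\<in>A. \<forall>p\<in>dom_of c. \<forall>u v w.
        pd c (\<lambda>q. \<omega> c q v w) u p - pd c (\<lambda>q. \<omega> c q u w) v p + pd c (\<lambda>q. \<omega> c q u v) w p = 0)"

definition cohomologous :: "('m::topological_space, 'k::finite) atlas \<Rightarrow> ('m, 'k) form2 \<Rightarrow> ('m, 'k) form2 \<Rightarrow> bool" where
  "cohomologous A \<omega> \<omega>' \<longleftrightarrow> (\<exists>\<eta>. one_form A \<eta> \<and>
     (\<forall>c\<in>A. \<forall>p\<in>dom_of c. \<forall>u v.
        \<omega> c p u v - \<omega>' c p u v = pd c (\<lambda>q. \<eta> c q v) u p - pd c (\<lambda>q. \<eta> c q u) v p))"

definition derham_class :: "('m::topological_space, 'k::finite) atlas \<Rightarrow> ('m, 'k) form2 \<Rightarrow> ('m, 'k) form2 set" where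
  "derham_class A \<omega> = {\<omega>'. closed_two_form A \<omega>' \<and> cohomologous A \<omega>' \<omega>}"

text \<open>
  Complex trace of a complex linear endomorphism \<open>T\<close> of \<open>(real^'k, J)\<close>: the coordinates of \<open>v\<close> in
  the complex basis \<open>B\<close> are read off from the real basis \<open>B \<union> J B\<close>.
\<close>

definition complex_basis :: "real^'k^'k \<Rightarrow> (real^'k::finite) set \<Rightarrow> bool" where
  "complex_basis J B \<longleftrightarrow> B \<inter> (*v) J ` B = {} \<and> independent (B \<union> (*v) J ` B) \<and> span (B \<union> (*v) J ` B) = UNIV"

definition complex_coord :: "real^'k^'k \<Rightarrow> (real^'k::finite) set \<Rightarrow> real^'k \<Rightarrow> real^'k \<Rightarrow> complex" where
  "complex_coord J B v b = Complex (representation (B \<union> (*v) J ` B) v b) (representation (B \<union> (*v) J ` B) v (J *v b))"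

definition complex_trace :: "real^'k^'k \<Rightarrow> real^'k^'k::finite \<Rightarrow> complex" where
  "complex_trace J T = (let B = (SOME B. complex_basis J B) in \<Sum>b\<in>B. complex_coord J B (T *v b) b)"

text \<open>A connection on \<open>TM\<close> as a complex vector bundle \<open>(TM, I)\<close>; torsion is allowed.\<close>

definition complex_connection :: "('m::topological_space, 'k::finite) atlas \<Rightarrow> ('m, 'k, real^'k^'k) fld \<Rightarrow> ('m, 'k) conn \<Rightarrow> bool" where
  "complex_connection A I D \<longleftrightarrow> affine_connection A D \<and>
     (\<forall>c\<in>A. \<forall>p\<in>dom_of c. \<forall>u. cov_end D c (I c) u p = 0)"

definition chern_form :: "('m, 'k::finite, real^'k^'k) fld \<Rightarrow> ('m, 'k) conn \<Rightarrow> ('m, 'k) form2" where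
  "chern_form I D c p u v = (\<i> / (2 * of_real pi)) * complex_trace (I c p) (curv D c p u v)"

text \<open>
  Chern-Weil definition of \<open>c\<^sub>1(TM, I)\<close>.  The union over all complex connections avoids choosing
  one; that it is a single class is the independence of the choice.
\<close>

definition first_chern_class :: "('m::topological_space, 'k::finite) atlas \<Rightarrow> ('m, 'k, real^'k^'k) fld \<Rightarrow> ('m, 'k) form2 set" where
  "first_chern_class A I = (\<Union>D\<in>{D. complex_connection A I D}. derham_class A (chern_form I D))"

definition ricci_form :: "('m, 'k::finite, real^'k^'k) fld \<Rightarrow> ('m, 'k) conn \<Rightarrow> ('m, 'k, real^'k \<Rightarrow> real^'k \<Rightarrow> real) fld" where
  "ricci_form I \<Gamma> c p X Y = Ric \<Gamma> c p X (I c p *v Y)"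

end

(* The Chern-Weil form of any connection preserving I_1 has the class of that of the mu-connection, because
   the difference of two such connections is a global 1-form with values in the I_1-linear endomorphisms.

   Write mu = f I_1, so that nu^mu = f^(-2(n+1)) and f is parallel for the connection induced by nabla^mu.
   A twistor connection differs from nabla^mu by a symmetric D with [D, Q] in Q.  Tracing the symmetry of D
   against the frame determines the Q-part of D by tr D, and the twistor equation then forces nabla^mu I_1 = 0.

   As the curvature R is trace free and commutes with I_1, the Chern form is tr(I_1 R)/(4 pi), and the first
   Bianchi identity gives tr(I_1 R(X,Y)) = Ric(Y, I_1 X) - Ric(X, I_1 Y).  It remains to see that Ric is
   I_1-invariant.  For n > 1 this follows from the same trace identity for I_2 and I_3, where
   [R, I_2] = Omega I_3: the form W(X,Y) = Ric(X, I_2 Y) - Ric(Y, I_2 X) satisfies W = (2n-1)^2 W.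
   For n = 1 the operators R(X,Y) are skew for a Hermitian metric, so R has pair symmetry, as on a Kaehler
   surface. *)
theory Submission
  imports Defs
begin

section \<open>Calculus in charts\<close>

text \<open>A twistor function satisfies its equation for some quaternionic connection that is not
  specified further, hence the detour through the difference D. The argument closes because f is
  parallel: in the twistor equation for the other connection the weight s0 then only sees tr D, and
  tr D also governs the part of D along the frame.

  The constant 1/(4 pi) is i/(2 pi) times the factor -i/2 in tr_C T = (tr T - i tr(I_1 T)) / 2.
  Forms are complex valued, and a connection preserving I_1 may have curvature of nonzero real
  trace; this shows up as an imaginary term of its Chern form, which has to be exact as well.

  The case n = 1 requires its own argument because W = (2n-1)^2 W is then a tautology. The skewness
  of R(X,Y), in turn, rests on x, I_1 x, I_2 x, I_3 x being a basis, which is special to dimension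
  four.\<close>

lemma frechet_derivative_cong_open:
  assumes "open S" "x \<in> S" "\<And>y. y \<in> S \<Longrightarrow> f y = g y"
  shows "frechet_derivative f (at x) = frechet_derivative g (at x)"
proof -
  have "(f has_derivative D) (at x) \<longleftrightarrow> (g has_derivative D) (at x)" for D
    using assms by (metis has_derivative_transform_within_open)
  then show ?thesis by (simp add: frechet_derivative_def)
qed

text \<open>On an open set the Frechet derivative depends only on the values of the function on that
  set, so the induction passes to the derivatives.\<close>

lemma Ck_on_cong:
  assumes "open S" "\<And>x. x \<in> S \<Longrightarrow> f x = g x"
  shows "Ck_on k S f \<longleftrightarrow> Ck_on k S g"
  using assms(2)
proof (induction k arbitrary: f g)
  case 0
  then show ?case by (simp cong: continuous_on_cong)
next
  case (Suc k)
  have "Ck_on k S (\<lambda>x. frechet_derivative f (at x) v) = Ck_on k S (\<lambda>x. frechet_derivative g (at x) v)" for v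
    using frechet_derivative_cong_open[OF assms(1), of _ f g] Suc by (intro Suc.IH) metis
  moreover have "f differentiable_on S \<longleftrightarrow> g differentiable_on S"
    using Suc.prems assms(1) has_derivative_transform_within_open[OF _ assms(1)]
    unfolding differentiable_on_eq_differentiable_at[OF assms(1)] differentiable_def by (metis (no_types, lifting))
  ultimately show ?case by simp
qed

lemma Ck_on_SucD: "Ck_on (Suc k) S f \<Longrightarrow> Ck_on k S f"
proof (induction k arbitrary: f)
  case 0
  then show ?case by (simp add: differentiable_imp_continuous_on)
next
  case (Suc k)
  then show ?case by (metis Ck_on.simps(2))
qed

lemma Ck_on_subset: "Ck_on k S f \<Longrightarrow> T \<subseteq> S \<Longrightarrow> Ck_on k T f"
  by (induction k arbitrary: f) (auto intro: continuous_on_subset differentiable_on_subset)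

lemma smooth_on_cong:
  "open S \<Longrightarrow> (\<And>x. x \<in> S \<Longrightarrow> f x = g x) \<Longrightarrow> smooth_on S f \<longleftrightarrow> smooth_on S g"
  using Ck_on_cong unfolding smooth_on_def by blast

lemma smooth_on_subset: "smooth_on S f \<Longrightarrow> T \<subseteq> S \<Longrightarrow> smooth_on T f"
  using Ck_on_subset unfolding smooth_on_def by blast

lemma smooth_on_differentiable:
  assumes "smooth_on S f" "open S" "x \<in> S"
  shows "f differentiable (at x)"
proof -
  have "Ck_on (Suc 0) S f" using assms unfolding smooth_on_def by blast
  then show ?thesis using assms by (simp add: differentiable_on_eq_differentiable_at)
qed

lemma smooth_on_frechet: "smooth_on S f \<Longrightarrow> smooth_on S (\<lambda>x. frechet_derivative f (at x) v)"
  unfolding smooth_on_def by (metis Ck_on.simps(2))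

section \<open>Closure of the classes C^k and C^infinity under sums, products and real
  powers\<close>

lemma Ck_on_const: "Ck_on k S (\<lambda>x. c)"
  by (induction k arbitrary: c) auto

lemmas frechet_derivative_worksI = iffD1[OF frechet_derivative_works]

lemma Ck_on_add:
  assumes "open S" shows "Ck_on k S f \<Longrightarrow> Ck_on k S g \<Longrightarrow> Ck_on k S (\<lambda>x. f x + g x)"
proof (induction k arbitrary: f g)
  case 0
  then show ?case by (simp add: continuous_on_add)
next
  case (Suc k)
  have d: "f differentiable (at x)" "g differentiable (at x)" if "x \<in> S" for x
    using Suc.prems that assms by (auto simp: differentiable_on_eq_differentiable_at)
  have "Ck_on k S (\<lambda>x. frechet_derivative (\<lambda>x. f x + g x) (at x) v)" for v
  proof (subst Ck_on_cong[OF assms])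
    show "frechet_derivative (\<lambda>x. f x + g x) (at x) v = frechet_derivative f (at x) v + frechet_derivative g (at x) v"
      if "x \<in> S" for x
      using frechet_derivative_at[OF has_derivative_add[OF d[OF that, THEN frechet_derivative_worksI]]] by metis
  qed (use Suc in auto)
  then show ?case using Suc.prems by (simp add: differentiable_on_add)
qed

lemma Ck_on_linear:
  assumes "open S" "bounded_linear h" shows "Ck_on k S f \<Longrightarrow> Ck_on k S (\<lambda>x. h (f x))"
proof (induction k arbitrary: f)
  case 0
  then show ?case using assms(2) by (simp add: bounded_linear.continuous_on)
next
  case (Suc k)
  have d: "((\<lambda>x. h (f x)) has_derivative (\<lambda>v. h (frechet_derivative f (at x) v))) (at x)" if "x \<in> S" for x
    using Suc.prems that assms by (auto simp: differentiable_on_eq_differentiable_at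
      intro!: bounded_linear.has_derivative[OF assms(2)] simp flip: frechet_derivative_works)
  have "Ck_on k S (\<lambda>x. frechet_derivative (\<lambda>x. h (f x)) (at x) v)" for v
  proof (subst Ck_on_cong[OF assms(1)])
    show "frechet_derivative (\<lambda>x. h (f x)) (at x) v = h (frechet_derivative f (at x) v)"
      if "x \<in> S" for x by (metis d frechet_derivative_at that)
  qed (use Suc in auto)
  then show ?case using d assms(1) by (auto simp: differentiable_on_eq_differentiable_at differentiable_def)
qed

text \<open>The product rule leaves undifferentiated factors in the derivative; these enter at order
  \<open>k\<close>, which \<open>Ck_on_SucD\<close> supplies.\<close>

lemma Ck_on_bilinear:
  assumes "open S" "bounded_bilinear h"
  shows "Ck_on k S f \<Longrightarrow> Ck_on k S g \<Longrightarrow> Ck_on k S (\<lambda>x. h (f x) (g x))"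
proof (induction k arbitrary: f g)
  case 0
  then show ?case using assms(2) by (simp add: bounded_bilinear.continuous_on)
next
  case (Suc k)
  have d: "((\<lambda>x. h (f x) (g x)) has_derivative
    (\<lambda>v. h (f x) (frechet_derivative g (at x) v) + h (frechet_derivative f (at x) v) (g x))) (at x)" if "x \<in> S" for x
    using Suc.prems that assms by (auto simp: differentiable_on_eq_differentiable_at
      intro!: bounded_bilinear.FDERIV[OF assms(2)] simp flip: frechet_derivative_works)
  have "Ck_on k S (\<lambda>x. frechet_derivative (\<lambda>x. h (f x) (g x)) (at x) v)" for v
  proof (subst Ck_on_cong[OF assms(1)])
    show "frechet_derivative (\<lambda>x. h (f x) (g x)) (at x) v =
       h (f x) (frechet_derivative g (at x) v) + h (frechet_derivative f (at x) v) (g x)"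
      if "x \<in> S" for x using frechet_derivative_at[OF d[OF that]] by metis
    show "Ck_on k S (\<lambda>x. h (f x) (frechet_derivative g (at x) v) + h (frechet_derivative f (at x) v) (g x))"
      using Suc.prems Ck_on_SucD[OF Suc.prems(1)] Ck_on_SucD[OF Suc.prems(2)]
      by (intro Ck_on_add[OF assms(1)] Suc.IH) simp_all
  qed
  then show ?case using d assms(1) by (auto simp: differentiable_on_eq_differentiable_at differentiable_def)
qed

text \<open>The induction ranges over all exponents, since differentiation replaces \<open>a\<close>
  by \<open>a - 1\<close>.\<close>

lemma Ck_on_powr:
  fixes f :: "'a::euclidean_space \<Rightarrow> real"
  assumes "open S" "\<And>x. x \<in> S \<Longrightarrow> f x > 0"
  shows "Ck_on k S f \<Longrightarrow> Ck_on k S (\<lambda>x. f x powr a)"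
proof (induction k arbitrary: a)
  case 0
  then show ?case using assms(2) by (auto intro!: continuous_on_powr) (metis less_irrefl)
next
  case (Suc k)
  have d: "((\<lambda>x. f x powr a) has_derivative
    (\<lambda>v. (a * f x powr (a - 1)) * frechet_derivative f (at x) v)) (at x)" if "x \<in> S" for x
  proof -
    have *: "(f has_derivative frechet_derivative f (at x)) (at x)"
      using Suc.prems that assms(1) by (auto simp: differentiable_on_eq_differentiable_at simp flip: frechet_derivative_works)
    have "((\<lambda>y. y powr a) has_derivative (*) (a * f x powr (a - 1))) (at (f x))"
      using has_real_derivative_powr[OF assms(2)[OF that], of a] by (simp add: has_field_derivative_def)
    from has_derivative_compose[OF * this] show ?thesis by simp
  qed
  have "Ck_on k S (\<lambda>x. frechet_derivative (\<lambda>x. f x powr a) (at x) v)" for v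
  proof (subst Ck_on_cong[OF assms(1)])
    show "frechet_derivative (\<lambda>x. f x powr a) (at x) v =
       (a * f x powr (a - 1)) * frechet_derivative f (at x) v"
      if "x \<in> S" for x using frechet_derivative_at[OF d[OF that]] by metis
    show "Ck_on k S (\<lambda>x. (a * f x powr (a - 1)) * frechet_derivative f (at x) v)"
      using Suc.prems Suc.IH[of "a - 1"] Ck_on_SucD
      by (intro Ck_on_bilinear[OF assms(1) bounded_bilinear_mult] Ck_on_const) auto
  qed
  then show ?case using d assms(1) by (auto simp: differentiable_on_eq_differentiable_at differentiable_def)
qed

lemma smooth_on_const: "smooth_on S (\<lambda>x. c)"
  by (simp add: smooth_on_def Ck_on_const)
lemma smooth_on_add: "open S \<Longrightarrow> smooth_on S f \<Longrightarrow> smooth_on S g \<Longrightarrow> smooth_on S (\<lambda>x. f x + g x)"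
  by (simp add: smooth_on_def Ck_on_add)
lemma smooth_on_linear: "open S \<Longrightarrow> bounded_linear h \<Longrightarrow> smooth_on S f \<Longrightarrow> smooth_on S (\<lambda>x. h (f x))"
  by (simp add: smooth_on_def Ck_on_linear)
lemma smooth_on_bilinear:
  "open S \<Longrightarrow> bounded_bilinear h \<Longrightarrow> smooth_on S f \<Longrightarrow> smooth_on S g \<Longrightarrow> smooth_on S (\<lambda>x. h (f x) (g x))"
  by (simp add: smooth_on_def Ck_on_bilinear)
lemma smooth_on_powr:
  fixes f :: "'a::euclidean_space \<Rightarrow> real"
  shows "open S \<Longrightarrow> (\<And>x. x \<in> S \<Longrightarrow> f x > 0) \<Longrightarrow> smooth_on S f \<Longrightarrow> smooth_on S (\<lambda>x. f x powr a)"
  by (simp add: smooth_on_def Ck_on_powr)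

text \<open>The mean value theorem is applied twice, along \<open>u\<close> to the increment in
  direction \<open>v\<close> and then along \<open>v\<close>. The mixed second difference over a
  parallelogram thus becomes h^2 times a mixed derivative at an interior point.\<close>

lemma mixed_difference_mvt:
  fixes f :: "'a::euclidean_space \<Rightarrow> real"
  assumes S: "\<And>s t. 0 \<le> s \<Longrightarrow> s \<le> h \<Longrightarrow> 0 \<le> t \<Longrightarrow> t \<le> h \<Longrightarrow> x + s *\<^sub>R u + t *\<^sub>R v \<in> S" and h: "h > 0"
    and f: "\<And>y. y \<in> S \<Longrightarrow> (f has_derivative F y) (at y)"
    and F: "\<And>y. y \<in> S \<Longrightarrow> ((\<lambda>y. F y u) has_derivative G y) (at y)"
  obtains s t where "0 < s" "s < h" "0 < t" "t < h"
    "f (x + h *\<^sub>R u + h *\<^sub>R v) - f (x + h *\<^sub>R u) - f (x + h *\<^sub>R v) + f x = h * h * G (x + s *\<^sub>R u + t *\<^sub>R v) v"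
proof -
  define g where "g s = f (x + s *\<^sub>R u + h *\<^sub>R v) - f (x + s *\<^sub>R u)" for s
  have d: "((\<lambda>s. f (x + s *\<^sub>R u + t *\<^sub>R v)) has_real_derivative F (x + s *\<^sub>R u + t *\<^sub>R v) u) (at s)"
    if "0 \<le> s" "s \<le> h" "0 \<le> t" "t \<le> h" for s t
  proof -
    have "((\<lambda>s. x + s *\<^sub>R u + t *\<^sub>R v) has_derivative (\<lambda>s. s *\<^sub>R u)) (at s)"
      by (auto intro!: derivative_eq_intros)
    from has_derivative_compose[OF this f[OF S[OF that]]]
    have "((\<lambda>s. f (x + s *\<^sub>R u + t *\<^sub>R v)) has_derivative (\<lambda>r. F (x + s *\<^sub>R u + t *\<^sub>R v) (r *\<^sub>R u))) (at s)" .
    moreover have "(\<lambda>r. F (x + s *\<^sub>R u + t *\<^sub>R v) (r *\<^sub>R u)) = (*) (F (x + s *\<^sub>R u + t *\<^sub>R v) u)"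
      using linear_cmul[OF has_derivative_linear[OF f[OF S[OF that]]]] by (auto simp: fun_eq_iff)
    ultimately show ?thesis by (simp add: has_field_derivative_def)
  qed
  have "\<exists>s. 0 < s \<and> s < h \<and> g h - g 0 = (h - 0) * (F (x + s *\<^sub>R u + h *\<^sub>R v) u - F (x + s *\<^sub>R u) u)"
  proof (rule MVT2[OF h])
    fix s assume "0 \<le> s" "s \<le> h"
    then show "(g has_real_derivative F (x + s *\<^sub>R u + h *\<^sub>R v) u - F (x + s *\<^sub>R u) u) (at s)"
      using DERIV_diff[OF d[of s h] d[of s 0]] h unfolding g_def by simp
  qed
  then obtain s where s: "0 < s" "s < h" "g h - g 0 = h * (F (x + s *\<^sub>R u + h *\<^sub>R v) u - F (x + s *\<^sub>R u) u)" by auto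
  have "\<exists>t. 0 < t \<and> t < h \<and> F (x + s *\<^sub>R u + h *\<^sub>R v) u - F (x + s *\<^sub>R u + 0 *\<^sub>R v) u = (h - 0) * G (x + s *\<^sub>R u + t *\<^sub>R v) v"
  proof (rule MVT2[OF h, of "\<lambda>t. F (x + s *\<^sub>R u + t *\<^sub>R v) u"])
    fix t assume "0 \<le> t" "t \<le> h"
    then have m: "x + s *\<^sub>R u + t *\<^sub>R v \<in> S" using s S by simp
    have "((\<lambda>t. x + s *\<^sub>R u + t *\<^sub>R v) has_derivative (\<lambda>t. t *\<^sub>R v)) (at t)"
      by (auto intro!: derivative_eq_intros)
    from has_derivative_compose[OF this F[OF m]]
    have "((\<lambda>t. F (x + s *\<^sub>R u + t *\<^sub>R v) u) has_derivative (\<lambda>r. G (x + s *\<^sub>R u + t *\<^sub>R v) (r *\<^sub>R v))) (at t)" .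
    moreover have "(\<lambda>r. G (x + s *\<^sub>R u + t *\<^sub>R v) (r *\<^sub>R v)) = (*) (G (x + s *\<^sub>R u + t *\<^sub>R v) v)"
      using linear_cmul[OF has_derivative_linear[OF F[OF m]]] by (auto simp: fun_eq_iff)
    ultimately show "((\<lambda>t. F (x + s *\<^sub>R u + t *\<^sub>R v) u) has_real_derivative G (x + s *\<^sub>R u + t *\<^sub>R v) v) (at t)"
      by (simp add: has_field_derivative_def)
  qed
  then obtain t where "0 < t" "t < h" "F (x + s *\<^sub>R u + h *\<^sub>R v) u - F (x + s *\<^sub>R u) u = h * G (x + s *\<^sub>R u + t *\<^sub>R v) v"
    by auto
  then show ?thesis using s that[of s t] by (simp add: g_def algebra_simps)
qed

text \<open>The mixed second difference is symmetric in \<open>u\<close> and \<open>v\<close>, so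
  the two orders of differentiation take a common value at points arbitrarily close to
  \<open>x\<close>; continuity at \<open>x\<close> then forces equality there.\<close>

lemma second_derivative_symmetric_real:
  fixes f :: "'a::euclidean_space \<Rightarrow> real"
  assumes "open S" "x \<in> S" "Ck_on 2 S f"
  shows "frechet_derivative (\<lambda>y. frechet_derivative f (at y) u) (at x) v =
         frechet_derivative (\<lambda>y. frechet_derivative f (at y) v) (at x) u" (is "?A = ?B")
proof (rule ccontr)
  define G where "G u y v = frechet_derivative (\<lambda>y. frechet_derivative f (at y) u) (at y) v" for u v y
  assume "?A \<noteq> ?B"
  then have ne: "G u x v \<noteq> G v x u" by (simp add: G_def)
  \<comment> \<open>Half the gap: numbers closer than this to the two different derivatives cannot
    coincide.\<close>
  define \<epsilon> where "\<epsilon> = \<bar>G u x v - G v x u\<bar> / 2"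
  have \<epsilon>: "\<epsilon> > 0" using ne by (simp add: \<epsilon>_def)
  have C: "Ck_on (Suc (Suc 0)) S f" using assms(3) by (simp add: numeral_2_eq_2)
  have f: "(f has_derivative frechet_derivative f (at y)) (at y)" if "y \<in> S" for y
    using C that assms(1) by (auto simp: differentiable_on_eq_differentiable_at simp flip: frechet_derivative_works)
  have F: "((\<lambda>y. frechet_derivative f (at y) w) has_derivative G w y) (at y)" if "y \<in> S" for y w
    using C that assms(1) unfolding G_def by (auto simp: differentiable_on_eq_differentiable_at simp flip: frechet_derivative_works)
  have c: "isCont (\<lambda>y. G a y b) x" for a b
    using C assms unfolding G_def by (auto simp: continuous_on_eq_continuous_at)
  have "\<forall>\<^sub>F y in nhds x. y \<in> S \<and> dist (G u y v) (G u x v) < \<epsilon> \<and> dist (G v y u) (G v x u) < \<epsilon>"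
    using c[of u v, unfolded isCont_def, THEN tendstoD, OF \<epsilon>]
      c[of v u, unfolded isCont_def, THEN tendstoD, OF \<epsilon>] assms \<epsilon>
    by (intro eventually_conj eventually_nhds_in_open) (simp_all add: eventually_nhds_conv_at)
  then obtain d where d: "d > 0" "\<And>y. dist y x < d \<Longrightarrow> y \<in> S \<and> dist (G u y v) (G u x v) < \<epsilon> \<and> dist (G v y u) (G v x u) < \<epsilon>"
    unfolding eventually_nhds_metric by auto
  \<comment> \<open>The summand 1 keeps the denominator positive when \<open>u\<close> and
    \<open>v\<close> vanish; the factor 2 puts the closed parallelogram inside the open ball of
    radius \<open>d\<close>.\<close>
  define h where "h = d / (2 * (norm u + norm v + 1))"
  have h: "h > 0" using d(1) unfolding h_def by (simp add: add_nonneg_pos)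
  have near: "dist (x + s *\<^sub>R u + t *\<^sub>R v) x < d" if "0 \<le> s" "s \<le> h" "0 \<le> t" "t \<le> h" for s t
  proof -
    have "dist (x + s *\<^sub>R u + t *\<^sub>R v) x = norm (s *\<^sub>R u + t *\<^sub>R v)" by (simp add: dist_norm algebra_simps)
    also have "\<dots> \<le> s * norm u + t * norm v" using that by (metis abs_of_nonneg norm_scaleR norm_triangle_ineq)
    also have "\<dots> \<le> h * norm u + h * norm v" using that by (intro add_mono mult_right_mono) auto
    also have "\<dots> \<le> h * (norm u + norm v + 1)" using h by (simp add: algebra_simps)
    also have "\<dots> = d / 2"
    proof -
      have "norm u + norm v + 1 \<noteq> 0" using norm_ge_zero[of u] norm_ge_zero[of v] by linarith
      moreover have "m \<noteq> 0 \<Longrightarrow> d / (2 * m) * m = d / 2" for m :: real by simp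
      ultimately show ?thesis unfolding h_def by blast
    qed
    also have "\<dots> < d" using d(1) by simp
    finally show ?thesis .
  qed
  obtain s t where 1: "0 < s" "s < h" "0 < t" "t < h"
    "f (x + h *\<^sub>R u + h *\<^sub>R v) - f (x + h *\<^sub>R u) - f (x + h *\<^sub>R v) + f x = h * h * G u (x + s *\<^sub>R u + t *\<^sub>R v) v"
    using near d(2) by (auto intro: mixed_difference_mvt[of h x u v S, OF _ h f F])
  have near': "dist (x + s *\<^sub>R v + t *\<^sub>R u) x < d" if "0 \<le> s" "s \<le> h" "0 \<le> t" "t \<le> h" for s t
    using near[of t s] that by (simp add: algebra_simps)
  obtain s' t' where 2: "0 < s'" "s' < h" "0 < t'" "t' < h"
    "f (x + h *\<^sub>R v + h *\<^sub>R u) - f (x + h *\<^sub>R v) - f (x + h *\<^sub>R u) + f x = h * h * G v (x + s' *\<^sub>R v + t' *\<^sub>R u) u"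
    using near' d(2) by (auto intro: mixed_difference_mvt[of h x v u S, OF _ h f F])
  have "h * h * G u (x + s *\<^sub>R u + t *\<^sub>R v) v = h * h * G v (x + s' *\<^sub>R v + t' *\<^sub>R u) u"
    using 1(5) 2(5) by (simp add: algebra_simps)
  then have "G u (x + s *\<^sub>R u + t *\<^sub>R v) v = G v (x + s' *\<^sub>R v + t' *\<^sub>R u) u" using h by simp
  moreover have "dist (G u (x + s *\<^sub>R u + t *\<^sub>R v) v) (G u x v) < \<epsilon>" using d(2)[OF near] 1 by simp
  moreover have "dist (G v (x + s' *\<^sub>R v + t' *\<^sub>R u) u) (G v x u) < \<epsilon>" using d(2)[OF near'] 2 by simp
  ultimately show False unfolding \<epsilon>_def dist_real_def by (auto simp: abs_if split: if_splits)
qed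

lemma second_derivative_symmetric:
  fixes f :: "'a::euclidean_space \<Rightarrow> 'b::euclidean_space"
  assumes "open S" "x \<in> S" "smooth_on S f"
  shows "frechet_derivative (\<lambda>y. frechet_derivative f (at y) u) (at x) v =
         frechet_derivative (\<lambda>y. frechet_derivative f (at y) v) (at x) u"
proof (rule euclidean_eqI)
  fix b :: 'b assume "b \<in> Basis"
  have bl: "bounded_linear (\<lambda>y. y \<bullet> b)" by (rule bounded_linear_inner_left)
  have 1: "frechet_derivative (\<lambda>y. g y \<bullet> b) (at y) w = frechet_derivative g (at y) w \<bullet> b"
    if "smooth_on S g" "y \<in> S" for g :: "'a \<Rightarrow> 'b" and y w
  proof -
    have "((\<lambda>y. g y \<bullet> b) has_derivative (\<lambda>w. frechet_derivative g (at y) w \<bullet> b)) (at y)"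
      using smooth_on_differentiable[OF that(1) assms(1) that(2)]
      by (intro bounded_linear.has_derivative[OF bl]) (simp flip: frechet_derivative_works)
    from frechet_derivative_at[OF this] show ?thesis by metis
  qed
  have 2: "frechet_derivative (\<lambda>y. frechet_derivative (\<lambda>y. f y \<bullet> b) (at y) u) (at x) v =
    frechet_derivative (\<lambda>y. frechet_derivative f (at y) u) (at x) v \<bullet> b" for u v
    using frechet_derivative_cong_open[OF assms(1,2), of "\<lambda>y. frechet_derivative (\<lambda>y. f y \<bullet> b) (at y) u" "\<lambda>y. frechet_derivative f (at y) u \<bullet> b"]
      1 assms smooth_on_frechet[OF assms(3)] by metis
  have "smooth_on S (\<lambda>y. f y \<bullet> b)" using smooth_on_linear[OF assms(1) bl assms(3)] .
  then show "frechet_derivative (\<lambda>y. frechet_derivative f (at y) u) (at x) v \<bullet> b =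
         frechet_derivative (\<lambda>y. frechet_derivative f (at y) v) (at x) u \<bullet> b"
    using second_derivative_symmetric_real[OF assms(1,2), of "\<lambda>y. f y \<bullet> b" u v] 2 by (simp add: smooth_on_def)
qed

section \<open>Smoothness and directional derivatives read in a chart\<close>

lemma chart_image_open:
  assumes "is_chart c" "open U" "U \<subseteq> dom_of c" shows "open (snd c ` U)"
proof -
  have h: "homeomorphism (fst c) (snd c ` fst c) (snd c) (cinv c)" and o: "open (snd c ` fst c)"
    using assms(1) by (auto simp: is_chart_def)
  have "openin (top_of_set (snd c ` fst c)) (snd c ` U)"
    using assms by (intro homeomorphism_imp_open_map[OF h]) (auto simp: openin_open)
  then show ?thesis using o by (metis openin_open_trans)
qed

lemma cinv_chart: "is_chart c \<Longrightarrow> p \<in> dom_of c \<Longrightarrow> cinv c (snd c p) = p"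
  by (auto simp: is_chart_def homeomorphism_def)

lemma cinv_image:
  assumes "is_chart c" "U \<subseteq> dom_of c" "x \<in> snd c ` U"
  shows "cinv c x \<in> U" and "snd c (cinv c x) = x"
proof -
  obtain p where p: "p \<in> U" "x = snd c p" using assms(3) by blast
  then have "cinv c x = p" using assms(1,2) by (simp add: cinv_chart subsetD)
  then show "cinv c x \<in> U" "snd c (cinv c x) = x" using p by simp_all
qed

lemma smooth_in_cong:
  assumes "is_chart c" "open U" "U \<subseteq> dom_of c" "\<And>p. p \<in> U \<Longrightarrow> f p = g p"
  shows "smooth_in c U f \<longleftrightarrow> smooth_in c U g"
  unfolding smooth_in_def using assms(4) cinv_image(1)[OF assms(1,3)]
  by (intro smooth_on_cong chart_image_open[OF assms(1-3)]) simp

lemma smooth_in_subset: "smooth_in c U f \<Longrightarrow> V \<subseteq> U \<Longrightarrow> smooth_in c V f"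
  unfolding smooth_in_def by (rule smooth_on_subset) auto

lemma pd_cong:
  assumes "is_chart c" "open U" "U \<subseteq> dom_of c" "p \<in> U" "\<And>p. p \<in> U \<Longrightarrow> f p = g p"
  shows "pd c f u p = pd c g u p"
proof -
  have "frechet_derivative (f \<circ> cinv c) (at (snd c p)) = frechet_derivative (g \<circ> cinv c) (at (snd c p))"
    using assms(4,5) cinv_image(1)[OF assms(1,3)]
    by (intro frechet_derivative_cong_open[OF chart_image_open[OF assms(1-3)]]) auto
  then show ?thesis by (simp add: pd_def)
qed

lemma smooth_in_has_derivative:
  assumes "is_chart c" "open U" "U \<subseteq> dom_of c" "p \<in> U" "smooth_in c U f"
  shows "((f \<circ> cinv c) has_derivative (\<lambda>u. pd c f u p)) (at (snd c p))"
proof -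
  have "(f \<circ> cinv c) differentiable (at (snd c p))"
    using assms(4,5) unfolding smooth_in_def
    by (intro smooth_on_differentiable[OF _ chart_image_open[OF assms(1-3)]]) auto
  then show ?thesis unfolding pd_def by (simp only: frechet_derivative_works)
qed

lemma pd_eqI: "((f \<circ> cinv c) has_derivative D) (at (snd c p)) \<Longrightarrow> pd c f u p = D u"
  unfolding pd_def by (drule frechet_derivative_at) simp

lemma linear_pd:
  "is_chart c \<Longrightarrow> open U \<Longrightarrow> U \<subseteq> dom_of c \<Longrightarrow> p \<in> U \<Longrightarrow> smooth_in c U f \<Longrightarrow> linear (\<lambda>u. pd c f u p)"
  using smooth_in_has_derivative has_derivative_linear by blast

lemma smooth_in_const: "smooth_in c U (\<lambda>p. k)"
  by (simp add: smooth_in_def comp_def smooth_on_const)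

context
  fixes c :: "('m::topological_space, 'k::finite) chart" and U
  assumes c: "is_chart c" "open U" "U \<subseteq> dom_of c"
begin

lemma smooth_in_add: "smooth_in c U f \<Longrightarrow> smooth_in c U g \<Longrightarrow> smooth_in c U (\<lambda>p. f p + g p)"
  unfolding smooth_in_def comp_def by (rule smooth_on_add[OF chart_image_open[OF c]])

lemma smooth_in_linear: "bounded_linear h \<Longrightarrow> smooth_in c U f \<Longrightarrow> smooth_in c U (\<lambda>p. h (f p))"
  unfolding smooth_in_def comp_def by (rule smooth_on_linear[OF chart_image_open[OF c]])

lemma smooth_in_bilinear:
  "bounded_bilinear h \<Longrightarrow> smooth_in c U f \<Longrightarrow> smooth_in c U g \<Longrightarrow> smooth_in c U (\<lambda>p. h (f p) (g p))"
  unfolding smooth_in_def comp_def by (rule smooth_on_bilinear[OF chart_image_open[OF c]])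

lemma smooth_in_minus: "smooth_in c U f \<Longrightarrow> smooth_in c U (\<lambda>p. - f p)"
  by (rule smooth_in_linear[OF bounded_linear_minus[OF bounded_linear_ident]])

lemma smooth_in_diff: "smooth_in c U f \<Longrightarrow> smooth_in c U g \<Longrightarrow> smooth_in c U (\<lambda>p. f p - g p)"
  using smooth_in_add[OF _ smooth_in_minus] by simp

lemma smooth_in_sum: "(\<And>i. i \<in> X \<Longrightarrow> smooth_in c U (f i)) \<Longrightarrow> smooth_in c U (\<lambda>p. \<Sum>i\<in>X. f i p)"
  by (induction X rule: infinite_finite_induct) (auto intro: smooth_in_const smooth_in_add)

lemma smooth_in_powr:
  fixes f :: "'m \<Rightarrow> real"
  assumes "\<And>p. p \<in> U \<Longrightarrow> f p > 0" "smooth_in c U f" shows "smooth_in c U (\<lambda>p. f p powr a)"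
proof -
  have "smooth_on (snd c ` U) (\<lambda>x. (f \<circ> cinv c) x powr a)"
    using assms(2)[unfolded smooth_in_def] assms(1)[OF cinv_image(1)[OF c(1,3)]]
    by (intro smooth_on_powr chart_image_open[OF c]) (auto simp del: comp_apply simp: comp_def)
  then show ?thesis by (simp add: smooth_in_def comp_def)
qed

lemma smooth_in_pd: "smooth_in c U f \<Longrightarrow> smooth_in c U (pd c f u)"
proof -
  assume f: "smooth_in c U f"
  have "smooth_on (snd c ` U) (\<lambda>x. frechet_derivative (f \<circ> cinv c) (at x) u)"
    using f by (simp add: smooth_in_def smooth_on_frechet)
  then show ?thesis unfolding smooth_in_def
    by (subst smooth_on_cong[OF chart_image_open[OF c], where g="\<lambda>x. frechet_derivative (f \<circ> cinv c) (at x) u"])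
      (simp_all add: pd_def cinv_image(2)[OF c(1,3)])
qed

lemma pd_const: "pd c (\<lambda>p. k) u p = 0"
  by (rule pd_eqI) (simp add: comp_def)

context
  fixes p assumes p: "p \<in> U"
begin

lemma pd_add: "smooth_in c U f \<Longrightarrow> smooth_in c U g \<Longrightarrow> pd c (\<lambda>q. f q + g q) u p = pd c f u p + pd c g u p"
  using has_derivative_add[OF smooth_in_has_derivative[OF c p] smooth_in_has_derivative[OF c p], of f g]
  by (intro pd_eqI) (auto simp: comp_def)

lemma pd_diff: "smooth_in c U f \<Longrightarrow> smooth_in c U g \<Longrightarrow> pd c (\<lambda>q. f q - g q) u p = pd c f u p - pd c g u p"
  using has_derivative_diff[OF smooth_in_has_derivative[OF c p] smooth_in_has_derivative[OF c p], of f g]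
  by (intro pd_eqI) (auto simp: comp_def)

lemma pd_linear: "bounded_linear h \<Longrightarrow> smooth_in c U f \<Longrightarrow> pd c (\<lambda>q. h (f q)) u p = h (pd c f u p)"
  using bounded_linear.has_derivative[OF _ smooth_in_has_derivative[OF c p], of h f]
  by (intro pd_eqI) (auto simp: comp_def)

lemma pd_bilinear: "bounded_bilinear h \<Longrightarrow> smooth_in c U f \<Longrightarrow> smooth_in c U g \<Longrightarrow>
  pd c (\<lambda>q. h (f q) (g q)) u p = h (f p) (pd c g u p) + h (pd c f u p) (g p)"
  using bounded_bilinear.FDERIV[OF _ smooth_in_has_derivative[OF c p] smooth_in_has_derivative[OF c p], of h f g]
    cinv_chart[OF c(1) subsetD[OF c(3) p]]
  by (intro pd_eqI) (simp add: comp_def)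

lemma pd_commute:
  fixes f :: "'m \<Rightarrow> 'b::euclidean_space"
  assumes f: "smooth_in c U f"
  shows "pd c (pd c f u) v p = pd c (pd c f v) u p"
proof -
  have *: "pd c (pd c f u) v p = frechet_derivative (\<lambda>x. frechet_derivative (f \<circ> cinv c) (at x) u) (at (snd c p)) v" for u v
    unfolding pd_def[of c "pd c f u"]
    by (subst frechet_derivative_cong_open[OF chart_image_open[OF c], of _ _ "\<lambda>x. frechet_derivative (f \<circ> cinv c) (at x) u"])
      (use p in \<open>simp_all add: pd_def cinv_image(2)[OF c(1,3)]\<close>)
  show ?thesis unfolding * using f p unfolding smooth_in_def
    by (intro second_derivative_symmetric[OF chart_image_open[OF c]]) auto
qed

end

end

lemma bounded_bilinear_matrix_mult: "bounded_bilinear (\<lambda>(A :: real^'n^'m) (B :: real^'k^'n). A ** B)"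
proof (rule bilinear_conv_bounded_bilinear[THEN iffD1], unfold bilinear_def, intro conjI allI)
  show "linear (\<lambda>B. A ** B)" for A :: "real^'n^'m"
    by (rule linearI)
      (simp_all add: matrix_matrix_mult_def vec_eq_iff distrib_left sum.distrib sum_distrib_left mult.left_commute)
  show "linear (\<lambda>A. A ** B)" for B :: "real^'k^'n"
    by (rule linearI)
      (simp_all add: matrix_matrix_mult_def vec_eq_iff distrib_right sum.distrib sum_distrib_left mult.assoc)
qed

lemma bounded_bilinear_matrix_vector: "bounded_bilinear ((*v) :: real^'n^'m \<Rightarrow> real^'n \<Rightarrow> real^'m)"
proof (rule bilinear_conv_bounded_bilinear[THEN iffD1], unfold bilinear_def, intro conjI allI)
  show "linear (\<lambda>x. A *v x)" for A :: "real^'n^'m" by simp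
  show "linear (\<lambda>A. A *v x)" for x :: "real^'n"
    by (rule linearI)
      (simp_all add: matrix_vector_mult_def vec_eq_iff distrib_right sum.distrib sum_distrib_left mult.assoc)
qed

lemma linear_trace: "linear (trace :: real^'n^'n \<Rightarrow> real)"
  by (auto intro!: linearI simp: trace_def sum.distrib sum_distrib_left)

lemmas bounded_linear_trace = linear_trace[unfolded linear_conv_bounded_linear]

section \<open>Traces\<close>

lemma
  fixes A A' :: "real^'n^'m" and B B' :: "real^'k^'n"
  shows matrix_mult_minus_left: "(- A) ** B = - (A ** B)"
  and matrix_mult_minus_right: "A ** (- B) = - (A ** B)"
  and matrix_mult_scaleR_left: "(r *\<^sub>R A) ** B = r *\<^sub>R (A ** B)"
  and matrix_mult_scaleR_right: "A ** (r *\<^sub>R B) = r *\<^sub>R (A ** B)"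
  and matrix_mult_diff_left: "(A - A') ** B = A ** B - A' ** B"
  and matrix_mult_diff_right: "A ** (B - B') = A ** B - A ** B'"
  and matrix_mult_add_left: "(A + A') ** B = A ** B + A' ** B"
  and matrix_mult_add_right: "A ** (B + B') = A ** B + A ** B'"
  and matrix_mult_zero_left: "0 ** B = 0"
  and matrix_mult_zero_right: "A ** 0 = 0"
  by (fact bounded_bilinear.minus_left[OF bounded_bilinear_matrix_mult]
    bounded_bilinear.minus_right[OF bounded_bilinear_matrix_mult]
    bounded_bilinear.scaleR_left[OF bounded_bilinear_matrix_mult]
    bounded_bilinear.scaleR_right[OF bounded_bilinear_matrix_mult]
    bounded_bilinear.diff_left[OF bounded_bilinear_matrix_mult]
    bounded_bilinear.diff_right[OF bounded_bilinear_matrix_mult]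
    bounded_bilinear.add_left[OF bounded_bilinear_matrix_mult]
    bounded_bilinear.add_right[OF bounded_bilinear_matrix_mult]
    bounded_bilinear.zero_left[OF bounded_bilinear_matrix_mult]
    bounded_bilinear.zero_right[OF bounded_bilinear_matrix_mult])+

lemmas matrix_ring_simps = matrix_mult_minus_left matrix_mult_minus_right matrix_mult_scaleR_left
  matrix_mult_scaleR_right matrix_mult_diff_left matrix_mult_diff_right matrix_mult_add_left
  matrix_mult_add_right matrix_mult_zero_left matrix_mult_zero_right matrix_mul_assoc[symmetric]

lemma
  fixes A :: "real^'n^'n"
  shows trace_scaleR: "trace (r *\<^sub>R A) = r * trace A"
  and trace_minus: "trace (- A) = - trace A"
  and trace_zero: "trace (0 :: real^'n^'n) = 0"
  by (simp_all add: linear_cmul[OF linear_trace] linear_neg[OF linear_trace] linear_0[OF linear_trace])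

lemmas trace_simps = trace_add trace_sub trace_scaleR trace_minus trace_zero trace_I

lemma matrix_vector_minus: "(- A) *v x = - (A *v x)" "A *v (- x) = - (A *v x)" for A :: "real^'n^'m"
  by (fact bounded_bilinear.minus_left[OF bounded_bilinear_matrix_vector]
    bounded_bilinear.minus_right[OF bounded_bilinear_matrix_vector])+

text \<open>Moving a frame element through a connection or curvature term creates rank-one maps of
  the free argument; this evaluates their traces.\<close>

lemma trace_matrix_rank1:
  fixes \<theta> :: "real^'n \<Rightarrow> real"
  assumes "linear \<theta>" shows "trace (matrix (\<lambda>u. \<theta> u *\<^sub>R w)) = \<theta> w"
proof -
  have "\<theta> w = \<theta> (\<Sum>i\<in>UNIV. w $ i *\<^sub>R axis i 1)" by (simp add: basis_expansion flip: scalar_mult_eq_scaleR)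
  also have "\<dots> = (\<Sum>i\<in>UNIV. w $ i * \<theta> (axis i 1))" using assms by (simp add: linear_sum linear_cmul)
  finally show ?thesis by (simp add: trace_def matrix_def mult.commute)
qed

lemma matrix_add: "matrix (\<lambda>x. f x + g x) = matrix f + matrix g" for f :: "real^'n \<Rightarrow> real^'m"
  by (simp add: matrix_def vec_eq_iff)
lemma matrix_diff: "matrix (\<lambda>x. f x - g x) = matrix f - matrix g" for f :: "real^'n \<Rightarrow> real^'m"
  by (simp add: matrix_def vec_eq_iff)

lemma matrix_scaleR_fun: "matrix (\<lambda>x. a *\<^sub>R f x) = a *\<^sub>R matrix f" for f :: "real^'n \<Rightarrow> real^'m"
  by (simp add: matrix_def vec_eq_iff)

lemma matrix_comp_left: "matrix (\<lambda>x. T *v f x) = T ** matrix f" for f :: "real^'n \<Rightarrow> real^'m"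
  by (simp add: matrix_def matrix_matrix_mult_def matrix_vector_mult_def vec_eq_iff)

section \<open>Real and complex traces computed in a basis\<close>

lemma trace_representation:
  fixes T :: "real^'n^'n"
  assumes "independent B" "span B = UNIV"
  shows "trace T = (\<Sum>b\<in>B. representation B (T *v b) b)"
proof -
  have fin: "finite B" using assms(1) by (rule independent_imp_finite)
  have "trace T = (\<Sum>i\<in>UNIV. (T *v axis i 1) $ i)"
    by (simp add: trace_def matrix_vector_mult_basis column_def)
  also have "\<dots> = (\<Sum>i\<in>UNIV. (T *v (\<Sum>b\<in>B. representation B (axis i 1) b *\<^sub>R b)) $ i)"
    using assms fin by (simp add: real_vector.sum_representation_eq)
  also have "\<dots> = (\<Sum>i\<in>UNIV. \<Sum>b\<in>B. representation B (axis i 1) b * (T *v b) $ i)"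
    by (simp add: linear_sum[OF matrix_vector_mul_linear] matrix_vector_mult_scaleR)
  also have "\<dots> = (\<Sum>b\<in>B. \<Sum>i\<in>UNIV. (T *v b) $ i * representation B (axis i 1) b)"
    by (subst sum.swap) (simp add: mult.commute)
  also have "\<dots> = (\<Sum>b\<in>B. representation B (\<Sum>i\<in>UNIV. (T *v b) $ i *\<^sub>R axis i 1) b)"
    using assms by (simp add: real_vector.representation_sum real_vector.representation_scale)
  also have "\<dots> = (\<Sum>b\<in>B. representation B (T *v b) b)"
    by (simp add: basis_expansion flip: scalar_mult_eq_scaleR)
  finally show ?thesis .
qed

text \<open>Among the sets \<open>B\<close> that are disjoint from their image under
  \<open>J\<close> and jointly independent with it, one of maximal cardinality is taken. A vector
  outside the span could be adjoined to it together with its image.\<close>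

lemma complex_basis_exists:
  fixes J :: "real^'k^'k"
  assumes J: "J ** J = - mat 1"
  shows "\<exists>B. complex_basis J B"
proof -
  have JJ: "J *v (J *v v) = - v" for v
    using J by (simp add: matrix_vector_mul_assoc matrix_vector_minus)
  define P where "P B \<longleftrightarrow> B \<inter> (*v) J ` B = {} \<and> independent (B \<union> (*v) J ` B)" for B
  have card: "card B < Suc (CARD('k))" if "P B" for B
  proof -
    have i: "independent (B \<union> (*v) J ` B)" using that P_def by blast
    then have "card (B \<union> (*v) J ` B) \<le> DIM(real^'k)" "finite (B \<union> (*v) J ` B)"
      using independent_bound independent_imp_finite by blast+
    then show ?thesis using card_mono[of "B \<union> (*v) J ` B" B] by simp
  qed
  have "P {}" by (simp add: P_def independent_empty)
  then have "\<exists>B. P B \<and> (\<forall>B'. P B' \<longrightarrow> card B' \<le> card B)"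
    by (rule ex_has_greatest_nat[where b="Suc (CARD('k))"]) (auto dest: card)
  then obtain B where B: "P B" and max: "\<And>B'. P B' \<Longrightarrow> card B' \<le> card B"
    by blast
  define C where "C = B \<union> (*v) J ` B"
  have ind: "independent C" and dis: "B \<inter> (*v) J ` B = {}" using B by (auto simp: P_def C_def)
  have fin: "finite B" using independent_imp_finite[OF ind] by (simp add: C_def)
  have Jspan: "J *v v \<in> span C" if "v \<in> span C" for v
  proof -
    have "J *v v \<in> (*v) J ` span C" using that by blast
    also have "\<dots> = span ((*v) J ` C)" by (simp add: linear_span_image)
    also have "\<dots> \<subseteq> span C"
    proof (rule span_minimal)
      show "(*v) J ` C \<subseteq> span C" unfolding C_def by (auto simp: JJ span_base intro!: span_neg)
    qed simp
    finally show ?thesis .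
  qed
  have "span C = UNIV"
  proof (rule ccontr)
    assume "span C \<noteq> UNIV"
    then obtain v where v: "v \<notin> span C" by blast
    have Jv: "J *v v \<notin> span (insert v C)"
    proof
      assume "J *v v \<in> span (insert v C)"
      then obtain a where a: "J *v v - a *\<^sub>R v \<in> span C" using span_breakdown_eq by blast
      \<comment> \<open>Applying \<open>J\<close> to Jv - a v and adding a times the same vector
        eliminates Jv and leaves -(1 + a^2) v, whose coefficient is nonzero over the reals.\<close>
      from span_add[OF Jspan[OF a] span_scale[OF a, of a]]
      have "- (1 + a * a) *\<^sub>R v \<in> span C" by (simp add: algebra_simps JJ)
      then have "(- 1 / (1 + a * a)) *\<^sub>R (- (1 + a * a) *\<^sub>R v) \<in> span C" by (rule span_scale)
      moreover have "1 + a * a \<noteq> 0" using zero_le_square[of a] by linarith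
      moreover have "(- 1 / x) *\<^sub>R (- x *\<^sub>R v) = v" if "x \<noteq> 0" for x using that by simp
      ultimately show False using v by metis
    qed
    have ne: "v \<notin> C" "J *v v \<notin> insert v C" using v Jv span_base by metis+
    have i: "independent (insert (J *v v) (insert v C))"
      using Jv v ind ne by (simp add: independent_insert)
    have "insert v B \<inter> (*v) J ` insert v B = {}"
      using dis ne JJ unfolding C_def by auto
    moreover have "insert v B \<union> (*v) J ` insert v B = insert (J *v v) (insert v C)" by (auto simp: C_def)
    ultimately have "P (insert v B)" using i by (simp add: P_def)
    from max[OF this] show False using ne fin by (auto simp: C_def card_insert_if)
  qed
  then show ?thesis using B by (auto simp: complex_basis_def P_def C_def)
qed

text \<open>In the real basis formed by \<open>B\<close> and its image, \<open>J\<close> exchanges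
  paired coordinates up to sign. The real traces of \<open>T\<close> and \<open>J ** T\<close>
  therefore count the real and imaginary parts of every complex diagonal entry twice. The resulting
  formula is free of the basis selected by SOME.\<close>

lemma complex_trace_eq:
  fixes J T :: "real^'k^'k"
  assumes J: "J ** J = - mat 1" and comm: "J ** T = T ** J"
  shows "complex_trace J T = Complex (trace T / 2) (- trace (J ** T) / 2)"
proof -
  define B where "B = (SOME B. complex_basis J B)"
  have "complex_basis J B" unfolding B_def using complex_basis_exists[OF J] by (rule someI_ex)
  define C where "C = B \<union> (*v) J ` B"
  have ind: "independent C" and sp: "span C = UNIV" and dis: "B \<inter> (*v) J ` B = {}"
    using \<open>complex_basis J B\<close> by (auto simp: complex_basis_def C_def)
  have fin: "finite B" using independent_imp_finite[OF ind] by (simp add: C_def)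
  have JJ: "J *v (J *v v) = - v" for v
    using J by (simp add: matrix_vector_mul_assoc matrix_vector_minus)
  have JT: "T *v (J *v v) = J *v (T *v v)" for v using comm by (simp add: matrix_vector_mul_assoc)
  have inj: "inj_on ((*v) J) B" by (rule inj_onI) (metis JJ minus_equation_iff)
  have finC: "finite C" using independent_imp_finite[OF ind] .
  let ?r = "representation C"
  have split: "sum f C = sum f B + (\<Sum>b\<in>B. f (J *v b))" for f :: "_ \<Rightarrow> 'x::comm_monoid_add"
    unfolding C_def using fin dis inj by (simp add: sum.union_disjoint sum.reindex)
  have rJ: "?r (J *v v) b = - ?r v (J *v b) \<and> ?r (J *v v) (J *v b) = ?r v b" if "b \<in> B" for v b
  proof -
    \<comment> \<open>The candidate coordinates of Jv. A vector x = J b of the second half comes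
      from b = - J x, because J squares to -1.\<close>
    define g where "g x = (if x \<in> B then - ?r v (J *v x) else if x \<in> (*v) J ` B then ?r v (- (J *v x)) else 0)" for x
    have gB: "g b = - ?r v (J *v b)" "g (J *v b) = ?r v b" if "b \<in> B" for b
      using that dis by (auto simp: g_def JJ)
    have gC: "b \<in> C" if "g b \<noteq> 0" for b using that by (auto simp: g_def C_def split: if_splits)
    have "?r (J *v v) = g"
    proof (rule real_vector.representation_eqI)
      show "J *v v \<in> span C" using sp by simp
      show "b \<in> C" if "g b \<noteq> 0" for b using gC that .
      show "finite {b. g b \<noteq> 0}" by (rule finite_subset[OF _ finC]) (use gC in blast)
      have "J *v v = J *v (\<Sum>b\<in>C. ?r v b *\<^sub>R b)" by (subst real_vector.sum_representation_eq[OF ind _ finC]) (simp_all add: sp)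
      also have "\<dots> = (\<Sum>b\<in>C. ?r v b *\<^sub>R (J *v b))"
        by (simp add: linear_sum[OF matrix_vector_mul_linear] matrix_vector_mult_scaleR)
      also have "\<dots> = (\<Sum>b\<in>C. g b *\<^sub>R b)"
        unfolding split by (simp add: gB JJ add.commute)
      also have "\<dots> = (\<Sum>b | g b \<noteq> 0. g b *\<^sub>R b)"
        by (rule sum.mono_neutral_right[OF finC]) (use gC in auto)
      finally show "(\<Sum>b | g b \<noteq> 0. g b *\<^sub>R b) = J *v v" by simp
    qed (rule ind)
    then show ?thesis using that by (simp add: gB)
  qed
  have "trace T = (\<Sum>b\<in>B. ?r (T *v b) b) + (\<Sum>b\<in>B. ?r (T *v b) b)"
    unfolding trace_representation[OF ind sp] split by (simp add: JT rJ)
  moreover have "trace (J ** T) = - (\<Sum>b\<in>B. ?r (T *v b) (J *v b)) - (\<Sum>b\<in>B. ?r (T *v b) (J *v b))"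
    unfolding trace_representation[OF ind sp] split
    by (simp add: rJ JT JJ sum_negf real_vector.representation_neg[OF ind] sp flip: matrix_vector_mul_assoc)
  moreover have "complex_trace J T = (\<Sum>b\<in>B. complex_coord J B (T *v b) b)"
    unfolding complex_trace_def B_def Let_def ..
  ultimately show ?thesis by (simp add: complex_eq_iff complex_coord_def C_def)
qed

section \<open>Algebra of admissible frames\<close>

text \<open>With \<open>A\<close> and \<open>B\<close> in the frame this replaces the unknown
  commutator by traces of \<open>T\<close> against products of frame elements.\<close>

lemma trace_commutator:
  "trace (A ** (T ** B - B ** T)) = trace ((B ** A) ** T) - trace ((A ** B) ** T)"
  for A B T :: "real^'n^'n"
  using trace_mul_sym[of "A ** T" B] by (simp add: matrix_ring_simps trace_simps)

context
  fixes V :: "(real^'k^'k) set" and I1 I2 I3 :: "real^'k^'k"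
  assumes frame: "admissible_frame V I1 I2 I3"
begin

lemma frame_squares: "I1 ** I1 = - mat 1" "I2 ** I2 = - mat 1" "I3 ** I3 = - mat 1"
  and frame_12: "I1 ** I2 = I3" and frame_21: "I2 ** I1 = - I3" and frame_span: "V = span {I1, I2, I3}"
  using frame unfolding admissible_frame_def by (blast, blast, blast, blast, metis minus_minus, blast)

lemma frame_mult: "I1 ** I1 = - mat 1" "I2 ** I2 = - mat 1" "I3 ** I3 = - mat 1"
  "I1 ** I2 = I3" "I2 ** I1 = - I3" "I2 ** I3 = I1" "I3 ** I2 = - I1" "I3 ** I1 = I2" "I1 ** I3 = - I2"
proof -
  show "I2 ** I3 = I1"
    using matrix_mul_assoc[of I2 I2 I1] by (simp add: frame_squares frame_21 matrix_ring_simps)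
  show "I3 ** I2 = - I1"
    using matrix_mul_assoc[of I1 I2 I2] by (simp add: frame_squares frame_12 matrix_ring_simps)
  show "I3 ** I1 = I2"
    using matrix_mul_assoc[of I2 I1 I1] by (simp add: frame_squares frame_21 matrix_ring_simps)
  show "I1 ** I3 = - I2"
    using matrix_mul_assoc[of I1 I1 I2] by (simp add: frame_squares frame_12 matrix_ring_simps)
qed (fact frame_squares frame_12 frame_21)+

lemma frame_mult_vec: "I1 *v (I1 *v x) = - x" "I2 *v (I2 *v x) = - x" "I3 *v (I3 *v x) = - x"
  "I1 *v (I2 *v x) = I3 *v x" "I2 *v (I1 *v x) = - (I3 *v x)" "I2 *v (I3 *v x) = I1 *v x"
  "I3 *v (I2 *v x) = - (I1 *v x)" "I3 *v (I1 *v x) = I2 *v x" "I1 *v (I3 *v x) = - (I2 *v x)"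
  by (simp_all add: matrix_vector_mul_assoc frame_mult matrix_vector_minus)

lemma frame_rotate: "admissible_frame V I2 I3 I1"
proof -
  have "V = span {I2, I3, I1}" unfolding frame_span by (simp add: insert_commute)
  then show ?thesis unfolding admissible_frame_def by (simp add: frame_mult matrix_ring_simps)
qed

lemma frame_mem: "I1 \<in> V" "I2 \<in> V" "I3 \<in> V"
  unfolding frame_span by (auto intro: span_base)

lemma frame_trace: "trace I1 = 0" "trace I2 = 0" "trace I3 = 0"
  using trace_mul_sym[of I2 I3] trace_mul_sym[of I3 I1] trace_mul_sym[of I1 I2]
  by (simp_all add: frame_mult trace_simps)

lemma frame_coordinates:
  assumes "X \<in> V"
  obtains a b c where "X = a *\<^sub>R I1 + b *\<^sub>R I2 + c *\<^sub>R I3"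
proof -
  obtain a b c where "X - a *\<^sub>R I1 - b *\<^sub>R I2 - c *\<^sub>R I3 = 0"
    using assms unfolding frame_span span_breakdown_eq by (auto simp: algebra_simps)
  then have "X = a *\<^sub>R I1 + b *\<^sub>R I2 + c *\<^sub>R I3" by (simp add: algebra_simps)
  then show ?thesis by (rule that)
qed

text \<open>The frame is orthogonal for the trace form and each square has trace -dim, so
  coordinates are read off by traces.\<close>

lemma frame_expand:
  assumes "X \<in> V"
  shows "X = - (trace (I1 ** X) / CARD('k)) *\<^sub>R I1 - (trace (I2 ** X) / CARD('k)) *\<^sub>R I2 - (trace (I3 ** X) / CARD('k)) *\<^sub>R I3"
proof -
  obtain a b c where X: "X = a *\<^sub>R I1 + b *\<^sub>R I2 + c *\<^sub>R I3" using frame_coordinates[OF assms] .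
  show ?thesis unfolding X by (simp add: matrix_ring_simps frame_mult trace_simps frame_trace)
qed

text \<open>A commutator that lies in \<open>V\<close> is determined by its traces against the
  frame. By \<open>trace_commutator\<close> these depend only on the three numbers tr(I_a T), which
  therefore serve for all three commutators.\<close>

lemma frame_commutator:
  assumes "T ** I1 - I1 ** T \<in> V" "T ** I2 - I2 ** T \<in> V" "T ** I3 - I3 ** T \<in> V"
  shows "T ** I1 - I1 ** T = (- 2 * trace (I3 ** T) / CARD('k)) *\<^sub>R I2 - (- 2 * trace (I2 ** T) / CARD('k)) *\<^sub>R I3"
    and "T ** I2 - I2 ** T = (- 2 * trace (I1 ** T) / CARD('k)) *\<^sub>R I3 - (- 2 * trace (I3 ** T) / CARD('k)) *\<^sub>R I1"
    and "T ** I3 - I3 ** T = (- 2 * trace (I2 ** T) / CARD('k)) *\<^sub>R I1 - (- 2 * trace (I1 ** T) / CARD('k)) *\<^sub>R I2"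
  by (subst frame_expand[OF assms(1)] frame_expand[OF assms(2)] frame_expand[OF assms(3)],
    simp only: trace_commutator, simp add: frame_mult matrix_ring_simps trace_simps)+

text \<open>The frames supplied by the definition of Q bear no relation to the induced complex
  structure. Here \<open>V\<close> is identified with the imaginary quaternions, whose product is
  minus the inner product plus the cross product, and the unit vector of \<open>J\<close> is
  completed to an oriented orthonormal triple.\<close>

lemma adapted_frame:
  assumes J: "J \<in> V" "J ** J = - mat 1"
  obtains K where "admissible_frame V J K (J ** K)"
proof -
  define \<phi> :: "real^3 \<Rightarrow> real^'k^'k" where "\<phi> a = a $ 1 *\<^sub>R I1 + a $ 2 *\<^sub>R I2 + a $ 3 *\<^sub>R I3" for a
  have lin: "linear \<phi>" by (rule linearI) (simp_all add: \<phi>_def algebra_simps)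
  have mult: "\<phi> a ** \<phi> b = - (a \<bullet> b) *\<^sub>R mat 1 + \<phi> (cross3 a b)" for a b
    by (simp add: \<phi>_def matrix_ring_simps frame_mult cross3_def inner_vec_def sum_3 algebra_simps)
  have range: "\<exists>a. X = \<phi> a" if X: "X \<in> V" for X
  proof -
    obtain a b c where "X = a *\<^sub>R I1 + b *\<^sub>R I2 + c *\<^sub>R I3" using frame_coordinates[OF X] .
    then have "X = \<phi> (vector [a, b, c])" by (simp add: \<phi>_def)
    then show ?thesis ..
  qed
  have inV: "\<phi> a \<in> V" for a
    unfolding \<phi>_def frame_span by (intro span_add span_scale span_base) auto
  obtain j where j: "J = \<phi> j" using range[OF J(1)] by blast
  have "- mat 1 = - (j \<bullet> j) *\<^sub>R (mat 1 :: real^'k^'k)"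
    using J(2) unfolding j mult by (simp add: linear_0[OF lin])
  then have jj: "j \<bullet> j = 1"
    by (auto dest!: arg_cong[of _ _ trace] simp: trace_simps)
  obtain k' where k': "k' \<noteq> 0" "orthogonal j k'"
    using orthogonal_to_vector_exists[of j] by (auto simp: orthogonal_commute)
  define k where "k = sgn k'"
  have kk: "k \<bullet> k = 1" and jk: "j \<bullet> k = 0"
    using k' by (simp_all add: k_def sgn_div_norm orthogonal_def dot_square_norm power2_eq_square)
  define p where "p = cross3 j k"
  \<comment> \<open>The part \<open>m\<close> of \<open>l\<close> orthogonal to \<open>j\<close> and
    \<open>k\<close> has zero cross product with \<open>p\<close>; the double cross product formula
    then makes it a multiple of \<open>p\<close>.\<close>
  have expand: "l = (l \<bullet> j) *\<^sub>R j + (l \<bullet> k) *\<^sub>R k + (l \<bullet> p) *\<^sub>R p" for l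
  proof -
    define m where "m = l - (l \<bullet> j) *\<^sub>R j - (l \<bullet> k) *\<^sub>R k"
    have mj: "m \<bullet> j = 0" "m \<bullet> k = 0"
      using jj kk jk by (simp_all add: m_def inner_diff_left inner_diff_right inner_commute)
    have pm: "p \<bullet> m = p \<bullet> l"
      by (simp add: p_def m_def inner_diff_right dot_cross_self)
    have pp: "p \<bullet> p = 1"
      using norm_cross_dot[of j k] norm_eq_1[THEN iffD2, OF jj] norm_eq_1[THEN iffD2, OF kk] jk
      by (simp add: p_def power2_norm_eq_inner)
    have "cross3 p m = (m \<bullet> j) *\<^sub>R k - (m \<bullet> k) *\<^sub>R j"
      by (simp add: p_def cross3_simps forall_3)
    then have "cross3 p (cross3 p m) = 0" by (simp add: mj)
    moreover have "cross3 p (cross3 p m) = (p \<bullet> m) *\<^sub>R p - (p \<bullet> p) *\<^sub>R m"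
      by (simp add: cross3_simps forall_3)
    ultimately have "m = (p \<bullet> l) *\<^sub>R p" by (simp add: pp pm)
    then show ?thesis by (simp add: m_def inner_commute algebra_simps)
  qed
  have JK: "J ** \<phi> k = \<phi> p" unfolding j mult by (simp add: jk p_def)
  have KJ: "\<phi> k ** J = - \<phi> p"
    unfolding j mult p_def cross_skew[of k j] by (simp add: jk inner_commute linear_neg[OF lin])
  have KK: "\<phi> k ** \<phi> k = - mat 1" unfolding mult by (simp add: kk linear_0[OF lin])
  have "\<phi> p ** \<phi> p = J ** ((\<phi> k ** J) ** \<phi> k)" by (simp add: JK[symmetric] matrix_mul_assoc)
  also have "\<dots> = - mat 1"
    unfolding KJ JK[symmetric] by (simp add: matrix_ring_simps KK J(2))
  finally have PP: "\<phi> p ** \<phi> p = - mat 1" .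
  have "V = span {J, \<phi> k, \<phi> p}"
  proof
    show "span {J, \<phi> k, \<phi> p} \<subseteq> V" using J(1) inV by (intro span_minimal) (auto simp: frame_span)
    show "V \<subseteq> span {J, \<phi> k, \<phi> p}"
    proof
      fix X assume "X \<in> V"
      then obtain l where l: "X = \<phi> l" using range by blast
      have "X = (l \<bullet> j) *\<^sub>R J + (l \<bullet> k) *\<^sub>R \<phi> k + (l \<bullet> p) *\<^sub>R \<phi> p"
        unfolding l j by (subst expand[of l]) (simp add: linear_add[OF lin] linear_cmul[OF lin])
      also have "\<dots> \<in> span {J, \<phi> k, \<phi> p}" by (intro span_add span_scale span_base) auto
      finally show "X \<in> span {J, \<phi> k, \<phi> p}" .
    qed
  qed
  then have "admissible_frame V J (\<phi> k) (J ** \<phi> k)"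
    using J(2) KK PP KJ by (simp add: admissible_frame_def JK)
  then show ?thesis by (rule that)
qed

end

text \<open>By symmetry D(Jv)u = D(u)(Jv). Commuting D(u) past J and tracing over u relates tr D(Jv)
  to the commutator coefficients \<open>\<theta>\<close>; the three cyclic versions form a linear
  system that can be solved for them.\<close>

lemma frame_symmetric_trace:
  fixes D :: "real^'k \<Rightarrow> real^'k^'k"
  assumes frame: "admissible_frame V I1 I2 I3"
    and lin: "linear D" and sym: "\<And>u v. D u *v v = D v *v u"
    and DV: "\<And>u J. J \<in> V \<Longrightarrow> D u ** J - J ** D u \<in> V"
    and card: "CARD('k) = 4 * n" and n: "n \<ge> 1"
  shows "trace (I1 ** D v) = real n / (real n + 1) * trace (D (I1 *v v))"
    and "trace (I2 ** D v) = real n / (real n + 1) * trace (D (I2 *v v))"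
    and "trace (I3 ** D v) = real n / (real n + 1) * trace (D (I3 *v v))"
proof -
  define \<theta> where "\<theta> J u = - 2 * trace (J ** D u) / CARD('k)" for J u
  have lin\<theta>: "linear (\<theta> J)" for J
    by (rule linearI)
      (simp_all add: \<theta>_def linear_add[OF lin] linear_cmul[OF lin] matrix_ring_simps trace_simps field_simps)
  have main: "trace (D (J *v v)) = trace (J ** D v) + \<theta> L (K *v v) - \<theta> K (L *v v)"
    if f: "admissible_frame V J K L" for J K L v
  proof -
    have "D u *v (J *v v) = J *v (D v *v u) + \<theta> L u *\<^sub>R (K *v v) - \<theta> K u *\<^sub>R (L *v v)" for u
    proof -
      have "(D u ** J - J ** D u) *v v = (\<theta> L u *\<^sub>R K - \<theta> K u *\<^sub>R L) *v v"
        using frame_commutator(1)[OF f, of "D u"] DV frame_mem[OF f] by (simp add: \<theta>_def)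
      then show ?thesis
        by (simp add: matrix_vector_mult_diff_rdistrib matrix_vector_mul_assoc[symmetric]
          scaleR_matrix_vector_assoc[symmetric] sym[of v u] algebra_simps)
    qed
    then have "matrix (\<lambda>u. D (J *v v) *v u) =
      matrix (\<lambda>u. J *v (D v *v u) + \<theta> L u *\<^sub>R (K *v v) - \<theta> K u *\<^sub>R (L *v v))"
      by (simp add: sym[of "J *v v"])
    then show ?thesis
      by (simp add: matrix_add matrix_diff matrix_comp_left[where f="(*v) (D v)"] trace_simps trace_matrix_rank1[OF lin\<theta>])
  qed
  have f2: "admissible_frame V I2 I3 I1" using frame_rotate[OF frame] .
  have f3: "admissible_frame V I3 I1 I2" using frame_rotate[OF f2] .
  have neg: "\<theta> J (- w) = - \<theta> J w" for J w using lin\<theta> by (rule linear_neg)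
  have tneg: "trace (D (- w)) = - trace (D w)" for w by (simp add: linear_neg[OF lin] trace_simps)
  note vec = frame_mult_vec[OF frame]
  have tr: "trace (J ** D w) = - 2 * n * \<theta> J w" for J w
    using card n by (simp add: \<theta>_def)
  have all: "\<theta> I1 (I1 *v w) = trace (D w) / (2 * n + 2) \<and> \<theta> I2 (I2 *v w) = trace (D w) / (2 * n + 2)
    \<and> \<theta> I3 (I3 *v w) = trace (D w) / (2 * n + 2)" for w
  proof -
    define t x y z where d: "t = trace (D w)" "x = \<theta> I1 (I1 *v w)" "y = \<theta> I2 (I2 *v w)" "z = \<theta> I3 (I3 *v w)"
    \<comment> \<open>Taking v = I_a w in the three identities gives a circulant system in
      \<open>x\<close>, \<open>y\<close>, \<open>z\<close>. Differences of its rows carry the factor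
      2n - 1, which is nonzero, so the three unknowns agree.\<close>
    have e: "t = 2 * n * x + y + z" "t = 2 * n * y + x + z" "t = 2 * n * z + x + y"
      using main[OF frame, of "I1 *v w"] main[OF f2, of "I2 *v w"] main[OF f3, of "I3 *v w"]
      by (simp_all add: vec neg tneg tr d)
    have "(2 * real n - 1) * (x - y) = 0" "(2 * real n - 1) * (x - z) = 0"
      using e by (simp_all add: algebra_simps)
    then have "y = x" "z = x" using n by auto
    then show ?thesis using e(1) by (simp add: d field_simps)
  qed
  have \<theta>: "\<theta> J v = - trace (D (J *v v)) / (2 * n + 2)" if "J \<in> {I1, I2, I3}" for J
    using all[of "- (J *v v)"] that by (auto simp: vec tneg matrix_vector_minus)
  show "trace (I1 ** D v) = real n / (real n + 1) * trace (D (I1 *v v))"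
    and "trace (I2 ** D v) = real n / (real n + 1) * trace (D (I2 *v v))"
    and "trace (I3 ** D v) = real n / (real n + 1) * trace (D (I3 *v v))"
    using n by (simp_all add: tr \<theta> field_simps)
qed

section \<open>Pointwise algebra of trace-free curvature tensors commuting with I_1\<close>

context
  fixes V :: "(real^'k^'k) set" and I1 I2 I3 :: "real^'k^'k" and R :: "real^'k \<Rightarrow> real^'k \<Rightarrow> real^'k^'k" and n :: nat
  assumes frame: "admissible_frame V I1 I2 I3"
    and bil: "bilinear R" and alt: "\<And>u v. R v u = - R u v"
    and bianchi: "\<And>u v w. R u v *v w + R v w *v u + R w u *v v = 0"
    and tr0: "\<And>u v. trace (R u v) = 0"
    and RV: "\<And>u v J. J \<in> V \<Longrightarrow> R u v ** J - J ** R u v \<in> V"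
    and comm: "\<And>u v. R u v ** I1 = I1 ** R u v"
    and card: "CARD('k) = 4 * n" and n: "n \<ge> 1"
begin

text \<open>The endomorphism behind the Ricci tensor \<open>r\<close>; it is kept before taking the
  trace so that frame elements can be moved through it.\<close>

private definition M where "M u v = matrix (\<lambda>X. R X u *v v)"
private definition r where "r u v = trace (M u v)"
private definition \<Omega> where "\<Omega> u v = - 2 * trace (I1 ** R u v) / CARD('k)"

private lemmas bil_simps = bilinear_ladd[OF bil] bilinear_radd[OF bil] bilinear_lmul[OF bil]
  bilinear_rmul[OF bil] bilinear_lneg[OF bil] bilinear_rneg[OF bil]

private lemma linear_M: "linear (\<lambda>X. R X u *v v)"
  by (rule linearI) (simp_all add: bil_simps matrix_vector_mult_add_rdistrib scaleR_matrix_vector_assoc)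

private lemma M_works: "M u v *v X = R X u *v v"
  unfolding M_def by (simp add: linear_M)

private lemma r_bilinear: "bilinear r"
proof -
  have "r (u + u') v = r u v + r u' v" "r u (v + v') = r u v + r u v'" "r (a *\<^sub>R u) v = a * r u v"
    "r u (a *\<^sub>R v) = a * r u v" for u u' v v' a
    by (simp_all add: r_def M_def bil_simps matrix_add matrix_vector_mult_add_rdistrib matrix_vector_right_distrib
      trace_simps matrix_vector_mult_scaleR scaleR_matrix_vector_assoc[symmetric] matrix_scaleR_fun)
  then show ?thesis by (auto simp: bilinear_def intro!: linearI)
qed

private lemmas r_neg = bilinear_lneg[OF r_bilinear] bilinear_rneg[OF r_bilinear]

text \<open>The first Bianchi identity writes R(u,v) as the difference of the partial maps
  \<open>M v u\<close> and \<open>M u v\<close>; cyclicity of the trace does the rest.\<close>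

private lemma trace_R: "trace (R u v ** T) = trace (T ** M v u) - trace (T ** M u v)"
proof -
  have "R u v *v (T *v w) = M v u *v (T *v w) - M u v *v (T *v w)" for w
  proof -
    have "R u v *v (T *v w) = - (R v (T *v w) *v u) - R (T *v w) u *v v"
      using bianchi[of u v "T *v w"] by (simp add: algebra_simps eq_neg_iff_add_eq_0)
    then show ?thesis by (simp add: M_works alt[of "T *v w" v] matrix_vector_minus)
  qed
  then have "R u v ** T = M v u ** T - M u v ** T"
    by (simp add: matrix_eq matrix_vector_mul_assoc[symmetric] matrix_vector_mult_diff_rdistrib)
  then show ?thesis by (simp add: trace_simps trace_mul_sym[of T])
qed

private lemma r_sym: "r u v = r v u"
  using trace_R[of u v "mat 1"] tr0 by (simp add: r_def)

private lemma I1_M: "I1 ** M v u = M v (I1 *v u)"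
  by (simp add: matrix_eq matrix_vector_mul_assoc[symmetric] M_works) (simp add: matrix_vector_mul_assoc comm)

private lemma \<Omega>_r: "2 * n * \<Omega> u v = r u (I1 *v v) - r v (I1 *v u)"
proof -
  have "trace (R u v ** I1) = r v (I1 *v u) - r u (I1 *v v)" by (simp add: trace_R I1_M r_def)
  then show ?thesis using n card by (simp add: \<Omega>_def comm)
qed

text \<open>As R commutes with I_1, the expression of [R, I_1] in \<open>frame_commutator\<close>
  vanishes. Its coefficients are multiples of the traces of R against I_3 and I_2, so these vanish
  too and only the rotation of I_2 and I_3 by \<open>\<Omega>\<close> remains.\<close>

private lemma RI2: "R u v ** I2 = I2 ** R u v + \<Omega> u v *\<^sub>R I3"
  and RI3: "R u v ** I3 = I3 ** R u v - \<Omega> u v *\<^sub>R I2"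
  and trI2: "trace (R u v ** I2) = 0" and trI3: "trace (R u v ** I3) = 0"
proof -
  note fc = frame_commutator[OF frame, of "R u v", OF RV RV RV, OF frame_mem[OF frame], unfolded comm]
  have e: "(- 2 * trace (I3 ** R u v) / CARD('k)) *\<^sub>R I2 = (- 2 * trace (I2 ** R u v) / CARD('k)) *\<^sub>R I3"
    using fc(1) by simp
  have "trace (I3 ** R u v) = 0" "trace (I2 ** R u v) = 0"
    using arg_cong[OF e, of "\<lambda>X. trace (I2 ** X)"] arg_cong[OF e, of "\<lambda>X. trace (I3 ** X)"]
    by (simp_all add: matrix_ring_simps frame_mult[OF frame] trace_simps frame_trace[OF frame])
  then show "trace (R u v ** I2) = 0" "trace (R u v ** I3) = 0"
    by (simp_all add: trace_mul_sym[of "R u v"])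
  show "R u v ** I2 = I2 ** R u v + \<Omega> u v *\<^sub>R I3" "R u v ** I3 = I3 ** R u v - \<Omega> u v *\<^sub>R I2"
    using fc(2,3) \<open>trace (I3 ** R u v) = 0\<close> \<open>trace (I2 ** R u v) = 0\<close>
    by (simp_all add: \<Omega>_def algebra_simps)
qed

private lemma \<Omega>_linear: "linear (\<lambda>X. \<Omega> X v)"
  by (rule linearI) (simp_all add: \<Omega>_def bil_simps matrix_ring_simps trace_simps field_simps)

text \<open>Moving I_2 through R costs the rank-one map X \<mapsto> Omega(X,v) I_3 u, whose trace is
  Omega(I_3 u, v); the same happens for I_3 with the opposite sign.\<close>

private lemma trace_I2_M: "trace (I2 ** M v u) = r v (I2 *v u) - \<Omega> (I3 *v u) v"
  and trace_I3_M: "trace (I3 ** M v u) = r v (I3 *v u) + \<Omega> (I2 *v u) v"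
proof -
  have "I2 *v (R X v *v u) = R X v *v (I2 *v u) - \<Omega> X v *\<^sub>R (I3 *v u)"
    "I3 *v (R X v *v u) = R X v *v (I3 *v u) + \<Omega> X v *\<^sub>R (I2 *v u)" for X
    by (simp_all add: matrix_vector_mul_assoc RI2 RI3 matrix_vector_mult_add_rdistrib
      matrix_vector_mult_diff_rdistrib scaleR_matrix_vector_assoc)
  then have "I2 ** M v u = M v (I2 *v u) - matrix (\<lambda>X. \<Omega> X v *\<^sub>R (I3 *v u))"
    "I3 ** M v u = M v (I3 *v u) + matrix (\<lambda>X. \<Omega> X v *\<^sub>R (I2 *v u))"
    unfolding M_def by (simp_all flip: matrix_comp_left matrix_diff matrix_add)
  then show "trace (I2 ** M v u) = r v (I2 *v u) - \<Omega> (I3 *v u) v"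
    "trace (I3 ** M v u) = r v (I3 *v u) + \<Omega> (I2 *v u) v"
    by (simp_all add: trace_simps trace_matrix_rank1[OF \<Omega>_linear] r_def)
qed

text \<open>Since tr(R I_2) = 0, \<open>trace_R\<close> expresses the asymmetry through
  \<open>\<Omega>\<close>, and \<open>\<Omega>_r\<close> turns this back into Ricci terms. One copy
  of the asymmetry reappears on the right; cancelling it lowers the factor 2n to 2n - 1.\<close>

private lemma W2: "(2 * real n - 1) * (r u (I2 *v v) - r v (I2 *v u)) = r (I1 *v u) (I3 *v v) - r (I3 *v u) (I1 *v v)"
  (is "?a * ?W = _")
proof -
  note vec = frame_mult_vec[OF frame]
  have "?W = - \<Omega> (I3 *v u) v + \<Omega> (I3 *v v) u"
    using trace_R[of u v I2] by (simp add: trI2 trace_I2_M)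
  then have "2 * n * ?W = 2 * n * (\<Omega> (I3 *v v) u - \<Omega> (I3 *v u) v)" by simp
  also have "\<dots> = 2 * n * \<Omega> (I3 *v v) u - 2 * n * \<Omega> (I3 *v u) v" by (rule Rings.right_diff_distrib)
  also have "\<dots> = r (I3 *v v) (I1 *v u) + r u (I2 *v v) - (r (I3 *v u) (I1 *v v) + r v (I2 *v u))"
    unfolding \<Omega>_r by (simp add: vec r_neg)
  finally show ?thesis using r_sym[of "I3 *v v"] by (simp add: algebra_simps)
qed
private lemma W3: "(2 * real n - 1) * (r u (I3 *v v) - r v (I3 *v u)) = r (I2 *v u) (I1 *v v) - r (I1 *v u) (I2 *v v)"
  (is "?a * ?W = _")
proof -
  note vec = frame_mult_vec[OF frame]
  have "?W = \<Omega> (I2 *v u) v - \<Omega> (I2 *v v) u"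
    using trace_R[of u v I3] by (simp add: trI3 trace_I3_M)
  then have "2 * n * ?W = 2 * n * (\<Omega> (I2 *v u) v - \<Omega> (I2 *v v) u)" by simp
  also have "\<dots> = 2 * n * \<Omega> (I2 *v u) v - 2 * n * \<Omega> (I2 *v v) u" by (rule Rings.right_diff_distrib)
  also have "\<dots> = r (I2 *v u) (I1 *v v) - r v (I3 *v u) - (r (I2 *v v) (I1 *v u) - r u (I3 *v v))"
    unfolding \<Omega>_r by (simp add: vec r_neg)
  finally show ?thesis using r_sym[of "I2 *v v"] by (simp add: algebra_simps)
qed

private lemma hermitian_high:
  assumes "n > 1" shows "r (I1 *v u) v = - r u (I1 *v v)"
proof -
  note vec = frame_mult_vec[OF frame]
  have sym0: "W = 0" if "(2 * real n - 1) * W = X" "(2 * real n - 1) * X = W" for W X :: real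
  proof -
    have "(2 * real n - 1) * ((2 * real n - 1) * W) = W" using that by simp
    then have "((2 * real n - 1) * (2 * real n - 1) - 1) * W = 0" by (simp only: Rings.left_diff_distrib mult.assoc)
    moreover have "(2 * real n - 1) * (2 * real n - 1) > 1 * 1" using assms by (intro mult_strict_mono) auto
    ultimately show ?thesis by simp
  qed
  \<comment> \<open>Replacing u, v by I_1 u, I_1 v in \<open>W2\<close> interchanges the roles of
    its two sides up to a common sign, which yields the second premise of
    \<open>sym0\<close>.\<close>
  have 2: "r u (I2 *v v) = r v (I2 *v u)" for u v
    using sym0[OF W2[of u v]] W2[of "I1 *v u" "I1 *v v"] r_sym[of "I3 *v u" "I1 *v v"] r_sym[of v "I2 *v u"]
    by (simp add: vec r_neg algebra_simps)
  have 3: "r u (I3 *v v) = r v (I3 *v u)" for u v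
    using sym0[OF W3[of u v]] W3[of "I1 *v u" "I1 *v v"] r_sym[of "I2 *v u" "I1 *v v"] r_sym[of v "I3 *v u"]
    by (simp add: vec r_neg algebra_simps)
  \<comment> \<open>I_1 = I_2 I_3 = - I_3 I_2, so passing I_2 and I_3 one after the other to the
    other argument reverses the sign for I_1.\<close>
  have "r (I1 *v u) v = r v (I2 *v (I3 *v u))" by (simp add: vec r_sym)
  also have "\<dots> = r (I3 *v u) (I2 *v v)" by (rule 2)
  also have "\<dots> = r (I2 *v v) (I3 *v u)" by (rule r_sym)
  also have "\<dots> = r u (I3 *v (I2 *v v))" by (rule 3)
  finally show ?thesis by (simp add: vec r_neg)
qed

text \<open>The Euclidean product of the chart summed over 1, I_1, I_2, I_3. The frame permutes the
  summands, so its elements are isometries and, squaring to -1, also skew.\<close>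

private definition g where
  "g x y = x \<bullet> y + (I1 *v x) \<bullet> (I1 *v y) + (I2 *v x) \<bullet> (I2 *v y) + (I3 *v x) \<bullet> (I3 *v y)"

private lemma g_bilinear: "bilinear g"
  unfolding bilinear_def
  by (auto intro!: linearI simp: g_def matrix_vector_right_distrib inner_add_left inner_add_right
      matrix_vector_mult_scaleR algebra_simps)

private lemmas g_simps = bilinear_ladd[OF g_bilinear] bilinear_radd[OF g_bilinear] bilinear_lmul[OF g_bilinear]
  bilinear_rmul[OF g_bilinear] bilinear_lneg[OF g_bilinear] bilinear_rneg[OF g_bilinear]
  bilinear_lsub[OF g_bilinear] bilinear_rsub[OF g_bilinear] bilinear_lzero[OF g_bilinear] bilinear_rzero[OF g_bilinear]

private lemma g_sym: "g x y = g y x"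
  by (simp add: g_def inner_commute)

private lemma g_pos: "x \<noteq> 0 \<Longrightarrow> g x x > 0"
  unfolding g_def by (intro add_pos_nonneg) auto

private lemma g_I: "g (I1 *v x) (I1 *v y) = g x y" "g (I2 *v x) (I2 *v y) = g x y" "g (I3 *v x) (I3 *v y) = g x y"
  by (simp_all add: g_def frame_mult_vec[OF frame])

private lemma g_skew: "g (I1 *v x) y = - g x (I1 *v y)" "g (I2 *v x) y = - g x (I2 *v y)" "g (I3 *v x) y = - g x (I3 *v y)"
  using g_I(1)[of x "I1 *v y"] g_I(2)[of x "I2 *v y"] g_I(3)[of x "I3 *v y"]
  by (simp_all add: frame_mult_vec[OF frame] g_simps)

private lemma g_orth: "g x (I1 *v x) = 0" "g x (I2 *v x) = 0" "g x (I3 *v x) = 0"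
  using g_skew[of x x] g_sym[of x] by simp_all

text \<open>In dimension four \<open>x, I\<^sub>1x, I\<^sub>2x, I\<^sub>3x\<close> is a \<open>g\<close>-orthogonal basis of vectors of equal length, and
  the diagonal entries of an operator commuting with the frame all agree.\<close>

private lemma commuting_skew:
  assumes one: "n = 1" and S: "S ** I1 = I1 ** S" "S ** I2 = I2 ** S" "S ** I3 = I3 ** S" and tr: "trace S = 0"
  shows "g (S *v x) x = 0"
proof (cases "x = 0")
  case False
  note vec = frame_mult_vec[OF frame]
  let ?B = "{x, I1 *v x, I2 *v x, I3 *v x}"
  have orth: "g a b = (if a = b then g x x else 0)" if "a \<in> ?B" "b \<in> ?B" for a b
    using that g_pos[OF False] g_orth[of x]
    by (auto simp: g_I g_skew vec g_simps)
  have ne: "g x x \<noteq> 0" using g_pos[OF False] by simp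
  have dist: "x \<noteq> I1 *v x" "x \<noteq> I2 *v x" "x \<noteq> I3 *v x" "I1 *v x \<noteq> I2 *v x" "I1 *v x \<noteq> I3 *v x" "I2 *v x \<noteq> I3 *v x"
    using ne g_orth[of x] g_orth[of "I1 *v x"] g_orth[of "I2 *v x"] g_I[of x x]
    by (auto simp: vec g_simps)
  have fin: "finite ?B" by simp
  have lin: "linear (\<lambda>y. g y b)" for b using g_bilinear by (simp add: bilinear_def)
  have ind: "independent ?B"
  proof (rule independent_if_scalars_zero[OF fin])
    fix f b assume f: "(\<Sum>a\<in>?B. f a *\<^sub>R a) = 0" and b: "b \<in> ?B"
    have "0 = g (\<Sum>a\<in>?B. f a *\<^sub>R a) b" unfolding f by (simp add: g_simps)
    also have "\<dots> = (\<Sum>a\<in>?B. f a * g a b)" by (simp only: linear_sum[OF lin] g_simps real_scaleR_def)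
    also have "\<dots> = (\<Sum>a\<in>?B. if a = b then f a * g x x else 0)" using b by (intro sum.cong) (simp_all only: orth, auto)
    also have "\<dots> = f b * g x x" using b by (simp only: sum.delta[OF fin] if_True)
    finally show "f b = 0" using ne by simp
  qed
  have "card ?B = 4" using dist by simp
  then have sp: "span ?B = UNIV"
    using card_ge_dim_independent[of ?B UNIV] ind card one by auto
  have rep: "representation ?B y b = g y b / g x x" if b: "b \<in> ?B" for y b
  proof -
    have "g y b = g (\<Sum>a\<in>?B. representation ?B y a *\<^sub>R a) b"
      by (subst real_vector.sum_representation_eq[OF ind _ fin]) (simp_all add: sp)
    also have "\<dots> = (\<Sum>a\<in>?B. representation ?B y a * g a b)" by (simp only: linear_sum[OF lin] g_simps real_scaleR_def)
    also have "\<dots> = (\<Sum>a\<in>?B. if a = b then representation ?B y a * g x x else 0)"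
      using b by (intro sum.cong) (simp_all only: orth, auto)
    also have "\<dots> = representation ?B y b * g x x" using b by (simp only: sum.delta[OF fin] if_True)
    finally show ?thesis using ne by simp
  qed
  have Sv: "S *v (I1 *v x) = I1 *v (S *v x)" "S *v (I2 *v x) = I2 *v (S *v x)" "S *v (I3 *v x) = I3 *v (S *v x)"
    using S by (simp_all add: matrix_vector_mul_assoc)
  have "0 = (\<Sum>b\<in>?B. representation ?B (S *v b) b)"
    using trace_representation[OF ind sp, of S] tr by simp
  also have "\<dots> = (\<Sum>b\<in>?B. g (S *v b) b / g x x)" by (rule sum.cong[OF refl rep])
  also have "\<dots> = 4 * (g (S *v x) x / g x x)" using dist by (simp add: Sv g_I)
  finally show ?thesis using ne by simp
qed (simp add: g_simps)

private lemma R_skew: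
  assumes one: "n = 1" shows "g (R u v *v x) y = - g x (R u v *v y)"
proof -
  have 0: "g (R u v *v x) x = 0" for x
  proof -
    \<comment> \<open>Because [I_1, I_2] = 2 I_3, subtracting half of Omega times I_1 cancels the
      rotation of I_2 and I_3 and makes \<open>S\<close> commute with the frame. I_1 is skew itself,
      so skewness of \<open>S\<close> gives that of R.\<close>
    define S where "S = R u v - (\<Omega> u v / 2) *\<^sub>R I1"
    have "g (S *v x) x = 0"
    proof (rule commuting_skew[OF one])
      show "S ** I1 = I1 ** S" "S ** I2 = I2 ** S" "S ** I3 = I3 ** S"
        by (simp_all add: S_def matrix_ring_simps comm RI2 RI3 frame_mult[OF frame] algebra_simps flip: scaleR_add_left)
      show "trace S = 0" by (simp add: S_def trace_simps tr0 frame_trace[OF frame])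
    qed
    then show ?thesis
      using g_orth(1)[of x] g_sym[of x]
      by (simp add: S_def matrix_vector_mult_diff_rdistrib g_simps scaleR_matrix_vector_assoc[symmetric])
  qed
  have "g (R u v *v (x + y)) (x + y) = g (R u v *v x) y + g (R u v *v y) x"
    by (simp only: matrix_vector_right_distrib g_simps 0)
  then show ?thesis using 0[of "x + y"] g_sym[of x] by simp
qed

private lemma hermitian_four:
  assumes one: "n = 1" shows "r (I1 *v u) v = - r u (I1 *v v)"
proof -
  define K where "K a b c d = g (R a b *v c) d" for a b c d
  have K1: "K b a c d = - K a b c d" for a b c d
    unfolding K_def by (subst alt) (simp add: matrix_vector_minus g_simps)
  have K2: "K a b d c = - K a b c d" for a b c d
    using R_skew[OF one, of a b d c] g_sym[of d] by (simp add: K_def)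
  have K3: "K a b c d + K b c a d + K c a b d = 0" for a b c d
    using arg_cong[OF bianchi[of a b c], of "\<lambda>x. g x d"] by (simp add: K_def g_simps)
  \<comment> \<open>The classical octahedron argument: four cyclic Bianchi sums combined with
    skewness in each pair of arguments.\<close>
  have pair: "K a b c d = K c d a b" for a b c d
    using K3[of a b c d] K3[of b c d a] K3[of c d a b] K3[of d a b c]
      K2[of b c a d] K2[of c d a b] K1[of b d c a] K1[of a d c b] K2[of a d b c] K1[of c a d b] K2[of c a b d]
      K1[of a d b c] K2[of a b c d] K2[of b d c a]
    by linarith
  \<comment> \<open>R(c,d) commutes with the isometry I_1; pair symmetry carries this over to the
    first two arguments.\<close>
  have "K (I1 *v a) (I1 *v b) c d = K a b c d" for a b c d
  proof -
    have "K (I1 *v a) (I1 *v b) c d = g (R c d *v (I1 *v a)) (I1 *v b)" unfolding pair[of "I1 *v a"] by (simp add: K_def)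
    also have "\<dots> = g (I1 *v (R c d *v a)) (I1 *v b)" by (simp add: matrix_vector_mul_assoc comm)
    also have "\<dots> = K a b c d" unfolding pair[of a] by (simp add: K_def g_I)
    finally show ?thesis .
  qed
  then have "g (R (I1 *v a) (I1 *v b) *v c - R a b *v c) d = 0" for a b c d by (simp add: K_def g_simps)
  then have RI: "R (I1 *v a) (I1 *v b) *v c = R a b *v c" for a b c
    using g_pos by (metis less_irrefl right_minus_eq)
  have "R (I1 *v X) u = - R X (I1 *v u)" for X
    using RI[of X "I1 *v u"] by (simp add: matrix_eq frame_mult_vec[OF frame] bil_simps) (metis minus_minus matrix_vector_minus(1))
  \<comment> \<open>The trace of this product is evaluated twice, once by the invariance of R just
    shown and once by cyclicity together with \<open>I1_M\<close>.\<close>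
  then have "M u v ** I1 = - M (I1 *v u) v"
    by (simp add: matrix_eq matrix_vector_mul_assoc[symmetric] M_works matrix_vector_minus)
  then have "trace (M u v ** I1) = - r (I1 *v u) v" by (simp add: r_def trace_simps)
  moreover have "trace (M u v ** I1) = r u (I1 *v v)" by (simp add: trace_mul_sym[of "M u v"] I1_M r_def)
  ultimately show ?thesis by simp
qed

text \<open>\<open>trace_R\<close> gives a difference of two Ricci terms. Symmetry and
  I_1-invariance of the Ricci tensor make them negatives of each other, hence the factor -2.\<close>

lemma quaternionic_ricci:
  defines "ric \<equiv> \<lambda>u v. trace (matrix (\<lambda>X. R X u *v v))"
  shows "trace (I1 ** R u v) = - 2 * ric u (I1 *v v)"
proof -
  have h: "r (I1 *v v) u = - r v (I1 *v u)"
    using hermitian_high hermitian_four n by (cases "n = 1") auto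
  have "trace (I1 ** R u v) = r v (I1 *v u) - r u (I1 *v v)"
    unfolding comm[symmetric] by (simp add: trace_R I1_M r_def)
  then show ?thesis using h r_sym[of "I1 *v v" u] by (simp add: r_def M_def ric_def)
qed

end

section \<open>Curvature in one chart\<close>

lemma linear_pd_connection:
  assumes c: "is_chart c" "open U" "U \<subseteq> dom_of c" and p: "p \<in> U"
    and \<Gamma>: "\<And>u. smooth_in c U (\<lambda>p. \<Gamma> c p u)" and lin: "\<And>p. p \<in> U \<Longrightarrow> linear (\<Gamma> c p)"
  shows "linear (\<lambda>v. pd c (\<lambda>q. \<Gamma> c q v) u p)"
proof (rule linearI)
  show "pd c (\<lambda>q. \<Gamma> c q (v + w)) u p = pd c (\<lambda>q. \<Gamma> c q v) u p + pd c (\<lambda>q. \<Gamma> c q w) u p" for v w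
    using pd_cong[OF c p, of "\<lambda>q. \<Gamma> c q (v + w)" "\<lambda>q. \<Gamma> c q v + \<Gamma> c q w"] lin
    by (simp add: linear_add pd_add[OF c p] \<Gamma>)
  show "pd c (\<lambda>q. \<Gamma> c q (a *\<^sub>R v)) u p = a *\<^sub>R pd c (\<lambda>q. \<Gamma> c q v) u p" for v a
    using pd_cong[OF c p, of "\<lambda>q. \<Gamma> c q (a *\<^sub>R v)" "\<lambda>q. a *\<^sub>R \<Gamma> c q v"] lin
    by (simp add: linear_cmul pd_linear[OF c p bounded_linear_scaleR_right] \<Gamma>)
qed

context
  fixes c :: "('m::topological_space, 'k::finite) chart" and U
  assumes c: "is_chart c" "open U" "U \<subseteq> dom_of c"
begin

lemma smooth_in_matrix_mult: "smooth_in c U f \<Longrightarrow> smooth_in c U g \<Longrightarrow> smooth_in c U (\<lambda>p. f p ** g p)"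
  for f :: "'m \<Rightarrow> real^'a^'b" and g :: "'m \<Rightarrow> real^'d^'a"
  by (rule smooth_in_bilinear[OF c bounded_bilinear_matrix_mult])

lemma smooth_in_matrix_vector: "smooth_in c U f \<Longrightarrow> smooth_in c U g \<Longrightarrow> smooth_in c U (\<lambda>p. f p *v g p)"
  for f :: "'m \<Rightarrow> real^'a^'b"
  by (rule smooth_in_bilinear[OF c bounded_bilinear_matrix_vector])

lemma smooth_in_scaleR: "smooth_in c U f \<Longrightarrow> smooth_in c U g \<Longrightarrow> smooth_in c U (\<lambda>p. f p *\<^sub>R g p)"
  by (rule smooth_in_bilinear[OF c bounded_bilinear_scaleR])

lemma smooth_in_mult: "smooth_in c U f \<Longrightarrow> smooth_in c U g \<Longrightarrow> smooth_in c U (\<lambda>p. f p * g p)"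
  for f g :: "'m \<Rightarrow> 'a::real_normed_algebra"
  by (rule smooth_in_bilinear[OF c bounded_bilinear_mult])

lemma smooth_in_trace: "smooth_in c U f \<Longrightarrow> smooth_in c U (\<lambda>p. trace (f p))"
  for f :: "'m \<Rightarrow> real^'a^'a"
  by (rule smooth_in_linear[OF c bounded_linear_trace])

lemma smooth_in_complex_of_real: "smooth_in c U f \<Longrightarrow> smooth_in c U (\<lambda>p. complex_of_real (f p))"
  by (rule smooth_in_linear[OF c bounded_linear_of_real])

lemmas smooth_in_rules = smooth_in_const smooth_in_pd[OF c] smooth_in_add[OF c] smooth_in_diff[OF c] smooth_in_minus[OF c]
  smooth_in_matrix_mult smooth_in_matrix_vector smooth_in_scaleR smooth_in_mult smooth_in_trace smooth_in_complex_of_real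

context
  fixes p assumes p: "p \<in> U"
begin

lemma pd_matrix_mult: "smooth_in c U f \<Longrightarrow> smooth_in c U g \<Longrightarrow>
  pd c (\<lambda>q. f q ** g q) u p = f p ** pd c g u p + pd c f u p ** g p"
  for f :: "'m \<Rightarrow> real^'a^'b" and g :: "'m \<Rightarrow> real^'d^'a"
  by (rule pd_bilinear[OF c p bounded_bilinear_matrix_mult])

lemma pd_matrix_vector: "smooth_in c U f \<Longrightarrow> smooth_in c U g \<Longrightarrow>
  pd c (\<lambda>q. f q *v g q) u p = f p *v pd c g u p + pd c f u p *v g p"
  for f :: "'m \<Rightarrow> real^'a^'b"
  by (rule pd_bilinear[OF c p bounded_bilinear_matrix_vector])

lemma pd_scaleR: "smooth_in c U f \<Longrightarrow> smooth_in c U g \<Longrightarrow>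
  pd c (\<lambda>q. f q *\<^sub>R g q) u p = f p *\<^sub>R pd c g u p + pd c f u p *\<^sub>R g p"
  by (rule pd_bilinear[OF c p bounded_bilinear_scaleR])

lemma pd_mult: "smooth_in c U f \<Longrightarrow> smooth_in c U g \<Longrightarrow>
  pd c (\<lambda>q. f q * g q) u p = f p * pd c g u p + pd c f u p * g p"
  for f g :: "'m \<Rightarrow> 'a::real_normed_algebra"
  by (rule pd_bilinear[OF c p bounded_bilinear_mult])

lemma pd_trace: "smooth_in c U f \<Longrightarrow> pd c (\<lambda>q. trace (f q)) u p = trace (pd c f u p)"
  for f :: "'m \<Rightarrow> real^'a^'a"
  by (rule pd_linear[OF c p bounded_linear_trace])

lemma pd_complex_of_real: "smooth_in c U f \<Longrightarrow> pd c (\<lambda>q. complex_of_real (f q)) u p = complex_of_real (pd c f u p)"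
  by (rule pd_linear[OF c p bounded_linear_of_real])

lemmas pd_rules = pd_add[OF c p] pd_diff[OF c p] pd_const[OF c] pd_matrix_mult pd_matrix_vector pd_scaleR pd_mult pd_trace pd_complex_of_real

end

context
  fixes \<Gamma> :: "('m, 'k) conn"
  assumes \<Gamma>: "\<And>u. smooth_in c U (\<lambda>p. \<Gamma> c p u)"
begin

lemma smooth_in_cov_end: "smooth_in c U J \<Longrightarrow> smooth_in c U (\<lambda>q. cov_end \<Gamma> c J v q)"
  unfolding cov_end_def by (intro smooth_in_rules \<Gamma>)

lemma smooth_in_curv: "smooth_in c U (\<lambda>q. curv \<Gamma> c q u v)"
  unfolding curv_def by (intro smooth_in_rules \<Gamma>)

text \<open>The directions are constant coordinate fields, which commute; the second partial
  derivatives of \<open>J\<close> cancel and the curvature acts on endomorphisms by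
  commutator.\<close>

lemma cov_end_commutator:
  assumes p: "p \<in> U" and J: "smooth_in c U J"
  shows "cov_end \<Gamma> c (\<lambda>q. cov_end \<Gamma> c J v q) u p - cov_end \<Gamma> c (\<lambda>q. cov_end \<Gamma> c J u q) v p =
    curv \<Gamma> c p u v ** J p - J p ** curv \<Gamma> c p u v"
  unfolding cov_end_def curv_def
  by (simp add: pd_rules[OF p] smooth_in_rules \<Gamma> J matrix_ring_simps pd_commute[OF c p J, of u v])

lemma trace_curv:
  assumes p: "p \<in> U"
  shows "trace (curv \<Gamma> c p u v) = pd c (\<lambda>q. trace (\<Gamma> c q v)) u p - pd c (\<lambda>q. trace (\<Gamma> c q u)) v p"
  unfolding curv_def
  by (simp add: pd_rules[OF p] smooth_in_rules \<Gamma> trace_simps trace_mul_sym[of "\<Gamma> c p u"])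

text \<open>The alternating sum is the exterior covariant derivative of the curvature. Only its
  endomorphism values are differentiated covariantly, so no Christoffel symbols act on the two form
  arguments.\<close>

lemma second_bianchi:
  assumes p: "p \<in> U"
  defines "C \<equiv> \<lambda>u v w. cov_end \<Gamma> c (\<lambda>q. curv \<Gamma> c q v w) u p"
  shows "C u v w - C v u w + C w u v = 0"
  unfolding C_def cov_end_def curv_def
  by (simp add: pd_rules[OF p] smooth_in_rules \<Gamma> matrix_ring_simps
     pd_commute[OF c p \<Gamma>, of _ u v] pd_commute[OF c p \<Gamma>, of _ u w] pd_commute[OF c p \<Gamma>, of _ v w])

text \<open>With a = D - Gamma the curvatures differ by the covariant exterior derivative of a plus
  [a_u, a_v]. Both connections preserve \<open>J\<close>, so a commutes with it and tr(J [a_u, a_v])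
  = 0; parallelism of \<open>J\<close> turns the rest into the exterior derivative of tr(J
  a).\<close>

lemma trace_transgression:
  fixes D :: "('m, 'k) conn"
  assumes p: "p \<in> U" and D: "\<And>u. smooth_in c U (\<lambda>p. D c p u)" and J: "smooth_in c U J"
    and J\<Gamma>: "\<And>u. cov_end \<Gamma> c J u p = 0" and JD: "\<And>u. cov_end D c J u p = 0"
  shows "trace (J p ** curv D c p u v) - trace (J p ** curv \<Gamma> c p u v) =
    pd c (\<lambda>q. trace (J q ** (D c q v - \<Gamma> c q v))) u p - pd c (\<lambda>q. trace (J q ** (D c q u - \<Gamma> c q u))) v p"
proof -
  have *: "pd c J u p = J p ** \<Gamma> c p u - \<Gamma> c p u ** J p" for u
    using J\<Gamma>[of u] by (simp add: cov_end_def algebra_simps)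
  have "pd c J u p = J p ** D c p u - D c p u ** J p" for u
    using JD[of u] by (simp add: cov_end_def algebra_simps)
  then have **: "J p ** D c p u - D c p u ** J p = J p ** \<Gamma> c p u - \<Gamma> c p u ** J p" for u
    by (metis *)
  define a where "a u = D c p u - \<Gamma> c p u" for u
  have a: "J p ** a u = a u ** J p" for u
    using **[of u] by (simp add: a_def matrix_ring_simps algebra_simps)
  have D': "D c p u = \<Gamma> c p u + a u" for u by (simp add: a_def)
  have "trace (J p ** (a u ** a v)) = trace (J p ** (a v ** a u))"
  proof -
    have "J p ** (a u ** a v) = a u ** (J p ** a v)" using a[of u] by (simp add: matrix_mul_assoc)
    then show ?thesis using trace_mul_sym[of "a u" "J p ** a v"] by (simp add: matrix_ring_simps)
  qed
  moreover have "trace (J p ** (X ** Y)) = trace (Y ** (J p ** X))" for X Y :: "real^'k^'k"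
    using trace_mul_sym[of Y "J p ** X"] by (simp add: matrix_ring_simps)
  ultimately show ?thesis
    unfolding curv_def
    by (simp add: pd_rules[OF p] smooth_in_rules \<Gamma> D J D' matrix_ring_simps trace_simps *)
qed

text \<open>For parallel \<open>J\<close> the derivative of the trace is the trace against
  \<open>J\<close> of the covariant derivative of the curvature, to which
  \<open>second_bianchi\<close> applies.\<close>

lemma trace_curv_closed:
  assumes p: "p \<in> U" and J: "smooth_in c U J" and J\<Gamma>: "\<And>u. cov_end \<Gamma> c J u p = 0"
  defines "P \<equiv> \<lambda>u v w. pd c (\<lambda>q. trace (J q ** curv \<Gamma> c q v w)) u p"
  shows "P u v w - P v u w + P w u v = 0"
proof -
  have "P u v w = trace (J p ** cov_end \<Gamma> c (\<lambda>q. curv \<Gamma> c q v w) u p)" for u v w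
  proof -
    have "pd c J u p = J p ** \<Gamma> c p u - \<Gamma> c p u ** J p"
      using J\<Gamma>[of u] by (simp add: cov_end_def algebra_simps)
    then show ?thesis
      using trace_mul_sym[of "J p ** curv \<Gamma> c p v w" "\<Gamma> c p u"]
      by (simp add: P_def cov_end_def pd_rules[OF p] smooth_in_rules smooth_in_curv J matrix_ring_simps trace_simps)
  qed
  then show ?thesis
    using arg_cong[OF second_bianchi[OF p, where u=u and v=v and w=w], of "\<lambda>X. trace (J p ** X)"]
    by (simp add: matrix_ring_simps trace_simps)
qed

context
  assumes lin: "\<And>p. p \<in> U \<Longrightarrow> linear (\<Gamma> c p)"
begin

lemma bilinear_curv:
  assumes p: "p \<in> U" shows "bilinear (curv \<Gamma> c p)"
proof -
  have 1: "linear (\<lambda>u. pd c (\<lambda>q. \<Gamma> c q v) u p)" for v using linear_pd[OF c p \<Gamma>] .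
  have 2: "linear (\<lambda>v. pd c (\<lambda>q. \<Gamma> c q v) u p)" for u
    by (rule linear_pd_connection[OF c p, where \<Gamma>=\<Gamma>, OF \<Gamma> lin])
  show ?thesis unfolding bilinear_def
    using linear_add[OF 1] linear_cmul[OF 1] linear_add[OF 2] linear_cmul[OF 2] linear_add[OF lin[OF p]] linear_cmul[OF lin[OF p]]
    by (auto intro!: linearI simp: curv_def matrix_ring_simps algebra_simps)
qed

lemma first_bianchi:
  assumes p: "p \<in> U" and tf: "\<And>q u v. q \<in> U \<Longrightarrow> \<Gamma> c q u *v v = \<Gamma> c q v *v u"
  shows "curv \<Gamma> c p u v *v w + curv \<Gamma> c p v w *v u + curv \<Gamma> c p w u *v v = 0"
proof -
  have d: "pd c (\<lambda>q. \<Gamma> c q v) u p *v w = pd c (\<lambda>q. \<Gamma> c q w) u p *v v" for u v w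
    using pd_cong[OF c p, of "\<lambda>q. \<Gamma> c q v *v w" "\<lambda>q. \<Gamma> c q w *v v"] tf
    by (simp add: pd_rules[OF p] smooth_in_rules \<Gamma>)
  show ?thesis
    unfolding curv_def
    using d[of v u w] d[of u v w] d[of v w u] tf[OF p, of u v] tf[OF p, of u w] tf[OF p, of v w]
    by (simp add: matrix_vector_mult_diff_rdistrib matrix_vector_mult_add_rdistrib flip: matrix_vector_mul_assoc)
qed

end

end

end

section \<open>Change of charts\<close>

context
  fixes A :: "('m::topological_space, 'k::finite) atlas" and c d :: "('m, 'k) chart"
  assumes A: "smooth_atlas A" and c: "c \<in> A" and d: "d \<in> A"
begin

lemma atlas_chart: "is_chart c" "open (dom_of c)"
  using A c by (auto simp: smooth_atlas_def is_chart_def)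

private lemma charts: "is_chart c" "is_chart d" "open (dom_of c)" "open (dom_of d)"
  using A c d by (auto simp: smooth_atlas_def is_chart_def)

private lemma cc: "is_chart c" "open (dom_of c \<inter> dom_of d)" "dom_of c \<inter> dom_of d \<subseteq> dom_of c"
  using charts by auto

private lemma transition_smooth: "smooth_on (snd c ` (dom_of c \<inter> dom_of d)) (snd d \<circ> cinv c)"
  using A c d by (auto simp: smooth_atlas_def)

lemma jac_has_derivative:
  assumes p: "p \<in> dom_of c \<inter> dom_of d"
  shows "((snd d \<circ> cinv c) has_derivative (\<lambda>u. jac c d p *v u)) (at (snd c p))"
  unfolding jac_def using p
  by (intro jacobian_works[THEN iffD1] smooth_on_differentiable[OF transition_smooth] chart_image_open[OF cc]) auto

lemma has_derivative_change_chart: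
  assumes p: "p \<in> dom_of c \<inter> dom_of d" and f: "((f \<circ> cinv d) has_derivative D) (at (snd d p))"
  shows "((f \<circ> cinv c) has_derivative (\<lambda>u. D (jac c d p *v u))) (at (snd c p))"
proof -
  have "((f \<circ> cinv d) has_derivative D) (at ((snd d \<circ> cinv c) (snd c p)))"
    using f p cinv_chart[OF cc(1)] by simp
  from has_derivative_compose[OF jac_has_derivative[OF p] this]
  show ?thesis
  proof (rule has_derivative_transform_within_open[OF _ chart_image_open[OF cc]])
    show "snd c p \<in> snd c ` (dom_of c \<inter> dom_of d)" using p by blast
    fix x assume "x \<in> snd c ` (dom_of c \<inter> dom_of d)"
    from cinv_image(1)[OF cc(1,3) this]
    show "(f \<circ> cinv d) ((snd d \<circ> cinv c) x) = (f \<circ> cinv c) x"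
      using cinv_chart[OF charts(2), of "cinv c x"] by simp
  qed
qed

lemma smooth_in_jac: "smooth_in c (dom_of c \<inter> dom_of d) (jac c d)"
proof -
  let ?U = "dom_of c \<inter> dom_of d"
  \<comment> \<open>The matrix with column \<open>j\<close> equal to \<open>w\<close> and zeros
    elsewhere. It presents the Jacobian as a sum of linear images of partial derivatives, to which
    the closure rules apply.\<close>
  define h :: "'k \<Rightarrow> real^'k \<Rightarrow> real^'k^'k" where "h j w = (\<chi> i l. if l = j then w $ i else 0)" for j w
  have h: "bounded_linear (h j)" for j
    unfolding linear_conv_bounded_linear[symmetric]
    by (rule linearI) (auto simp: h_def vec_eq_iff)
  have "smooth_in c ?U (snd d)" using transition_smooth by (simp add: smooth_in_def)
  then have "smooth_in c ?U (\<lambda>p. \<Sum>j\<in>UNIV. h j (pd c (snd d) (axis j 1) p))"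
    by (intro smooth_in_sum[OF cc] smooth_in_linear[OF cc h] smooth_in_pd[OF cc])
  moreover have "(\<Sum>j\<in>UNIV. h j (pd c (snd d) (axis j 1) p)) = jac c d p" for p
    by (simp add: jac_def jacobian_def matrix_def h_def pd_def vec_eq_iff sum_component)
  ultimately show ?thesis by simp
qed

end

lemma jac_inverse:
  fixes A :: "('m::topological_space, 'k::finite) atlas"
  assumes A: "smooth_atlas A" and c: "c \<in> A" and d: "d \<in> A" and p: "p \<in> dom_of c \<inter> dom_of d"
  shows "jac d c p ** jac c d p = mat 1"
proof -
  have p': "p \<in> dom_of d \<inter> dom_of c" using p by blast
  note chart = atlas_chart[OF A c c]
  have "((snd c \<circ> cinv c) has_derivative (\<lambda>u. u)) (at (snd c p))"
    by (rule has_derivative_transform_within_open[OF has_derivative_ident chart_image_open[OF chart order_refl]])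
      (use p cinv_image(2)[OF chart(1) order_refl] in auto)
  moreover have "((snd c \<circ> cinv c) has_derivative (\<lambda>u. jac d c p *v (jac c d p *v u))) (at (snd c p))"
    by (rule has_derivative_change_chart[OF A c d p jac_has_derivative[OF A d c p']])
  ultimately have "(\<lambda>u. u) = (\<lambda>u. jac d c p *v (jac c d p *v u))" by (rule has_derivative_unique)
  then show ?thesis by (metis (no_types) matrix_eq matrix_vector_mul_assoc matrix_vector_mul_lid)
qed

lemma affine_connectionD:
  assumes "affine_connection A \<Gamma>" "c \<in> A"
  shows "\<And>p. p \<in> dom_of c \<Longrightarrow> linear (\<Gamma> c p)" and "\<And>u. smooth_in c (dom_of c) (\<lambda>p. \<Gamma> c p u)"
  using assms by (auto simp: affine_connection_def)

text \<open>The law without its vector argument: an equation between matrix fields, ready to be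
  differentiated again for the curvature.\<close>

lemma connection_change_chart:
  fixes A :: "('m::topological_space, 'k::finite) atlas"
  assumes A: "smooth_atlas A" and c: "c \<in> A" and d: "d \<in> A" and \<Gamma>: "affine_connection A \<Gamma>"
    and p: "p \<in> dom_of c \<inter> dom_of d"
  shows "jac c d p ** \<Gamma> c p u = pd c (jac c d) u p + \<Gamma> d p (jac c d p *v u) ** jac c d p"
proof (unfold matrix_eq, intro allI)
  fix v
  have cc: "is_chart c" "open (dom_of c \<inter> dom_of d)" "dom_of c \<inter> dom_of d \<subseteq> dom_of c"
    using A c d by (auto simp: smooth_atlas_def is_chart_def)
  have "pd c (\<lambda>q. jac c d q *v v) u p = pd c (jac c d) u p *v v"
    using pd_matrix_vector[OF cc p smooth_in_jac[OF A c d] smooth_in_const, of v u]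
    by (simp add: pd_const[OF cc])
  moreover have "jac c d p *v (\<Gamma> c p u *v v) =
          pd c (\<lambda>q. jac c d q *v v) u p + \<Gamma> d p (jac c d p *v u) *v (jac c d p *v v)"
    using \<Gamma> c d p by (auto simp: affine_connection_def)
  ultimately show "(jac c d p ** \<Gamma> c p u) *v v = (pd c (jac c d) u p + \<Gamma> d p (jac c d p *v u) ** jac c d p) *v v"
    by (simp add: matrix_vector_mult_add_rdistrib flip: matrix_vector_mul_assoc)
qed

text \<open>The connection law is differentiated once more and antisymmetrised. Second derivatives
  of the Jacobian cancel, and torsion-freeness in both charts makes its first derivative symmetric,
  which removes the other inhomogeneous terms.\<close>

lemma curv_change_chart:
  fixes A :: "('m::topological_space, 'k::finite) atlas"
  assumes A: "smooth_atlas A" and c: "c \<in> A" and d: "d \<in> A"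
    and \<Gamma>: "affine_connection A \<Gamma>" and tf: "torsion_free A \<Gamma>"
    and p: "p \<in> dom_of c \<inter> dom_of d"
  shows "jac c d p ** curv \<Gamma> c p u v = curv \<Gamma> d p (jac c d p *v u) (jac c d p *v v) ** jac c d p"
proof -
  let ?U = "dom_of c \<inter> dom_of d"
  have cc: "is_chart c" "open ?U" "?U \<subseteq> dom_of c" and dd: "is_chart d" "open (dom_of d)" "dom_of d \<subseteq> dom_of d"
    using A c d by (auto simp: smooth_atlas_def is_chart_def)
  let ?j = "jac c d"
  have sm: "smooth_in c ?U ?j" "smooth_in c ?U (\<lambda>q. \<Gamma> c q w)" for w
    using smooth_in_jac[OF A c d] affine_connectionD(2)[OF \<Gamma> c] smooth_in_subset cc(3) by blast+
  define E where "E x y = pd d (\<lambda>q. \<Gamma> d q y) x p" for x y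
  have linE: "linear (E x)" for x
    unfolding E_def using p affine_connectionD[OF \<Gamma> d] by (intro linear_pd_connection[OF dd]) auto
  have lind: "linear (\<Gamma> d q)" if "q \<in> ?U" for q using affine_connectionD(1)[OF \<Gamma> d] that by blast
  have expand: "f w = (\<Sum>i\<in>UNIV. w $ i *\<^sub>R f (axis i 1))" if "linear f" for f :: "real^'k \<Rightarrow> real^'k^'k" and w
  proof -
    have "f w = f (\<Sum>i\<in>UNIV. w $ i *\<^sub>R axis i 1)" by (simp add: basis_expansion flip: scalar_mult_eq_scaleR)
    then show ?thesis using that by (simp add: linear_sum linear_cmul)
  qed
  \<comment> \<open>Smoothness of \<open>\<Gamma> d\<close> is given for fixed directions, whereas
    \<open>?j q *v w\<close> moves with \<open>q\<close>. The expansion in the standard basis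
    separates the two dependences.\<close>
  define G where "G w q = (\<Sum>i\<in>UNIV. (?j q *v w) $ i *\<^sub>R \<Gamma> d q (axis i 1))" for w q
  have G: "G w q = \<Gamma> d q (?j q *v w)" if "q \<in> ?U" for w q
    unfolding G_def by (rule expand[OF lind[OF that], symmetric])
  have dG: "((G w \<circ> cinv c) has_derivative (\<lambda>x. \<Gamma> d p (pd c ?j x p *v w) + E (?j p *v x) (?j p *v w))) (at (snd c p))" for w
  proof -
    have 1: "((\<lambda>x. (?j (cinv c x) *v w) $ i) has_derivative (\<lambda>x. (pd c ?j x p *v w) $ i)) (at (snd c p))" for i
    proof -
      have bl: "bounded_linear (\<lambda>T. (T *v w) $ i)"
        using bounded_linear_compose[OF bounded_linear_vec_nth bounded_bilinear.bounded_linear_left[OF bounded_bilinear_matrix_vector]] .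
      show ?thesis
        using bounded_linear.has_derivative[OF bl smooth_in_has_derivative[OF cc p sm(1)]] by (simp add: comp_def)
    qed
    have 2: "((\<lambda>x. \<Gamma> d (cinv c x) (axis i 1)) has_derivative (\<lambda>x. E (?j p *v x) (axis i 1))) (at (snd c p))" for i
      using has_derivative_change_chart[OF A c d p smooth_in_has_derivative[OF dd _ affine_connectionD(2)[OF \<Gamma> d]], of "axis i 1"] p
      unfolding E_def comp_def by blast
    have "((\<lambda>x. \<Sum>i\<in>UNIV. (?j (cinv c x) *v w) $ i *\<^sub>R \<Gamma> d (cinv c x) (axis i 1)) has_derivative
       (\<lambda>x. \<Sum>i\<in>UNIV. (?j (cinv c (snd c p)) *v w) $ i *\<^sub>R E (?j p *v x) (axis i 1) + (pd c ?j x p *v w) $ i *\<^sub>R \<Gamma> d (cinv c (snd c p)) (axis i 1))) (at (snd c p))"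
      by (intro has_derivative_sum has_derivative_scaleR 1 2)
    moreover have "cinv c (snd c p) = p" using cinv_chart[OF cc(1)] p by blast
    ultimately show ?thesis
      unfolding G_def comp_def expand[OF linE, where w="?j p *v w"] expand[OF lind[OF p], where w="pd c ?j _ p *v w"]
      by (simp add: sum.distrib add.commute)
  qed
  have deriv: "\<Gamma> d p (?j p *v w) ** pd c ?j x p + (\<Gamma> d p (pd c ?j x p *v w) + E (?j p *v x) (?j p *v w)) ** ?j p =
     ?j p ** pd c (\<lambda>q. \<Gamma> c q w) x p + pd c ?j x p ** \<Gamma> c p w - pd c (pd c ?j w) x p" for w x
  proof -
    have "pd c (\<lambda>q. G w q ** ?j q) x p = G w p ** pd c ?j x p + (\<Gamma> d p (pd c ?j x p *v w) + E (?j p *v x) (?j p *v w)) ** ?j p"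
      using bounded_bilinear.FDERIV[OF bounded_bilinear_matrix_mult dG smooth_in_has_derivative[OF cc p sm(1)], of w]
        cinv_chart[OF cc(1), of p] p
      by (intro pd_eqI) (simp add: comp_def)
    moreover have "pd c (\<lambda>q. G w q ** ?j q) x p = pd c (\<lambda>q. ?j q ** \<Gamma> c q w - pd c ?j w q) x p"
      by (rule pd_cong[OF cc p]) (simp add: G connection_change_chart[OF A c d \<Gamma>])
    ultimately show ?thesis
      by (simp add: G[OF p] pd_rules[OF cc p] smooth_in_rules[OF cc] sm)
  qed
  have a: "pd c ?j x p = ?j p ** \<Gamma> c p x - \<Gamma> d p (?j p *v x) ** ?j p" for x
    using connection_change_chart[OF A c d \<Gamma> p, of x] by simp
  have tfc: "\<Gamma> c p x *v y = \<Gamma> c p y *v x" "\<Gamma> d p x *v y = \<Gamma> d p y *v x" for x y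
    using tf c d p by (auto simp: torsion_free_def)
  have sym: "pd c ?j u p *v v = pd c ?j v p *v u"
    unfolding a by (simp add: matrix_vector_mult_diff_rdistrib tfc(1)[of u v] tfc(2)[of "?j p *v u" "?j p *v v"]
      flip: matrix_vector_mul_assoc)
  have comm: "pd c (pd c ?j u) v p = pd c (pd c ?j v) u p"
    by (rule pd_commute[OF cc p sm(1)])
  show ?thesis
    using deriv[of v u] deriv[of u v] unfolding comm sym curv_def E_def[symmetric]
    by (simp add: a matrix_ring_simps algebra_simps) (smt (verit) add.assoc add.commute add_diff_cancel_left')
qed

section \<open>Twistor functions and cohomology\<close>

lemma frame_qnorm:
  fixes T :: "real^'k^'k"
  assumes frame: "admissible_frame V I1 I2 I3" and T: "T \<in> V"
  shows "T ** T = - ((qnorm T)\<^sup>2 *\<^sub>R mat 1)" and "T \<noteq> 0 \<Longrightarrow> - (1 / CARD('k)) * trace (T ** T) > 0"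
    and "T \<noteq> 0 \<Longrightarrow> qnorm T > 0"
proof -
  obtain a b c where X: "T = a *\<^sub>R I1 + b *\<^sub>R I2 + c *\<^sub>R I3" using frame_coordinates[OF frame T] .
  have TT: "T ** T = - ((a\<^sup>2 + b\<^sup>2 + c\<^sup>2) *\<^sub>R mat 1)"
    unfolding X by (simp add: matrix_ring_simps frame_mult[OF frame] power2_eq_square algebra_simps)
  have tr: "- (1 / CARD('k)) * trace (T ** T) = a\<^sup>2 + b\<^sup>2 + c\<^sup>2"
    unfolding TT by (simp add: trace_simps)
  then have q: "qnorm T = sqrt (a\<^sup>2 + b\<^sup>2 + c\<^sup>2)" unfolding qnorm_def by simp
  have "(qnorm T)\<^sup>2 = a\<^sup>2 + b\<^sup>2 + c\<^sup>2" unfolding q by simp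
  then show "T ** T = - ((qnorm T)\<^sup>2 *\<^sub>R mat 1)" unfolding TT by simp
  assume "T \<noteq> 0"
  then have "a \<noteq> 0 \<or> b \<noteq> 0 \<or> c \<noteq> 0" unfolding X by auto
  then have "a\<^sup>2 + b\<^sup>2 + c\<^sup>2 > 0"
    by (metis add_nonneg_pos add_pos_nonneg zero_le_power2 zero_less_power2 add_nonneg_nonneg)
  then show "- (1 / CARD('k)) * trace (T ** T) > 0" "qnorm T > 0" using tr q by simp_all
qed

lemma qnorm_scaleR: "qnorm (a *\<^sub>R T) = \<bar>a\<bar> * qnorm T" for T :: "real^'k^'k"
proof -
  have "- (1 / real CARD('k)) * trace ((a *\<^sub>R T) ** (a *\<^sub>R T)) = a\<^sup>2 * (- (1 / real CARD('k)) * trace (T ** T))"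
    by (simp add: matrix_ring_simps trace_simps power2_eq_square)
  then show ?thesis unfolding qnorm_def by (simp only: real_sqrt_mult real_sqrt_abs)
qed

lemma conjugate_trace:
  fixes j j' X X' I I' :: "real^'k^'k"
  assumes j: "j' ** j = mat 1" and X: "j ** X = X' ** j"
  shows "trace X' = trace X" and "I' = j ** I ** j' \<Longrightarrow> trace (I' ** X') = trace (I ** X)"
proof -
  have j': "j ** j' = mat 1" using j matrix_left_right_inverse by blast
  have X': "X' = j ** (X ** j')"
    using X j' by (metis matrix_mul_assoc matrix_mul_rid)
  have jj: "j' ** (j ** Y) = Y" for Y :: "real^'k^'k" using j by (simp add: matrix_mul_assoc)
  show "trace X' = trace X"
    unfolding X' using trace_mul_sym[of j "X ** j'"] j by (simp add: matrix_ring_simps)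
  show "trace (I' ** X') = trace (I ** X)" if "I' = j ** I ** j'"
    unfolding X' that using trace_mul_sym[of j "I ** (X ** j')"] j by (simp add: matrix_ring_simps jj)
qed

text \<open>\<open>X\<close> stands for the derivative of I_1 and \<open>D\<close> for the
  mu-connection minus the twistor connection. Pairing with I_1 kills \<open>X\<close> and the
  commutator and expresses \<open>\<xi>\<close> by tr D. The values of \<open>\<xi>\<close> on I_2 u
  and I_3 u are then \<open>- f\<close> times the coefficients of [D, I_1] found with
  \<open>frame_symmetric_trace\<close>, so only f X = 0 is left.\<close>

lemma twistor_equation_parallel:
  fixes D :: "real^'k \<Rightarrow> real^'k^'k"
  assumes frame: "admissible_frame V I1 I2 I3"
    and lin: "linear D" and sym: "\<And>u v. D u *v v = D v *v u"
    and DV: "\<And>u J. J \<in> V \<Longrightarrow> D u ** J - J ** D u \<in> V"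
    and card: "CARD('k) = 4 * n" and n: "n \<ge> 1"
    and f: "f \<noteq> 0" and \<xi>: "linear \<xi>" and X: "\<And>u. trace (I1 ** X u) = 0"
    and eq: "\<And>u. f *\<^sub>R (X u - (D u ** I1 - I1 ** D u)) - (trace (D u) * f / (2 * (n + 1))) *\<^sub>R I1 =
      \<xi> (I1 *v u) *\<^sub>R I1 + \<xi> (I2 *v u) *\<^sub>R I2 + \<xi> (I3 *v u) *\<^sub>R I3"
  shows "X u = 0"
proof -
  note vec = frame_mult_vec[OF frame]
  define t where "t u = trace (D u)" for u
  have t: "t (- u) = - t u" for u by (simp add: t_def linear_neg[OF lin] trace_simps)
  have "\<xi> (I1 *v u) = - t u * f / (2 * (n + 1))" for u
  proof -
    have "f * (trace (I1 ** X u) - trace (I1 ** (D u ** I1 - I1 ** D u))) + t u * f / (2 * (n + 1)) * CARD('k) =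
      - \<xi> (I1 *v u) * CARD('k)"
      using arg_cong[OF eq[of u], of "\<lambda>X. trace (I1 ** X)"]
      by (simp add: matrix_ring_simps trace_simps frame_mult[OF frame] frame_trace[OF frame] t_def)
    then have "(t u * f / (2 * (n + 1)) + \<xi> (I1 *v u)) * CARD('k) = 0"
      unfolding trace_commutator by (simp add: X algebra_simps)
    then show ?thesis using card n by simp
  qed
  \<comment> \<open>Every w is I_1 applied to - I_1 w, so the I_1-component already fixes the whole
    form.\<close>
  from this[of "- (I1 *v u)" for u] have \<xi>t: "\<xi> w = t (I1 *v w) * f / (2 * (n + 1))" for w
    by (simp add: vec matrix_vector_minus t)
  have tr: "- 2 * trace (I2 ** D u) / CARD('k) = - t (I2 *v u) / (2 * (n + 1))"
    "- 2 * trace (I3 ** D u) / CARD('k) = - t (I3 *v u) / (2 * (n + 1))"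
    using frame_symmetric_trace(2,3)[OF frame lin sym DV card n, of u] n
    by (simp_all add: t_def card field_simps)
  have "D u ** I1 - I1 ** D u = (- t (I3 *v u) / (2 * (n + 1))) *\<^sub>R I2 - (- t (I2 *v u) / (2 * (n + 1))) *\<^sub>R I3"
    using frame_commutator(1)[OF frame, of "D u", OF DV DV DV, OF frame_mem[OF frame]] unfolding tr .
  note eq[of u, unfolded this \<xi>t]
  then have "f *\<^sub>R X u = 0"
    by (simp add: vec t t_def[symmetric] algebra_simps)
  then show ?thesis using f by simp
qed

section \<open>One-forms and the cohomology relation\<close>

lemma one_formD:
  assumes "one_form A \<eta>" "c \<in> A"
  shows "\<And>p. p \<in> dom_of c \<Longrightarrow> linear (\<eta> c p)" and "\<And>u. smooth_in c (dom_of c) (\<lambda>p. \<eta> c p u)"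
    and "\<And>d p u. d \<in> A \<Longrightarrow> p \<in> dom_of c \<inter> dom_of d \<Longrightarrow> \<eta> c p u = \<eta> d p (jac c d p *v u)"
  using assms unfolding one_form_def by blast+

lemma smooth_atlas_chart:
  assumes "smooth_atlas A" "c \<in> A" shows "is_chart c" "open (dom_of c)" "dom_of c \<subseteq> dom_of c"
  using assms unfolding smooth_atlas_def is_chart_def by blast+

lemma one_form_add:
  assumes A: "smooth_atlas A" and \<eta>: "one_form A \<eta>" and \<theta>: "one_form A \<theta>"
  shows "one_form A (\<lambda>c p u. \<eta> c p u + \<theta> c p u)"
  unfolding one_form_def
proof (intro conjI ballI allI)
  fix c assume c: "c \<in> A"
  show "smooth_in c (dom_of c) (\<lambda>p. \<eta> c p u + \<theta> c p u)" for u
    by (rule smooth_in_add[OF smooth_atlas_chart[OF A c] one_formD(2)[OF \<eta> c] one_formD(2)[OF \<theta> c]])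
  show "linear (\<lambda>u. \<eta> c p u + \<theta> c p u)" if "p \<in> dom_of c" for p
    by (rule linear_compose_add[OF one_formD(1)[OF \<eta> c that] one_formD(1)[OF \<theta> c that]])
  show "\<eta> c p u + \<theta> c p u = \<eta> d p (jac c d p *v u) + \<theta> d p (jac c d p *v u)"
    if "d \<in> A" "p \<in> dom_of c \<inter> dom_of d" for d p u
    using one_formD(3)[OF \<eta> c that] one_formD(3)[OF \<theta> c that] by metis
qed

lemma one_form_minus:
  assumes A: "smooth_atlas A" and \<eta>: "one_form A \<eta>"
  shows "one_form A (\<lambda>c p u. - \<eta> c p u)"
  unfolding one_form_def
proof (intro conjI ballI allI)
  fix c assume c: "c \<in> A"
  show "smooth_in c (dom_of c) (\<lambda>p. - \<eta> c p u)" for u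
    by (rule smooth_in_minus[OF smooth_atlas_chart[OF A c] one_formD(2)[OF \<eta> c]])
  show "linear (\<lambda>u. - \<eta> c p u)" if "p \<in> dom_of c" for p
    by (rule linear_compose_neg[OF one_formD(1)[OF \<eta> c that]])
  show "- \<eta> c p u = - \<eta> d p (jac c d p *v u)" if "d \<in> A" "p \<in> dom_of c \<inter> dom_of d" for d p u
    using one_formD(3)[OF \<eta> c that] by metis
qed

lemma cohomologous_sym:
  assumes A: "smooth_atlas A" and c: "cohomologous A \<omega> \<omega>'" shows "cohomologous A \<omega>' \<omega>"
proof -
  obtain \<eta> where \<eta>: "one_form A \<eta>" and eq: "\<And>c p u v. c \<in> A \<Longrightarrow> p \<in> dom_of c \<Longrightarrow>
      \<omega> c p u v - \<omega>' c p u v = pd c (\<lambda>q. \<eta> c q v) u p - pd c (\<lambda>q. \<eta> c q u) v p"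
    using c unfolding cohomologous_def by blast
  show ?thesis unfolding cohomologous_def
  proof (intro exI conjI ballI allI)
    show "one_form A (\<lambda>c p u. - \<eta> c p u)" using one_form_minus[OF A \<eta>] .
    fix c p u v assume c: "c \<in> A" and p: "p \<in> dom_of c"
    note ch = smooth_atlas_chart[OF A c]
    have "pd c (\<lambda>q. - \<eta> c q v) u p = - pd c (\<lambda>q. \<eta> c q v) u p" for u v
      by (rule pd_linear[OF ch p bounded_linear_minus[OF bounded_linear_ident] one_formD(2)[OF \<eta> c]])
    then show "\<omega>' c p u v - \<omega> c p u v = pd c (\<lambda>q. - \<eta> c q v) u p - pd c (\<lambda>q. - \<eta> c q u) v p"
      using eq[OF c p, of u v] by (simp add: algebra_simps)
  qed
qed

lemma cohomologous_trans:
  assumes A: "smooth_atlas A" and c: "cohomologous A \<omega> \<omega>'" "cohomologous A \<omega>' \<omega>''" shows "cohomologous A \<omega> \<omega>''"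
proof -
  obtain \<eta> where \<eta>: "one_form A \<eta>" and eq: "\<And>c p u v. c \<in> A \<Longrightarrow> p \<in> dom_of c \<Longrightarrow>
      \<omega> c p u v - \<omega>' c p u v = pd c (\<lambda>q. \<eta> c q v) u p - pd c (\<lambda>q. \<eta> c q u) v p"
    using c unfolding cohomologous_def by blast
  obtain \<theta> where \<theta>: "one_form A \<theta>" and eq': "\<And>c p u v. c \<in> A \<Longrightarrow> p \<in> dom_of c \<Longrightarrow>
      \<omega>' c p u v - \<omega>'' c p u v = pd c (\<lambda>q. \<theta> c q v) u p - pd c (\<lambda>q. \<theta> c q u) v p"
    using c unfolding cohomologous_def by blast
  show ?thesis unfolding cohomologous_def
  proof (intro exI conjI ballI allI)
    show "one_form A (\<lambda>c p u. \<eta> c p u + \<theta> c p u)" using one_form_add[OF A \<eta> \<theta>] .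
    fix c p u v assume c: "c \<in> A" and p: "p \<in> dom_of c"
    note ch = smooth_atlas_chart[OF A c]
    have "\<omega> c p u v - \<omega>'' c p u v = (\<omega> c p u v - \<omega>' c p u v) + (\<omega>' c p u v - \<omega>'' c p u v)" by simp
    then show "\<omega> c p u v - \<omega>'' c p u v = pd c (\<lambda>q. \<eta> c q v + \<theta> c q v) u p - pd c (\<lambda>q. \<eta> c q u + \<theta> c q u) v p"
      unfolding eq[OF c p] eq'[OF c p]
      by (simp add: pd_add[OF ch p one_formD(2)[OF \<eta> c] one_formD(2)[OF \<theta> c]])
  qed
qed

lemma derham_class_eq:
  assumes "smooth_atlas A" "cohomologous A \<omega> \<omega>'" shows "derham_class A \<omega> = derham_class A \<omega>'"
  using assms cohomologous_sym cohomologous_trans unfolding derham_class_def by blast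

text \<open>\<open>preserves_Q\<close> speaks of local sections; an element of one fibre is extended
  with constant coefficients in a local basis of sections.\<close>

lemma section_through:
  fixes A :: "('m::topological_space, 'k::finite) atlas"
  assumes A: "smooth_atlas A" and Q: "rank3_subbundle A Q" and c: "c \<in> A" and p: "p \<in> dom_of c" and J: "J \<in> Q c p"
  obtains U \<sigma> where "open U" "p \<in> U" "U \<subseteq> dom_of c" "smooth_in c U \<sigma>" "\<And>q. q \<in> U \<Longrightarrow> \<sigma> q \<in> Q c q" "\<sigma> p = J"
proof -
  obtain U s1 s2 s3 where U: "open U" "p \<in> U" "U \<subseteq> dom_of c"
    and s: "smooth_in c U s1" "smooth_in c U s2" "smooth_in c U s3"
    and sp: "\<And>q. q \<in> U \<Longrightarrow> Q c q = span {s1 q, s2 q, s3 q}"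
    using Q c p unfolding rank3_subbundle_def by metis
  have ch: "is_chart c" using A c by (auto simp: smooth_atlas_def)
  obtain a b d where "J - a *\<^sub>R s1 p - b *\<^sub>R s2 p - d *\<^sub>R s3 p = 0"
    using J unfolding sp[OF U(2)] span_breakdown_eq by (auto simp: algebra_simps)
  then have J: "J = a *\<^sub>R s1 p + b *\<^sub>R s2 p + d *\<^sub>R s3 p" by (simp add: algebra_simps)
  show ?thesis
  proof (rule that[OF U])
    show "smooth_in c U (\<lambda>q. a *\<^sub>R s1 q + b *\<^sub>R s2 q + d *\<^sub>R s3 q)"
      by (intro smooth_in_rules[OF ch U(1,3)] s)
    show "a *\<^sub>R s1 q + b *\<^sub>R s2 q + d *\<^sub>R s3 q \<in> Q c q" if "q \<in> U" for q
      unfolding sp[OF that] by (intro span_add span_scale span_base) auto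
  qed (simp add: J)
qed

lemma subspace_fiber:
  assumes "almost_quaternionic A Q" "c \<in> A" "p \<in> dom_of c" shows "subspace (Q c p)"
  using assms unfolding almost_quaternionic_def admissible_frame_def by (metis subspace_span)

lemma preserves_QD:
  assumes "preserves_Q A Q \<Gamma>" "c \<in> A" "open U" "U \<subseteq> dom_of c" "smooth_in c U J"
    and "\<And>q. q \<in> U \<Longrightarrow> J q \<in> Q c q" "p \<in> U"
  shows "cov_end \<Gamma> c J u p \<in> Q c p"
  using assms(1)[unfolded preserves_Q_def, rule_format, OF assms(2), of U J p u] assms(3-7) by simp

text \<open>The commutator is the antisymmetrised second covariant derivative of a local section
  through \<open>J\<close>, and each covariant derivative stays in Q.\<close>

lemma curv_preserves_Q:
  fixes A :: "('m::topological_space, 'k::finite) atlas"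
  assumes A: "smooth_atlas A" and Q: "almost_quaternionic A Q" and \<Gamma>: "affine_connection A \<Gamma>" "preserves_Q A Q \<Gamma>"
    and c: "c \<in> A" and p: "p \<in> dom_of c" and J: "J \<in> Q c p"
  shows "curv \<Gamma> c p u v ** J - J ** curv \<Gamma> c p u v \<in> Q c p"
proof -
  obtain U \<sigma> where U: "open U" "p \<in> U" "U \<subseteq> dom_of c" and \<sigma>: "smooth_in c U \<sigma>" "\<And>q. q \<in> U \<Longrightarrow> \<sigma> q \<in> Q c q" "\<sigma> p = J"
    using section_through[OF A conjunct1[OF Q[unfolded almost_quaternionic_def]] c p J] by blast
  have ch: "is_chart c" using A c by (auto simp: smooth_atlas_def)
  have \<Gamma>s: "smooth_in c U (\<lambda>p. \<Gamma> c p u)" for u using affine_connectionD(2)[OF \<Gamma>(1) c] U(3) smooth_in_subset by blast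
  have *: "cov_end \<Gamma> c \<tau> u q \<in> Q c q" if "smooth_in c U \<tau>" "\<And>q. q \<in> U \<Longrightarrow> \<tau> q \<in> Q c q" "q \<in> U" for \<tau> u q
    using preserves_QD[OF \<Gamma>(2) c U(1,3)] that by blast
  have "cov_end \<Gamma> c (\<lambda>q. cov_end \<Gamma> c \<sigma> v q) u p \<in> Q c p" for u v
    by (intro * smooth_in_cov_end[OF ch U(1,3), where \<Gamma>=\<Gamma>, OF \<Gamma>s] \<sigma> U)
  then have "cov_end \<Gamma> c (\<lambda>q. cov_end \<Gamma> c \<sigma> v q) u p - cov_end \<Gamma> c (\<lambda>q. cov_end \<Gamma> c \<sigma> u q) v p \<in> Q c p"
    using subspace_fiber[OF Q c p] by (simp add: subspace_diff)
  then show ?thesis using cov_end_commutator[OF ch U(1,3), where \<Gamma>=\<Gamma>, OF \<Gamma>s U(2) \<sigma>(1), of v u] by (simp add: \<sigma>)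
qed

lemma parallel_commutes_curv:
  fixes c :: "('m::topological_space, 'k::finite) chart"
  assumes c: "is_chart c" "open U" "U \<subseteq> dom_of c" and p: "p \<in> U" and \<Gamma>: "\<And>u. smooth_in c U (\<lambda>p. \<Gamma> c p u)"
    and J: "smooth_in c U J" "\<And>q u. q \<in> U \<Longrightarrow> cov_end \<Gamma> c J u q = 0"
  shows "curv \<Gamma> c p u v ** J p = J p ** curv \<Gamma> c p u v"
proof -
  have "cov_end \<Gamma> c (\<lambda>q. cov_end \<Gamma> c J v q) u p = 0" for u v
    unfolding cov_end_def[of _ _ "\<lambda>q. cov_end \<Gamma> c J v q"]
    by (subst pd_cong[OF c p, of _ "\<lambda>q. 0"]) (simp_all add: J p pd_const[OF c] matrix_ring_simps)
  then show ?thesis using cov_end_commutator[OF c, where \<Gamma>=\<Gamma>, OF \<Gamma> p J(1), of v u] by simp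
qed

lemma pd_power:
  fixes c :: "('m::topological_space, 'k::finite) chart" and f :: "'m \<Rightarrow> real"
  assumes c: "is_chart c" "open U" "U \<subseteq> dom_of c" and p: "p \<in> U" and f: "smooth_in c U f"
  shows "pd c (\<lambda>q. f q ^ N) u p = N * f p ^ (N - 1) * pd c f u p"
  using has_derivative_power[OF smooth_in_has_derivative[OF c p f], of N] cinv_chart[OF c(1), of p] c(3) p
  by (intro pd_eqI) (auto simp: comp_def mult_ac)

section \<open>The Ricci form and the first Chern class\<close>

context
  fixes n :: nat
    and A :: "('m::{t2_space,second_countable_topology}, 'k::finite) atlas"
    and Q :: "('m, 'k) qbundle"
    and \<mu> I :: "('m, 'k, real^'k^'k) fld"
    and \<Gamma> :: "('m, 'k) conn"
  assumes qcm: "quaternionic_complex_manifold n A Q \<mu>"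
    and ics: "induced_complex_structure n A Q \<mu> I"
    and mu: "mu_connection n A Q \<mu> \<Gamma>"
begin

private lemma basics: "n \<ge> 1" "CARD('k) = 4 * n" "smooth_atlas A" "almost_quaternionic A Q"
  "\<And>c p. c \<in> A \<Longrightarrow> p \<in> dom_of c \<Longrightarrow> \<mu> c p \<noteq> 0"
  "affine_connection A \<Gamma>" "torsion_free A \<Gamma>" "preserves_Q A Q \<Gamma>"
  using qcm mu
  by (auto simp: quaternionic_complex_manifold_def quaternionic_manifold_def mu_connection_def quaternionic_connection_def)

private lemma frame_exists:
  assumes "c \<in> A" "p \<in> dom_of c" obtains I1 I2 I3 where "admissible_frame (Q c p) I1 I2 I3"
  using basics(4) assms unfolding almost_quaternionic_def by blast

private lemma decomposition_nonzero:
  assumes dec: "mu_decomposition n A Q \<mu> e \<nu> \<mu>'" and c: "c \<in> A" and p: "p \<in> dom_of c"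
  shows "e c p \<noteq> 0" "\<mu>' c p \<noteq> 0" "\<mu>' c p \<in> Q c p" "\<mu> c p = e c p *\<^sub>R \<mu>' c p"
    "\<nu> c p \<noteq> 0" "e c p ^ (2 * (n + 1)) = 1 / \<nu> c p"
    "0 < qnorm (\<mu>' c p)" "0 < - (1 / CARD('k)) * trace (\<mu>' c p ** \<mu>' c p)"
    "\<mu>' c p ** \<mu>' c p = - ((qnorm (\<mu>' c p))\<^sup>2 *\<^sub>R mat 1)"
proof -
  show *: "\<mu> c p = e c p *\<^sub>R \<mu>' c p" "\<mu>' c p \<in> Q c p" "\<nu> c p \<noteq> 0" "e c p ^ (2 * (n + 1)) = 1 / \<nu> c p"
    using dec c p by (auto simp: mu_decomposition_def section_Q_def associated_pair_def)
  show 0: "e c p \<noteq> 0" "\<mu>' c p \<noteq> 0" using *(1) basics(5)[OF c p] by auto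
  obtain I1 I2 I3 where "admissible_frame (Q c p) I1 I2 I3" using frame_exists[OF c p] .
  from frame_qnorm[OF this *(2)] 0
  show "0 < qnorm (\<mu>' c p)" "0 < - (1 / CARD('k)) * trace (\<mu>' c p ** \<mu>' c p)"
    "\<mu>' c p ** \<mu>' c p = - ((qnorm (\<mu>' c p))\<^sup>2 *\<^sub>R mat 1)" by auto
qed

text \<open>\<open>f\<close> is e times the norm of \<open>\<mu>'\<close>. The last property is
  phrased by the norm of \<open>\<mu>\<close> because \<open>I\<close> and the mu-volume may come
  from different associated pairs; the even power removes the sign ambiguity of
  \<open>I\<close>.\<close>

private lemma I_props:
  obtains f :: "('m, 'k, real) fld" where
    "\<And>c p. c \<in> A \<Longrightarrow> p \<in> dom_of c \<Longrightarrow> I c p \<in> Q c p"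
    "\<And>c p. c \<in> A \<Longrightarrow> p \<in> dom_of c \<Longrightarrow> I c p ** I c p = - mat 1"
    "\<And>c. c \<in> A \<Longrightarrow> smooth_in c (dom_of c) (I c)"
    "\<And>c. c \<in> A \<Longrightarrow> smooth_in c (dom_of c) (f c)"
    "\<And>c p. c \<in> A \<Longrightarrow> p \<in> dom_of c \<Longrightarrow> \<mu> c p = f c p *\<^sub>R I c p"
    "\<And>c d p. c \<in> A \<Longrightarrow> d \<in> A \<Longrightarrow> p \<in> dom_of c \<inter> dom_of d \<Longrightarrow> I d p = jac c d p ** I c p ** jac d c p"
    "\<And>c p. c \<in> A \<Longrightarrow> p \<in> dom_of c \<Longrightarrow> f c p ^ (2 * (n + 1)) = qnorm (\<mu> c p) ^ (2 * (n + 1))"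
proof -
  obtain e \<nu> \<mu>' where dec: "mu_decomposition n A Q \<mu> e \<nu> \<mu>'"
    and I: "\<And>c p. c \<in> A \<Longrightarrow> p \<in> dom_of c \<Longrightarrow> I c p = (1 / qnorm (\<mu>' c p)) *\<^sub>R \<mu>' c p"
    using ics unfolding induced_complex_structure_def by blast
  note dn = decomposition_nonzero[OF dec]
  define f where "f c p = e c p * qnorm (\<mu>' c p)" for c p
  have e: "smooth_in c (dom_of c) (e c)" and m: "smooth_in c (dom_of c) (\<mu>' c)" if "c \<in> A" for c
    using dec that unfolding mu_decomposition_def associated_pair_def section_L_def section_Q_def endo_field_def by blast+
  \<comment> \<open>The squared norm. It is smooth and positive, so the norm and its inverse are
    smooth as real powers of it.\<close>
  define h where "h c p = - (1 / CARD('k)) * trace (\<mu>' c p ** \<mu>' c p)" for c p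
  have q: "qnorm (\<mu>' c p) = h c p powr (1/2)" if "c \<in> A" "p \<in> dom_of c" for c p
    using dn(8)[OF that] unfolding qnorm_def h_def by (simp add: powr_half_sqrt)
  have h: "smooth_in c (dom_of c) (h c)" if "c \<in> A" for c
  proof -
    note ch = smooth_atlas_chart[OF basics(3) that]
    show ?thesis unfolding h_def by (intro smooth_in_rules[OF ch] m that)
  qed
  have hp: "smooth_in c (dom_of c) (\<lambda>p. h c p powr a)" if "c \<in> A" for c a
    by (rule smooth_in_powr[OF smooth_atlas_chart[OF basics(3) that] _ h[OF that]])
      (use dn(8) that in \<open>simp add: h_def\<close>)
  show ?thesis
  proof (rule that[of f])
    show "I c p \<in> Q c p" if "c \<in> A" "p \<in> dom_of c" for c p
      unfolding I[OF that] using dn(3)[OF that] subspace_fiber[OF basics(4) that] by (simp add: subspace_scale)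
    show "I c p ** I c p = - mat 1" if "c \<in> A" "p \<in> dom_of c" for c p
      unfolding I[OF that] using dn(7,9)[OF that] by (simp add: matrix_ring_simps power2_eq_square)
    show "smooth_in c (dom_of c) (I c)" if c: "c \<in> A" for c
    proof -
      note ch = smooth_atlas_chart[OF basics(3) c]
      have "smooth_in c (dom_of c) (\<lambda>p. h c p powr (- (1/2)) *\<^sub>R \<mu>' c p)"
        by (intro smooth_in_scaleR[OF ch] hp m c)
      then show ?thesis
        by (subst smooth_in_cong[OF ch, where g="\<lambda>p. h c p powr (- (1/2)) *\<^sub>R \<mu>' c p"])
          (simp_all add: I[OF c] q[OF c] powr_minus inverse_eq_divide)
    qed
    show "smooth_in c (dom_of c) (f c)" if c: "c \<in> A" for c
    proof -
      note ch = smooth_atlas_chart[OF basics(3) c]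
      have "smooth_in c (dom_of c) (\<lambda>p. e c p * h c p powr (1/2))"
        by (intro smooth_in_mult[OF ch] hp e c)
      then show ?thesis
        by (subst smooth_in_cong[OF ch, where g="\<lambda>p. e c p * h c p powr (1/2)"])
          (simp_all add: f_def q[OF c])
    qed
    show "\<mu> c p = f c p *\<^sub>R I c p" if "c \<in> A" "p \<in> dom_of c" for c p
      using dn(4,7)[OF that] by (simp add: I[OF that] f_def)
    show "I d p = jac c d p ** I c p ** jac d c p" if "c \<in> A" "d \<in> A" "p \<in> dom_of c \<inter> dom_of d" for c d p
    proof -
      have p: "p \<in> dom_of c" "p \<in> dom_of d" using that by auto
      have T: "\<mu>' d p = jac c d p ** \<mu>' c p ** jac d c p"
        using dec that unfolding mu_decomposition_def section_Q_def endo_field_def transp_end_def by blast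
      have j: "jac d c p ** jac c d p = mat 1" using jac_inverse[OF basics(3) that] .
      have "jac c d p ** \<mu>' c p = \<mu>' d p ** jac c d p"
        unfolding T using j by (simp add: matrix_ring_simps)
      from conjugate_trace(2)[OF j this T] have "qnorm (\<mu>' d p) = qnorm (\<mu>' c p)" by (simp add: qnorm_def)
      then show ?thesis unfolding I[OF that(1) p(1)] I[OF that(2) p(2)] T by (simp add: matrix_ring_simps)
    qed
    show "f c p ^ (2 * (n + 1)) = qnorm (\<mu> c p) ^ (2 * (n + 1))" if "c \<in> A" "p \<in> dom_of c" for c p
      unfolding dn(4)[OF that] f_def qnorm_scaleR by (simp add: power_mult_distrib power_even_abs)
  qed
qed

private lemma curv_facts:
  assumes c: "c \<in> A" and p: "p \<in> dom_of c"
  shows "bilinear (curv \<Gamma> c p)" "curv \<Gamma> c p v u = - curv \<Gamma> c p u v"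
    "curv \<Gamma> c p u v *v w + curv \<Gamma> c p v w *v u + curv \<Gamma> c p w u *v v = 0"
    "J \<in> Q c p \<Longrightarrow> curv \<Gamma> c p u v ** J - J ** curv \<Gamma> c p u v \<in> Q c p"
proof -
  note ch = smooth_atlas_chart[OF basics(3) c]
  note G = affine_connectionD[OF basics(6) c]
  show "bilinear (curv \<Gamma> c p)" by (rule bilinear_curv[OF ch, where \<Gamma>=\<Gamma>, OF G(2,1) p])
  show "curv \<Gamma> c p v u = - curv \<Gamma> c p u v" by (simp add: curv_def algebra_simps)
  show "curv \<Gamma> c p u v *v w + curv \<Gamma> c p v w *v u + curv \<Gamma> c p w u *v v = 0"
    by (rule first_bianchi[OF ch, where \<Gamma>=\<Gamma>, OF G(2,1) p]) (use basics(7) c in \<open>auto simp: torsion_free_def\<close>)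
  show "J \<in> Q c p \<Longrightarrow> curv \<Gamma> c p u v ** J - J ** curv \<Gamma> c p u v \<in> Q c p"
    by (rule curv_preserves_Q[OF basics(3,4,6,8) c p])
qed

context
  fixes f :: "('m, 'k, real) fld"
  assumes IQ: "\<And>c p. c \<in> A \<Longrightarrow> p \<in> dom_of c \<Longrightarrow> I c p \<in> Q c p"
    and II: "\<And>c p. c \<in> A \<Longrightarrow> p \<in> dom_of c \<Longrightarrow> I c p ** I c p = - mat 1"
    and Is: "\<And>c. c \<in> A \<Longrightarrow> smooth_in c (dom_of c) (I c)"
    and fs: "\<And>c. c \<in> A \<Longrightarrow> smooth_in c (dom_of c) (f c)"
    and \<mu>f: "\<And>c p. c \<in> A \<Longrightarrow> p \<in> dom_of c \<Longrightarrow> \<mu> c p = f c p *\<^sub>R I c p"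
    and IT: "\<And>c d p. c \<in> A \<Longrightarrow> d \<in> A \<Longrightarrow> p \<in> dom_of c \<inter> dom_of d \<Longrightarrow> I d p = jac c d p ** I c p ** jac d c p"
    and fN: "\<And>c p. c \<in> A \<Longrightarrow> p \<in> dom_of c \<Longrightarrow> f c p ^ (2 * (n + 1)) = qnorm (\<mu> c p) ^ (2 * (n + 1))"
begin

section \<open>The coefficient of mu and the mu-volume\<close>

private lemma f_nonzero: "c \<in> A \<Longrightarrow> p \<in> dom_of c \<Longrightarrow> f c p \<noteq> 0"
  using \<mu>f basics(5) by fastforce

text \<open>\<open>V\<close> is the coefficient of the mu-volume. The relation e^(2(n+1)) = 1/nu of
  an associated pair makes it the inverse of f^(2(n+1)), from which its smoothness is derived; the
  last property says that the mu-connection preserves it.\<close>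

private lemma volume:
  obtains V :: "('m, 'k, real) fld" where
    "\<And>c p. c \<in> A \<Longrightarrow> p \<in> dom_of c \<Longrightarrow> V c p * f c p ^ (2 * (n + 1)) = 1"
    "\<And>c. c \<in> A \<Longrightarrow> smooth_in c (dom_of c) (V c)"
    "\<And>c p u. c \<in> A \<Longrightarrow> p \<in> dom_of c \<Longrightarrow> pd c (V c) u p = trace (\<Gamma> c p u) * V c p"
proof -
  obtain V e \<nu> \<mu>' where dec: "mu_decomposition n A Q \<mu> e \<nu> \<mu>'"
    and V: "\<And>c p. c \<in> A \<Longrightarrow> p \<in> dom_of c \<Longrightarrow> V c p = \<nu> c p / qnorm (\<mu>' c p) ^ (2 * (n + 1))"
    and par: "\<And>c p u. c \<in> A \<Longrightarrow> p \<in> dom_of c \<Longrightarrow> cov_L \<Gamma> 1 c (V c) u p = 0"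
    using mu unfolding mu_connection_def mu_volume_def by blast
  note dn = decomposition_nonzero[OF dec]
  have Vf: "V c p * f c p ^ (2 * (n + 1)) = 1" if "c \<in> A" "p \<in> dom_of c" for c p
  proof -
    have "f c p ^ (2 * (n + 1)) = e c p ^ (2 * (n + 1)) * qnorm (\<mu>' c p) ^ (2 * (n + 1))"
      unfolding fN[OF that] dn(4)[OF that] qnorm_scaleR by (simp add: power_mult_distrib power_even_abs)
    then show ?thesis unfolding V[OF that] dn(6)[OF that] using dn(5,7)[OF that] by simp
  qed
  show ?thesis
  proof (rule that[of V, OF Vf])
    fix c assume c: "c \<in> A"
    note ch = smooth_atlas_chart[OF basics(3) c]
    \<comment> \<open>\<open>f\<close> may be negative, so the real power is taken of its positive
      square.\<close>
    have sm: "smooth_in c (dom_of c) (\<lambda>p. (f c p * f c p) powr (- real (n + 1)))"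
      by (intro smooth_in_powr[OF ch] smooth_in_mult[OF ch] fs c)
        (use f_nonzero[OF c] not_real_square_gt_zero in blast)
    have Veq: "V c p = (f c p * f c p) powr (- real (n + 1))" if p: "p \<in> dom_of c" for p
    proof -
      have "(f c p * f c p) powr (real (n + 1)) = (f c p * f c p) ^ (n + 1)"
        by (rule powr_realpow) (use f_nonzero[OF c p] not_real_square_gt_zero in blast)
      also have "\<dots> = f c p ^ (2 * (n + 1))" by (simp only: power_mult power2_eq_square)
      finally have "(f c p * f c p) powr (- real (n + 1)) = 1 / f c p ^ (2 * (n + 1))"
        unfolding powr_minus by (simp add: inverse_eq_divide)
      moreover have "V c p = 1 / f c p ^ (2 * (n + 1))"
        by (simp only: nonzero_eq_divide_eq[OF power_not_zero[OF f_nonzero[OF c p]]] Vf[OF c p])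
      ultimately show ?thesis by metis
    qed
    show "smooth_in c (dom_of c) (V c)"
      by (rule smooth_in_cong[OF ch Veq, THEN iffD2, OF _ sm])
  next
    fix c p u assume "c \<in> A" "p \<in> dom_of c"
    from par[OF this] show "pd c (V c) u p = trace (\<Gamma> c p u) * V c p" by (simp add: cov_L_def)
  qed
qed

text \<open>Differentiating V f^(2(n+1)) = 1 with \<open>V\<close> parallel shows that
  \<open>f\<close> is parallel for the connection of weight s0 = -1/(2(n+1)).\<close>

private lemma pd_f:
  assumes c: "c \<in> A" and p: "p \<in> dom_of c"
  shows "pd c (f c) u p = - trace (\<Gamma> c p u) * f c p / (2 * (n + 1))"
proof -
  obtain V :: "('m, 'k, real) fld" where
    Vf: "\<And>c p. c \<in> A \<Longrightarrow> p \<in> dom_of c \<Longrightarrow> V c p * f c p ^ (2 * (n + 1)) = 1" and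
    Vs: "\<And>c. c \<in> A \<Longrightarrow> smooth_in c (dom_of c) (V c)" and
    dV: "\<And>c p u. c \<in> A \<Longrightarrow> p \<in> dom_of c \<Longrightarrow> pd c (V c) u p = trace (\<Gamma> c p u) * V c p"
    using volume by metis
  note ch = smooth_atlas_chart[OF basics(3) c]
  have sp: "smooth_in c (dom_of c) (\<lambda>q. f c q ^ N)" for N
    by (induction N) (auto intro: smooth_in_const smooth_in_mult[OF ch fs[OF c]])
  have "pd c (\<lambda>q. V c q * f c q ^ (2 * (n + 1))) u p = pd c (\<lambda>q. 1) u p"
    by (rule pd_cong[OF ch p]) (use Vf[OF c] in simp)
  then have "V c p * (real (2 * (n + 1)) * f c p ^ (2 * (n + 1) - 1) * pd c (f c) u p) +
     trace (\<Gamma> c p u) * V c p * f c p ^ (2 * (n + 1)) = 0"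
    by (simp only: pd_const[OF ch] pd_mult[OF ch p Vs[OF c] sp] pd_power[OF ch p fs[OF c]] dV[OF c p])
  moreover have "f c p ^ (2 * (n + 1)) = f c p ^ (2 * (n + 1) - 1) * f c p" by simp
  ultimately have "V c p * f c p ^ (2 * (n + 1) - 1) * (real (2 * (n + 1)) * pd c (f c) u p + trace (\<Gamma> c p u) * f c p) = 0"
    by (simp only: distrib_left mult_ac)
  moreover have "V c p \<noteq> 0" using Vf[OF c p] by auto
  ultimately have "real (2 * (n + 1)) * pd c (f c) u p + trace (\<Gamma> c p u) * f c p = 0"
    using f_nonzero[OF c p] by simp
  then show ?thesis by (simp add: field_simps)
qed

text \<open>\<open>V\<close> is a nowhere zero parallel density; commuting its second derivatives
  shows that the induced connection on densities is flat.\<close>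

private lemma trace_curv_zero:
  assumes c: "c \<in> A" and p: "p \<in> dom_of c"
  shows "trace (curv \<Gamma> c p u v) = 0"
proof -
  obtain V :: "('m, 'k, real) fld" where
    Vf: "\<And>c p. c \<in> A \<Longrightarrow> p \<in> dom_of c \<Longrightarrow> V c p * f c p ^ (2 * (n + 1)) = 1" and
    Vs: "\<And>c. c \<in> A \<Longrightarrow> smooth_in c (dom_of c) (V c)" and
    dV: "\<And>c p u. c \<in> A \<Longrightarrow> p \<in> dom_of c \<Longrightarrow> pd c (V c) u p = trace (\<Gamma> c p u) * V c p"
    using volume by metis
  note ch = smooth_atlas_chart[OF basics(3) c]
  note G = affine_connectionD(2)[OF basics(6) c]
  have dd: "pd c (pd c (V c) v) u p = trace (\<Gamma> c p v) * (trace (\<Gamma> c p u) * V c p) + pd c (\<lambda>q. trace (\<Gamma> c q v)) u p * V c p" for u v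
  proof -
    have "pd c (pd c (V c) v) u p = pd c (\<lambda>q. trace (\<Gamma> c q v) * V c q) u p"
      by (rule pd_cong[OF ch p]) (rule dV[OF c])
    also have "\<dots> = trace (\<Gamma> c p v) * (trace (\<Gamma> c p u) * V c p) + pd c (\<lambda>q. trace (\<Gamma> c q v)) u p * V c p"
      using pd_mult[OF ch p smooth_in_trace[OF ch G] Vs[OF c]] by (simp add: dV[OF c p])
    finally show ?thesis .
  qed
  have "pd c (pd c (V c) v) u p = pd c (pd c (V c) u) v p" by (rule pd_commute[OF ch p Vs[OF c]])
  then have "trace (curv \<Gamma> c p u v) * V c p = 0"
    unfolding dd trace_curv[OF ch, where \<Gamma>=\<Gamma>, OF G p] by (simp add: algebra_simps)
  then show ?thesis using Vf[OF c p] by auto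
qed

private lemma parallel_I:
  assumes c: "c \<in> A" and p: "p \<in> dom_of c"
  shows "cov_end \<Gamma> c (I c) u p = 0"
proof -
  note ch = smooth_atlas_chart[OF basics(3) c]
  obtain \<Gamma>0 where "quaternionic_connection A Q \<Gamma>0" and tw: "twistor_equation n A Q \<Gamma>0 \<mu>"
    using qcm unfolding quaternionic_complex_manifold_def twistor_function_def by blast
  then have \<Gamma>0: "affine_connection A \<Gamma>0" "torsion_free A \<Gamma>0" "preserves_Q A Q \<Gamma>0"
    by (auto simp: quaternionic_connection_def)
  \<comment> \<open>In a chart, sections of L^s0 are functions, so the constant 1 is an admissible
    choice of \<open>e\<close> on the whole chart domain.\<close>
  have "\<exists>\<xi>. (\<forall>p\<in>dom_of c. linear (\<xi> p)) \<and> (\<forall>u. smooth_in c (dom_of c) (\<lambda>p. \<xi> p u)) \<and>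
      (\<forall>p\<in>dom_of c. \<forall>I1 I2 I3. admissible_frame (Q c p) I1 I2 I3 \<longrightarrow>
             (\<forall>u. cov_QL \<Gamma>0 (s0 n) c (\<mu> c) u p =
                1 *\<^sub>R (\<xi> p (I1 *v u) *\<^sub>R I1 + \<xi> p (I2 *v u) *\<^sub>R I2 + \<xi> p (I3 *v u) *\<^sub>R I3)))"
    using tw[unfolded twistor_equation_def, rule_format, OF c, of "dom_of c" "\<lambda>_. 1"] ch smooth_in_const[of c "dom_of c" 1] by simp
  then obtain \<xi> where \<xi>: "\<And>p. p \<in> dom_of c \<Longrightarrow> linear (\<xi> p)"
    and eq: "\<And>p I1 I2 I3 u. p \<in> dom_of c \<Longrightarrow> admissible_frame (Q c p) I1 I2 I3 \<Longrightarrow>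
      cov_QL \<Gamma>0 (s0 n) c (\<mu> c) u p = \<xi> p (I1 *v u) *\<^sub>R I1 + \<xi> p (I2 *v u) *\<^sub>R I2 + \<xi> p (I3 *v u) *\<^sub>R I3"
    by (metis scaleR_one)
  obtain J1 J2 J3 where "admissible_frame (Q c p) J1 J2 J3" using frame_exists[OF c p] .
  then obtain K where frame: "admissible_frame (Q c p) (I c p) K (I c p ** K)"
    using adapted_frame IQ[OF c p] II[OF c p] by blast
  define D where "D u = \<Gamma> c p u - \<Gamma>0 c p u" for u
  have lin: "linear D" unfolding D_def
    by (intro linear_compose_sub affine_connectionD(1)[OF basics(6) c p] affine_connectionD(1)[OF \<Gamma>0(1) c p])
  have sym: "D u *v v = D v *v u" for u v
    using basics(7) \<Gamma>0(2) c p by (simp add: D_def torsion_free_def matrix_vector_mult_diff_rdistrib)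
  have DV: "D u ** J - J ** D u \<in> Q c p" if J: "J \<in> Q c p" for u J
  proof -
    obtain U \<sigma> where U: "open U" "p \<in> U" "U \<subseteq> dom_of c" and \<sigma>: "smooth_in c U \<sigma>" "\<And>q. q \<in> U \<Longrightarrow> \<sigma> q \<in> Q c q" "\<sigma> p = J"
      using section_through[OF basics(3) conjunct1[OF basics(4)[unfolded almost_quaternionic_def]] c p J] by blast
    have "cov_end \<Gamma> c \<sigma> u p \<in> Q c p" "cov_end \<Gamma>0 c \<sigma> u p \<in> Q c p"
      by (rule preserves_QD[OF basics(8) c U(1,3) \<sigma>(1,2) U(2)], assumption)
        (rule preserves_QD[OF \<Gamma>0(3) c U(1,3) \<sigma>(1,2) U(2)], assumption)
    then have "cov_end \<Gamma> c \<sigma> u p - cov_end \<Gamma>0 c \<sigma> u p \<in> Q c p"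
      using subspace_fiber[OF basics(4) c p] by (simp add: subspace_diff)
    moreover have "cov_end \<Gamma> c \<sigma> u p - cov_end \<Gamma>0 c \<sigma> u p = D u ** J - J ** D u"
      by (simp add: cov_end_def D_def \<sigma>(3) matrix_ring_simps)
    ultimately show ?thesis by simp
  qed
  \<comment> \<open>Differentiating I^2 = -1 makes the trace of I times its partial derivative
    vanish, and a commutator with I has zero trace against I.\<close>
  have X: "trace (I c p ** cov_end \<Gamma> c (I c) u p) = 0" for u
  proof -
    have "pd c (\<lambda>q. I c q ** I c q) u p = pd c (\<lambda>q. - mat 1) u p"
      by (rule pd_cong[OF ch p]) (rule II[OF c])
    then have "I c p ** pd c (I c) u p + pd c (I c) u p ** I c p = 0"
      by (simp add: pd_const[OF ch] pd_matrix_mult[OF ch p Is[OF c] Is[OF c]])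
    from arg_cong[OF this, of trace] have "trace (I c p ** pd c (I c) u p) = 0"
      by (simp add: trace_simps trace_mul_sym[of "pd c (I c) u p"])
    moreover have "cov_end \<Gamma> c (I c) u p = pd c (I c) u p + (\<Gamma> c p u ** I c p - I c p ** \<Gamma> c p u)"
      by (simp add: cov_end_def)
    ultimately show ?thesis by (simp only: matrix_mult_add_right trace_add trace_commutator)
  qed
  have "f c p *\<^sub>R (cov_end \<Gamma> c (I c) u p - (D u ** I c p - I c p ** D u)) - (trace (D u) * f c p / (2 * (n + 1))) *\<^sub>R I c p =
      \<xi> p (I c p *v u) *\<^sub>R I c p + \<xi> p (K *v u) *\<^sub>R K + \<xi> p ((I c p ** K) *v u) *\<^sub>R (I c p ** K)" for u
  proof -
    have "pd c (\<mu> c) u p = pd c (\<lambda>q. f c q *\<^sub>R I c q) u p" by (rule pd_cong[OF ch p \<mu>f[OF c]])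
    then have d: "pd c (\<mu> c) u p = f c p *\<^sub>R pd c (I c) u p + pd c (f c) u p *\<^sub>R I c p"
      by (simp add: pd_scaleR[OF ch p fs[OF c] Is[OF c]])
    have t: "trace (D u) = trace (\<Gamma> c p u) - trace (\<Gamma>0 c p u)" by (simp add: D_def trace_simps)
    \<comment> \<open>By \<open>pd_f\<close> the derivative of \<open>f\<close> is s0 times the
      trace of \<open>\<Gamma>\<close>; subtracting the same term for \<open>\<Gamma>0\<close>
      leaves only the trace of \<open>D\<close>.\<close>
    have s: "pd c (f c) u p - s0 n * trace (\<Gamma>0 c p u) * f c p = - (trace (D u) * f c p / (2 * (n + 1)))"
    proof -
      have "s0 n = - 1 / (2 * (n + 1))" by (simp add: s0_def)
      moreover have "- g * h / N - - 1 / N * g' * h = - ((g - g') * h / N)" for g g' h N :: real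
        by (simp add: Rings.left_diff_distrib diff_divide_distrib)
      ultimately show ?thesis unfolding pd_f[OF c p] t by metis
    qed
    have "cov_QL \<Gamma>0 (s0 n) c (\<mu> c) u p = f c p *\<^sub>R (cov_end \<Gamma> c (I c) u p - (D u ** I c p - I c p ** D u))
      + (pd c (f c) u p - s0 n * trace (\<Gamma>0 c p u) * f c p) *\<^sub>R I c p"
      by (simp add: cov_QL_def cov_end_def d \<mu>f[OF c p] D_def matrix_ring_simps algebra_simps)
    then show ?thesis unfolding s using eq[OF p frame, of u] by simp
  qed
  from twistor_equation_parallel[OF frame lin sym DV basics(2,1) f_nonzero[OF c p] \<xi>[OF p] X this]
  show ?thesis .
qed

private lemma complex_connection_mu: "complex_connection A I \<Gamma>"
  using basics(6) parallel_I by (simp add: complex_connection_def)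

private lemma ricci_trace:
  assumes c: "c \<in> A" and p: "p \<in> dom_of c"
  shows "ricci_form I \<Gamma> c p u v = - trace (I c p ** curv \<Gamma> c p u v) / 2"
proof -
  obtain J1 J2 J3 where "admissible_frame (Q c p) J1 J2 J3" using frame_exists[OF c p] .
  then obtain K where frame: "admissible_frame (Q c p) (I c p) K (I c p ** K)"
    using adapted_frame IQ[OF c p] II[OF c p] by blast
  note ch = smooth_atlas_chart[OF basics(3) c]
  have "curv \<Gamma> c p u v ** I c p = I c p ** curv \<Gamma> c p u v" for u v
    by (rule parallel_commutes_curv[OF ch p, where \<Gamma>=\<Gamma>, OF affine_connectionD(2)[OF basics(6) c] Is[OF c]])
      (rule parallel_I[OF c])
  from quaternionic_ricci[OF frame curv_facts(1,2,3)[OF c p] trace_curv_zero[OF c p] curv_facts(4)[OF c p] this basics(2,1)]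
  show ?thesis by (simp add: ricci_form_def Ric_def)
qed

section \<open>Closedness and de Rham class of the Ricci form\<close>

private definition \<rho> where "\<rho> = (\<lambda>c p X Y. complex_of_real (- (1 / (2 * pi)) * ricci_form I \<Gamma> c p X Y))"

private lemma \<rho>_trace: "c \<in> A \<Longrightarrow> p \<in> dom_of c \<Longrightarrow>
    \<rho> c p u v = complex_of_real ((1 / (4 * pi)) * trace (I c p ** curv \<Gamma> c p u v))"
  by (simp add: \<rho>_def ricci_trace)

private lemma smooth_in_trace_I_curv:
  assumes c: "c \<in> A" shows "smooth_in c (dom_of c) (\<lambda>p. trace (I c p ** curv \<Gamma> c p u v))"
proof -
  note ch = smooth_atlas_chart[OF basics(3) c]
  show ?thesis
    by (intro smooth_in_rules[OF ch] Is[OF c] smooth_in_curv[OF ch, where \<Gamma>=\<Gamma>, OF affine_connectionD(2)[OF basics(6) c]])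
qed

private lemma closed_\<rho>: "closed_two_form A \<rho>"
  unfolding closed_two_form_def two_form_def
proof (intro conjI ballI allI)
  fix c assume c: "c \<in> A"
  note ch = smooth_atlas_chart[OF basics(3) c]
  note G = affine_connectionD[OF basics(6) c]
  let ?F = "\<lambda>u v p. complex_of_real ((1 / (4 * pi)) * trace (I c p ** curv \<Gamma> c p u v))"
  have sm: "smooth_in c (dom_of c) (?F u v)" for u v
    by (intro smooth_in_rules[OF ch] smooth_in_trace_I_curv c)
  show "smooth_in c (dom_of c) (\<lambda>p. \<rho> c p u v)" for u v
    using sm[of u v] by (subst smooth_in_cong[OF ch \<rho>_trace[OF c]])
  show "pd c (\<lambda>q. \<rho> c q v w) u p - pd c (\<lambda>q. \<rho> c q u w) v p + pd c (\<lambda>q. \<rho> c q u v) w p = 0"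
    if p: "p \<in> dom_of c" for p u v w
  proof -
    have "pd c (\<lambda>q. \<rho> c q v w) u p = complex_of_real ((1 / (4 * pi)) * pd c (\<lambda>q. trace (I c q ** curv \<Gamma> c q v w)) u p)" for u v w
    proof -
      have "pd c (\<lambda>q. \<rho> c q v w) u p = pd c (?F v w) u p"
        by (rule pd_cong[OF ch p \<rho>_trace[OF c]])
      also have "\<dots> = complex_of_real ((1 / (4 * pi)) * pd c (\<lambda>q. trace (I c q ** curv \<Gamma> c q v w)) u p)"
        by (simp only: pd_complex_of_real[OF ch p smooth_in_mult[OF ch smooth_in_const smooth_in_trace_I_curv[OF c]]]
            pd_mult[OF ch p smooth_in_const smooth_in_trace_I_curv[OF c]] pd_const[OF ch]) simp
      finally show ?thesis .
    qed
    moreover have "(1 / (4 * pi)) * (pd c (\<lambda>q. trace (I c q ** curv \<Gamma> c q v w)) u p - pd c (\<lambda>q. trace (I c q ** curv \<Gamma> c q u w)) v p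
        + pd c (\<lambda>q. trace (I c q ** curv \<Gamma> c q u v)) w p) = 0"
      using trace_curv_closed[OF ch, where \<Gamma>=\<Gamma>, OF G(2) p Is[OF c] parallel_I[OF c p]] by simp
    ultimately show ?thesis
      by (simp only: of_real_diff[symmetric] of_real_add[symmetric] ring_distribs) (simp only: of_real_0)
  qed
  fix p assume p: "p \<in> dom_of c"
  show "\<rho> c p u u = 0" for u
    by (simp add: \<rho>_trace[OF c p] curv_def matrix_ring_simps trace_simps)
  note bil = curv_facts(1)[OF c p]
  show "bilinear (\<rho> c p)"
    unfolding bilinear_def
    by (auto intro!: linearI simp: \<rho>_trace[OF c p] bilinear_ladd[OF bil] bilinear_radd[OF bil] bilinear_lmul[OF bil]
      bilinear_rmul[OF bil] matrix_ring_simps trace_simps complex_eq_iff algebra_simps add_divide_distrib)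
next
  fix c d p u v assume c: "c \<in> A" and d: "d \<in> A" and p: "p \<in> dom_of c \<inter> dom_of d"
  have p': "p \<in> dom_of c" "p \<in> dom_of d" using p by auto
  show "\<rho> c p u v = \<rho> d p (jac c d p *v u) (jac c d p *v v)"
    using conjugate_trace(2)[OF jac_inverse[OF basics(3) c d p] curv_change_chart[OF basics(3) c d basics(6,7) p] IT[OF c d p]]
    by (simp add: \<rho>_trace[OF c p'(1)] \<rho>_trace[OF d p'(2)])
qed

text \<open>The primitive is built from the difference \<open>a\<close> of the connections. Its real
  part transgresses tr(I R). Its imaginary part, from tr a, accounts for the real trace of the
  curvature of \<open>D\<close>, since that of the mu-connection is zero.\<close>

private lemma chern_cohomologous:
  assumes D: "complex_connection A I D"
  shows "cohomologous A (chern_form I D) \<rho>"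
proof -
  have Da: "affine_connection A D" and DI: "\<And>c p u. c \<in> A \<Longrightarrow> p \<in> dom_of c \<Longrightarrow> cov_end D c (I c) u p = 0"
    using D by (auto simp: complex_connection_def)
  define a where "a c p u = D c p u - \<Gamma> c p u" for c p u
  define \<eta> :: "('m, 'k) form1" where
    "\<eta> c p u = complex_of_real ((1 / (4 * pi)) * trace (I c p ** a c p u)) + \<i> * complex_of_real ((1 / (4 * pi)) * trace (a c p u))" for c p u
  have as: "smooth_in c (dom_of c) (\<lambda>p. a c p u)" if c: "c \<in> A" for c u
    unfolding a_def
    by (intro smooth_in_diff[OF smooth_atlas_chart[OF basics(3) c]] affine_connectionD(2)[OF basics(6) c] affine_connectionD(2)[OF Da c])
  have \<eta>: "one_form A \<eta>"
    unfolding one_form_def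
  proof (intro conjI ballI allI)
    fix c assume c: "c \<in> A"
    note ch = smooth_atlas_chart[OF basics(3) c]
    show "smooth_in c (dom_of c) (\<lambda>p. \<eta> c p u)" for u
      unfolding \<eta>_def by (intro smooth_in_rules[OF ch] as Is c)
    fix p assume p: "p \<in> dom_of c"
    have "linear (a c p)"
      unfolding a_def by (intro linear_compose_sub affine_connectionD(1)[OF basics(6) c p] affine_connectionD(1)[OF Da c p])
    then show "linear (\<eta> c p)"
      by (auto intro!: linearI simp: \<eta>_def linear_add linear_cmul matrix_ring_simps trace_simps complex_eq_iff algebra_simps add_divide_distrib)
  next
    fix c d p u assume c: "c \<in> A" and d: "d \<in> A" and p: "p \<in> dom_of c \<inter> dom_of d"
    have "jac c d p ** a c p u = a d p (jac c d p *v u) ** jac c d p"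
      using connection_change_chart[OF basics(3) c d basics(6) p, of u] connection_change_chart[OF basics(3) c d Da p, of u]
      by (simp add: a_def matrix_ring_simps)
    note ct = conjugate_trace[OF jac_inverse[OF basics(3) c d p] this]
    show "\<eta> c p u = \<eta> d p (jac c d p *v u)"
      using ct(1) ct(2)[OF IT[OF c d p]] by (simp add: \<eta>_def)
  qed
  have "chern_form I D c p u v - \<rho> c p u v = pd c (\<lambda>q. \<eta> c q v) u p - pd c (\<lambda>q. \<eta> c q u) v p"
    if c: "c \<in> A" and p: "p \<in> dom_of c" for c p u v
  proof -
    note ch = smooth_atlas_chart[OF basics(3) c]
    note G = affine_connectionD(2)[OF basics(6) c] and DG = affine_connectionD(2)[OF Da c]
    have "I c p ** curv D c p u v = curv D c p u v ** I c p"
      by (rule parallel_commutes_curv[OF ch p, where \<Gamma>=D, OF DG Is[OF c] DI[OF c], symmetric])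
    then have chern: "chern_form I D c p u v =
       complex_of_real ((1 / (4 * pi)) * trace (I c p ** curv D c p u v)) + \<i> * complex_of_real ((1 / (4 * pi)) * trace (curv D c p u v))"
      by (simp add: chern_form_def complex_trace_eq[OF II[OF c p]] complex_eq_iff)
    have pd\<eta>: "pd c (\<lambda>q. \<eta> c q v) u p =
      complex_of_real ((1 / (4 * pi)) * pd c (\<lambda>q. trace (I c q ** a c q v)) u p) + \<i> * complex_of_real ((1 / (4 * pi)) * pd c (\<lambda>q. trace (a c q v)) u p)" for u v
    proof -
      have s: "smooth_in c (dom_of c) (\<lambda>q. trace (I c q ** a c q v))" "smooth_in c (dom_of c) (\<lambda>q. trace (a c q v))"
        by (intro smooth_in_rules[OF ch] as Is c)+
      show ?thesis
        unfolding \<eta>_def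
        by (simp only: pd_add[OF ch p] pd_mult[OF ch p] pd_const[OF ch] pd_complex_of_real[OF ch p] s
            smooth_in_rules[OF ch] mult_zero_left add_0_right)
    qed
    have "trace (I c p ** curv D c p u v) - trace (I c p ** curv \<Gamma> c p u v) =
       pd c (\<lambda>q. trace (I c q ** a c q v)) u p - pd c (\<lambda>q. trace (I c q ** a c q u)) v p"
      unfolding a_def
      by (rule trace_transgression[OF ch, where \<Gamma>=\<Gamma> and D=D, OF G p DG Is[OF c] parallel_I[OF c p] DI[OF c p]])
    moreover have "trace (curv D c p u v) = pd c (\<lambda>q. trace (a c q v)) u p - pd c (\<lambda>q. trace (a c q u)) v p"
    proof -
      have "pd c (\<lambda>q. trace (a c q v)) u p = pd c (\<lambda>q. trace (D c q v)) u p - pd c (\<lambda>q. trace (\<Gamma> c q v)) u p" for u v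
        unfolding a_def trace_sub by (rule pd_diff[OF ch p smooth_in_trace[OF ch DG] smooth_in_trace[OF ch G]])
      then show ?thesis
        using trace_curv_zero[OF c p, of u v]
        by (simp add: trace_curv[OF ch, where \<Gamma>=\<Gamma>, OF G p] trace_curv[OF ch, where \<Gamma>=D, OF DG p])
    qed
    ultimately show ?thesis
      unfolding chern \<rho>_trace[OF c p] pd\<eta> by (simp add: complex_eq_iff right_diff_distrib[symmetric] diff_divide_distrib[symmetric])
  qed
  then show ?thesis unfolding cohomologous_def using \<eta> by blast
qed

text \<open>All members of the union coincide, and the mu-connection, being itself complex, shows
  that the union is not empty.\<close>

private lemma first_chern_class_\<rho>: "first_chern_class A I = derham_class A \<rho>"
proof -
  have "derham_class A (chern_form I D) = derham_class A \<rho>" if "complex_connection A I D" for D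
    by (rule derham_class_eq[OF basics(3) chern_cohomologous[OF that]])
  then show ?thesis unfolding first_chern_class_def using complex_connection_mu by blast
qed

text \<open>The conclusion relative to a factorization of mu as \<open>f\<close> times
  \<open>I\<close>; \<open>I_props\<close> provides such an \<open>f\<close>.\<close>

lemma chern_class_given_factorization:
  "closed_two_form A (\<lambda>c p X Y. complex_of_real (- (1 / (2 * pi)) * ricci_form I \<Gamma> c p X Y)) \<and>
   first_chern_class A I = derham_class A (\<lambda>c p X Y. complex_of_real (- (1 / (2 * pi)) * ricci_form I \<Gamma> c p X Y))"
  using closed_\<rho> first_chern_class_\<rho> unfolding \<rho>_def by blast

end

lemma ricci_form_represents_chern_class:
  "closed_two_form A (\<lambda>c p X Y. complex_of_real (- (1 / (2 * pi)) * ricci_form I \<Gamma> c p X Y)) \<and>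
   first_chern_class A I = derham_class A (\<lambda>c p X Y. complex_of_real (- (1 / (2 * pi)) * ricci_form I \<Gamma> c p X Y))"
proof -
  obtain f :: "('m, 'k, real) fld" where
    "\<And>c p. c \<in> A \<Longrightarrow> p \<in> dom_of c \<Longrightarrow> I c p \<in> Q c p"
    "\<And>c p. c \<in> A \<Longrightarrow> p \<in> dom_of c \<Longrightarrow> I c p ** I c p = - mat 1"
    "\<And>c. c \<in> A \<Longrightarrow> smooth_in c (dom_of c) (I c)"
    "\<And>c. c \<in> A \<Longrightarrow> smooth_in c (dom_of c) (f c)"
    "\<And>c p. c \<in> A \<Longrightarrow> p \<in> dom_of c \<Longrightarrow> \<mu> c p = f c p *\<^sub>R I c p"
    "\<And>c d p. c \<in> A \<Longrightarrow> d \<in> A \<Longrightarrow> p \<in> dom_of c \<inter> dom_of d \<Longrightarrow> I d p = jac c d p ** I c p ** jac d c p"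
    "\<And>c p. c \<in> A \<Longrightarrow> p \<in> dom_of c \<Longrightarrow> f c p ^ (2 * (n + 1)) = qnorm (\<mu> c p) ^ (2 * (n + 1))"
    by (rule I_props) blast
  then show ?thesis by (rule chern_class_given_factorization)
qed

end

theorem theorem4p5:
  fixes n :: nat
    and A :: "('m::{t2_space,second_countable_topology}, 'k::finite) atlas"
    and Q :: "('m, 'k) qbundle"
    and \<mu> I\<^sub>1 :: "('m, 'k, real^'k^'k) fld"
    and nabla_mu :: "('m, 'k) conn"
  assumes "quaternionic_complex_manifold n A Q \<mu>"
    and "induced_complex_structure n A Q \<mu> I\<^sub>1"
    and "mu_connection n A Q \<mu> nabla_mu"
  defines "\<rho> \<equiv> (\<lambda>c p X Y. complex_of_real (- (1 / (2 * pi)) * ricci_form I\<^sub>1 nabla_mu c p X Y))"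
  shows "closed_two_form A \<rho> \<and> first_chern_class A I\<^sub>1 = derham_class A \<rho>"
  unfolding \<rho>_def by (rule ricci_form_represents_chern_class[OF assms(1-3)])

end
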